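(* Let $R$ be a one-dimensional complete local domain as in the context, with embedding dimension $n$, reduced type $s$ and conductor $\mathfrak{C}_R\subseteq\mathfrak{m}_R^2$. Let $S=R\left[\frac{\mathfrak{C}_R}{x_1}\right]$, with $\operatorname{edim} S=n+s$, and assume that $$\operatorname{type}(R)\leq \frac{n^2-3n-2ns}{2}.$$ If $\mathfrak{m}_R^5\subseteq \mathfrak{C}_R+x_1R$, then $\tau(\Omega_R)\neq 0$.
   Context: $k$ is an algebraically closed field of characteristic $0$; $(R,\mathfrak{m}_R,k)$ is a one-dimensional complete equicharacteristic local $k$-algebra which is a domain, with residue field $k$, fraction field $Q$, integral closure $\overline{R}=k[[t]]$ and embedding dimension $n$ (edim denotes embedding dimension). Write $R=k[[x_1,\dots,x_n]]$ with $x_i=\alpha_it^{a_i}$ minimal generators of $\mathfrak{m}_R$, $\alpha_i$ units of $\overline{R}$, $\alpha_1=1$ (achieved by choice of $t$), $a_1\le\cdots\le a_n$. The conductor is $\mathfrak{C}_R=\{q\in Q:q\overline{R}\subseteq R\}$. The reduced type of $R$ is $s=\dim_k\frac{(\mathfrak{C}_R,x_1)}{(x_1)}$. $\operatorname{type}(R)$ is the Cohen-Macaulay type of $R$. $S=R[\frac{\mathfrak{C}_R}{x_1}]$ is the subring of $\overline{R}$ generated over $R$ by the set $\frac{\mathfrak{C}_R}{x_1}=\{\frac{z}{x_1}:z\in\mathfrak{C}_R\}$; when $\mathfrak{C}_R\subseteq\mathfrak{m}_R^2$ its embedding dimension is $n+s$. Write $R=k[[X_1,\dots,X_n]]/I$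 with $I=(f_1,\dots,f_m)\subseteq (X_1,\dots,X_n)^2$, $X_i\mapsto x_i$. The universally finite module of differentials $\Omega_R$ is the cokernel of the Jacobian matrix $R^m\xrightarrow{[\partial f_j/\partial x_i]}R^n$; $\tau(\Omega_R)$ is its torsion submodule. *)

theory Defs
  imports
    "HOL-Algebra.Embedded_Algebras"
    "HOL-Algebra.Ideal_Product"
    "HOL-Algebra.Generated_Rings"
    "HOL-Algebra.Ring_Divisibility"
    "HOL-Algebra.Algebraic_Closure_Type"
    "HOL-Computational_Algebra.Formal_Laurent_Series"
    "HOL-Library.Poly_Mapping"
begin

section \<open>Local rings\<close>

definition is_local :: "('b, 'c) ring_scheme \<Rightarrow> bool"
  where "is_local A \<longleftrightarrow> cring A \<and> (\<exists>!M. maximalideal M A)"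

definition max_ideal :: "('b, 'c) ring_scheme \<Rightarrow> 'b set"
  where "max_ideal A = (THE M. maximalideal M A)"

definition ideal_power :: "('b, 'c) ring_scheme \<Rightarrow> 'b set \<Rightarrow> nat \<Rightarrow> 'b set"
  where "ideal_power A I i = I [^]\<^bsub>ideals_set A\<^esub> i"

text \<open>Every coherent sequence of residues modulo the powers of \<open>I\<close> has exactly one lift, that
  is, \<open>A\<close> is the inverse limit of the rings \<open>A / I^i\<close>; this includes separatedness.\<close>

definition adically_complete :: "('b, 'c) ring_scheme \<Rightarrow> 'b set \<Rightarrow> bool"
  where "adically_complete A I \<longleftrightarrow>
    (\<forall>u :: nat \<Rightarrow> 'b.
       (\<forall>i. u i \<in> carrier A) \<and> (\<forall>i. u (Suc i) \<ominus>\<^bsub>A\<^esub> u i \<in> ideal_power A I i) \<longrightarrow>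
       (\<exists>!l. l \<in> carrier A \<and> (\<forall>i. l \<ominus>\<^bsub>A\<^esub> u i \<in> ideal_power A I i)))"

definition prime_chain :: "('b, 'c) ring_scheme \<Rightarrow> nat \<Rightarrow> (nat \<Rightarrow> 'b set) \<Rightarrow> bool"
  where "prime_chain A d P \<longleftrightarrow>
    (\<forall>i\<le>d. primeideal (P i) A) \<and> (\<forall>i<d. P i \<subset> P (Suc i))"

definition has_krull_dim :: "('b, 'c) ring_scheme \<Rightarrow> nat \<Rightarrow> bool"
  where "has_krull_dim A d \<longleftrightarrow>
    (\<exists>P. prime_chain A d P) \<and> \<not> (\<exists>P. prime_chain A (Suc d) P)"


section \<open>Subrings of the field of Laurent series\<close>

text \<open>All rings are \<open>k\<close>-subalgebras of \<open>k((t))\<close>, with \<open>k\<close> embedded by \<^const>\<open>fls_const\<close>.\<close>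

abbreviation subr :: "'a::field fls set \<Rightarrow> 'a fls ring"
  where "subr R \<equiv> ring_of_type_algebra\<lparr>carrier := R\<rparr>"

definition frac_field :: "'a::field fls set \<Rightarrow> 'a fls set"
  where "frac_field R = {a / b | a b. a \<in> R \<and> b \<in> R \<and> b \<noteq> 0}"

definition integral_over :: "'a::field fls set \<Rightarrow> 'a fls \<Rightarrow> bool"
  where "integral_over R q \<longleftrightarrow>
    (\<exists>p :: 'a fls poly.
       Polynomial.lead_coeff p = 1 \<and> (\<forall>i. Polynomial.coeff p i \<in> R) \<and> Polynomial.poly p q = 0)"

definition integral_closure :: "'a::field fls set \<Rightarrow> 'a fls set"
  where "integral_closure R = {q \<in> frac_field R. integral_over R q}"

text \<open>\<open>complete_branch R\<close>: \<open>R\<close> is a complete Noetherian local \<open>k\<close>-algebra of dimension one with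
  residue field \<open>k\<close> whose integral closure in its fraction field is \<open>k[[t]]\<close>.  It is a domain
  because it lies in the field \<open>k((t))\<close>.\<close>

definition complete_branch :: "'a::field fls set \<Rightarrow> bool"
  where "complete_branch R \<longleftrightarrow>
    subring R ring_of_type_algebra \<and>
    range fls_const \<subseteq> R \<and>
    noetherian_ring (subr R) \<and>
    is_local (subr R) \<and>
    adically_complete (subr R) (max_ideal (subr R)) \<and>
    has_krull_dim (subr R) 1 \<and>
    bij_betw (\<lambda>c. max_ideal (subr R) +>\<^bsub>subr R\<^esub> fls_const c) UNIV
      (carrier (subr R Quot max_ideal (subr R))) \<and>
    integral_closure R = range fps_to_fls"

definition conductor :: "'a::field fls set \<Rightarrow> 'a fls set"
  where "conductor R = {q \<in> frac_field R. \<forall>f \<in> integral_closure R. q * f \<in> R}"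

text \<open>The ring \<open>R[C / x]\<close>, where \<open>C\<close> is the conductor of \<open>R\<close>.\<close>

definition conductor_extension :: "'a::field fls set \<Rightarrow> 'a fls \<Rightarrow> 'a fls set"
  where "conductor_extension R x =
    generate_ring ring_of_type_algebra (R \<union> (\<lambda>z. z / x) ` conductor R)"


section \<open>Numerical invariants\<close>

text \<open>\<open>quot_dim R V J d\<close> says that \<open>V / J\<close> has dimension \<open>d\<close> over \<open>k\<close>, where \<open>J \<subseteq> V\<close> and \<open>J\<close> is a
  proper ideal of \<open>R\<close>; \<open>V / J\<close> is taken inside the \<open>k\<close>-algebra \<open>R / J\<close>.  Being a relation, it
  is false for every \<open>d\<close> when the dimension is infinite.\<close>

definition quot_dim :: "'a::field fls set \<Rightarrow> 'a fls set \<Rightarrow> 'a fls set \<Rightarrow> nat \<Rightarrow> bool"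
  where "quot_dim R V J d \<longleftrightarrow>
    ring.dimension (subr R Quot J) d
      ((\<lambda>c. J +>\<^bsub>subr R\<^esub> fls_const c) ` UNIV) ((\<lambda>v. J +>\<^bsub>subr R\<^esub> v) ` V)"

definition has_edim :: "'a::field fls set \<Rightarrow> nat \<Rightarrow> bool"
  where "has_edim R d \<longleftrightarrow>
    quot_dim R (max_ideal (subr R)) (ideal_power (subr R) (max_ideal (subr R)) 2) d"

text \<open>The ideal \<open>(C, x)\<close>, with \<open>C\<close> the conductor.\<close>

definition conductor_plus :: "'a::field fls set \<Rightarrow> 'a fls \<Rightarrow> 'a fls set"
  where "conductor_plus R x = conductor R <+>\<^bsub>subr R\<^esub> PIdl\<^bsub>subr R\<^esub> x"

definition has_reduced_type :: "'a::field fls set \<Rightarrow> 'a fls \<Rightarrow> nat \<Rightarrow> bool"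
  where "has_reduced_type R x s \<longleftrightarrow> quot_dim R (conductor_plus R x) (PIdl\<^bsub>subr R\<^esub> x) s"

text \<open>The Cohen-Macaulay type of a one-dimensional Cohen-Macaulay local ring is the dimension of
  the socle \<open>(x : m) / (x)\<close> of \<open>R / (x)\<close>; it does not depend on the parameter \<open>x\<close>.\<close>

definition has_cm_type :: "'a::field fls set \<Rightarrow> 'a fls \<Rightarrow> nat \<Rightarrow> bool"
  where "has_cm_type R x r \<longleftrightarrow>
    quot_dim R {z \<in> R. \<forall>y \<in> max_ideal (subr R). y * z \<in> PIdl\<^bsub>subr R\<^esub> x} (PIdl\<^bsub>subr R\<^esub> x) r"


section \<open>Power series in several variables\<close>

text \<open>An element of \<open>k[[X_1, ..., X_n]]\<close> is its family of coefficients, indexed by exponent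
  vectors supported in \<open>{1..n}\<close>.\<close>

definition monomials :: "nat \<Rightarrow> (nat \<Rightarrow>\<^sub>0 nat) set"
  where "monomials n = {e. Poly_Mapping.keys e \<subseteq> {1..n}}"

definition total_degree :: "(nat \<Rightarrow>\<^sub>0 nat) \<Rightarrow> nat"
  where "total_degree e = (\<Sum>i\<in>Poly_Mapping.keys e. Poly_Mapping.lookup e i)"

definition mps :: "nat \<Rightarrow> ((nat \<Rightarrow>\<^sub>0 nat) \<Rightarrow> 'a::field) ring"
  where "mps n =
    \<lparr>carrier = {f. \<forall>e. e \<notin> monomials n \<longrightarrow> f e = 0},
     monoid.mult = (\<lambda>f g e. \<Sum>(a, b)\<in>{(a, b). a + b = e}. f a * g b),
     one = (\<lambda>e. if e = 0 then 1 else 0),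
     ring.zero = (\<lambda>e. 0),
     add = (\<lambda>f g e. f e + g e)\<rparr>"

definition mps_var :: "nat \<Rightarrow> (nat \<Rightarrow>\<^sub>0 nat) \<Rightarrow> 'a::field"
  where "mps_var i = (\<lambda>e. if e = Poly_Mapping.single i 1 then 1 else 0)"

text \<open>Formal partial derivative with respect to \<open>X_i\<close>.\<close>

definition mps_deriv :: "nat \<Rightarrow> ((nat \<Rightarrow>\<^sub>0 nat) \<Rightarrow> 'a::field) \<Rightarrow> (nat \<Rightarrow>\<^sub>0 nat) \<Rightarrow> 'a"
  where "mps_deriv i f =
    (\<lambda>e. of_nat (Suc (Poly_Mapping.lookup e i)) * f (e + Poly_Mapping.single i 1))"

text \<open>Substitution of \<open>x_1, ..., x_n\<close> into \<open>f\<close>, for \<open>x_i \<in> t k[[t]]\<close>.  A monomial of total degree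
  larger than \<open>j\<close> then has order larger than \<open>j\<close>, so the coefficient of \<open>t^j\<close> is a finite sum.\<close>

definition mps_eval :: "nat \<Rightarrow> (nat \<Rightarrow> 'a::field fls) \<Rightarrow> ((nat \<Rightarrow>\<^sub>0 nat) \<Rightarrow> 'a) \<Rightarrow> 'a fls"
  where "mps_eval n x f = fps_to_fls (Abs_fps (\<lambda>j.
    \<Sum>e\<in>{e \<in> monomials n. total_degree e \<le> j}.
      f e * fls_nth (\<Prod>i\<in>{1..n}. x i ^ Poly_Mapping.lookup e i) (int j)))"


section \<open>Differentials and torsion\<close>

text \<open>The fields \<open>mult\<close> and \<open>one\<close> of a module record are not used.\<close>

definition free_module :: "'a::field fls set \<Rightarrow> nat \<Rightarrow> ('a fls, nat \<Rightarrow> 'a fls) module"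
  where "free_module R n =
    \<lparr>carrier = {1..n} \<rightarrow>\<^sub>E R, monoid.mult = undefined, one = undefined,
     ring.zero = (\<lambda>i\<in>{1..n}. 0),
     add = (\<lambda>v w. \<lambda>i\<in>{1..n}. v i + w i),
     module.smult = (\<lambda>r v. \<lambda>i\<in>{1..n}. r * v i)\<rparr>"

definition quotient_module :: "('r, 'b) module \<Rightarrow> 'b set \<Rightarrow> ('r, 'b set) module"
  where "quotient_module M N =
    \<lparr>carrier = a_rcosets\<^bsub>M\<^esub> N, monoid.mult = undefined, one = undefined,
     ring.zero = N,
     add = set_add M,
     module.smult = (\<lambda>r W. \<Union>w\<in>W. N +>\<^bsub>M\<^esub> (r \<odot>\<^bsub>M\<^esub> w))\<rparr>"

text \<open>The image of the Jacobian matrix \<open>R^m \<rightarrow> R^n\<close> of \<open>f_1, ..., f_m\<close>.\<close>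

definition jacobian_image ::
    "'a::field fls set \<Rightarrow> nat \<Rightarrow> (nat \<Rightarrow> 'a fls) \<Rightarrow> nat \<Rightarrow> (nat \<Rightarrow> (nat \<Rightarrow>\<^sub>0 nat) \<Rightarrow> 'a)
      \<Rightarrow> (nat \<Rightarrow> 'a fls) set"
  where "jacobian_image R n x m f =
    (\<lambda>c. \<lambda>i\<in>{1..n}. \<Sum>j\<in>{1..m}. mps_eval n x (mps_deriv i (f j)) * c j) ` ({1..m} \<rightarrow>\<^sub>E R)"

definition differentials ::
    "'a::field fls set \<Rightarrow> nat \<Rightarrow> (nat \<Rightarrow> 'a fls) \<Rightarrow> nat \<Rightarrow> (nat \<Rightarrow> (nat \<Rightarrow>\<^sub>0 nat) \<Rightarrow> 'a)
      \<Rightarrow> ('a fls, (nat \<Rightarrow> 'a fls) set) module"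
  where "differentials R n x m f = quotient_module (free_module R n) (jacobian_image R n x m f)"

text \<open>For a domain \<open>A\<close>.\<close>

definition torsion :: "('r, 'c) ring_scheme \<Rightarrow> ('r, 'b) module \<Rightarrow> 'b set"
  where "torsion A M =
    {w \<in> carrier M. \<exists>r \<in> carrier A - {\<zero>\<^bsub>A\<^esub>}. r \<odot>\<^bsub>M\<^esub> w = \<zero>\<^bsub>M\<^esub>}"

end

theory Submission
  imports Defs
begin

text \<open>If \<open>\<Omega>\<^sub>R\<close> is torsion-free, it embeds into \<open>k((t)) dt\<close>, so every relation \<open>\<Sum> v\<^sub>i dx\<^sub>i/dt = 0\<close>
  with \<open>v\<^sub>i \<in> R\<close> comes from the gradient of an element of the presentation ideal \<open>I \<subseteq> (X)\<^sup>2\<close>.  Let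
  \<open>\<theta> = t d/dt\<close>, let \<open>tD\<close> be the \<open>R\<close>-module generated by the \<open>\<theta> x\<^sub>i\<close>, let \<open>U = R + tD\<close> and let \<open>W\<close> be
  the set of all \<open>z \<in> m\<close> with \<open>\<theta> z \<in> x\<^sub>1 U\<close>.  Two consequences clash.  Comparing the index of
  \<open>x\<^sub>1 U + \<theta> m\<close> in \<open>tD\<close> with that of \<open>x\<^sub>1 R\<close> in \<open>W\<close>, the \<open>(n-1)(n-2)/2\<close> elements \<open>x\<^sub>i \<theta> x\<^sub>j\<close> with
  \<open>1 < i < j\<close>, which are independent modulo \<open>x\<^sub>1 U + \<theta> m\<close>, give \<open>(n-1)(n-2)/2 \<le> dim W / x\<^sub>1 R\<close>.  On the
  other hand Euler's formula gives \<open>W \<subseteq> m^4 + x\<^sub>1 R\<close>, hence \<open>m W \<subseteq> m^5 + x\<^sub>1 R \<subseteq> C + x\<^sub>1 R\<close>; multiplying by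
  \<open>x\<^sub>1, \<dots>, x\<^sub>n\<close> then bounds \<open>dim W / x\<^sub>1 R\<close> by \<open>type R + n s\<close>.\<close>

section \<open>Counting valuations of subspaces of \<open>k[[t]]\<close>\<close>

text \<open>The step from torsion-freeness to "every relation comes from a gradient" means that the
  differentials have rank one, and it is the delicate one, because a derivation is not continuous
  for free. It is reduced to showing that a derivation from R to a torsion-free module that kills
  x_1 kills R. Since x_1 is a power of t, each power of t is algebraic over the series in x_1, and
  each element of t^c k[[t]] is a finite combination of powers of t with series in x_1 as
  coefficients. These series are killed exactly by the chain rule, so no limit is taken. The
  exponent 4 comes from I having order 2: for a suitable lift of z the partial derivatives are of
  order 2 modulo X_1, so its part free of X_1 has order 3, and one third of Euler's sum removes the
  cubic form at the cost of a multiple of x_1. One more factor from m gives 5. The spaces compared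
  contain t^M k[[t]] for a common M, so dimensions become numbers of orders below M. The final
  contradiction has a margin of 2, from (n-1)(n-2) = n^2 - 3n + 2.\<close>

definition fps_subspace :: "'a::field fps set \<Rightarrow> bool"
  where "fps_subspace V \<longleftrightarrow>
    0 \<in> V \<and> (\<forall>f\<in>V. \<forall>g\<in>V. f + g \<in> V) \<and> (\<forall>c. \<forall>f\<in>V. fps_const c * f \<in> V)"

text \<open>If \<open>t^M k[[t]] \<subseteq> V\<close>, this is the dimension of \<open>V / t^M k[[t]]\<close>.\<close>

definition val_count :: "nat \<Rightarrow> 'a::field fps set \<Rightarrow> nat"
  where "val_count M V = card {j. j < M \<and> (\<exists>f\<in>V. f \<noteq> 0 \<and> subdegree f = j)}"

lemma fps_subspaceD:
  assumes "fps_subspace V"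
  shows "0 \<in> V" "\<And>f g. f \<in> V \<Longrightarrow> g \<in> V \<Longrightarrow> f + g \<in> V"
    "\<And>c f. f \<in> V \<Longrightarrow> fps_const c * f \<in> V"
    "\<And>f g. f \<in> V \<Longrightarrow> g \<in> V \<Longrightarrow> f - g \<in> V"
    "\<And>f. f \<in> V \<Longrightarrow> - f \<in> V"
proof -
  show 0: "0 \<in> V" "\<And>f g. f \<in> V \<Longrightarrow> g \<in> V \<Longrightarrow> f + g \<in> V"
    "\<And>c f. f \<in> V \<Longrightarrow> fps_const c * f \<in> V"
    using assms by (auto simp: fps_subspace_def)
  show n: "- f \<in> V" if "f \<in> V" for f
  proof -
    have "fps_const (- 1) * f = - f"
      by (metis fps_const_1_eq_1 fps_const_neg mult_minus1)
    then show ?thesis using 0(3)[OF that, of "- 1"] by simp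
  qed
  show "f - g \<in> V" if "f \<in> V" "g \<in> V" for f g
    using 0(2)[OF that(1) n[OF that(2)]] by simp
qed

lemma fps_subspace_Int: "fps_subspace V \<Longrightarrow> fps_subspace W \<Longrightarrow> fps_subspace (V \<inter> W)"
  by (auto simp: fps_subspace_def)

definition fps_plus :: "'a::field fps set \<Rightarrow> 'a fps set \<Rightarrow> 'a fps set"
  where "fps_plus V W = {f + g | f g. f \<in> V \<and> g \<in> W}"

definition fps_line :: "'a::field fps \<Rightarrow> 'a fps set"
  where "fps_line w = range (\<lambda>c. fps_const c * w)"

lemma fps_subspace_plus:
  assumes "fps_subspace V" "fps_subspace W"
  shows "fps_subspace (fps_plus V W)"
  unfolding fps_subspace_def
proof (intro conjI ballI allI)
  show "0 \<in> fps_plus V W"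
    using assms[THEN fps_subspaceD(1)] by (force simp: fps_plus_def)
next
  fix f g assume "f \<in> fps_plus V W" "g \<in> fps_plus V W"
  then obtain a b c d where "f = a + b" "g = c + d" "a \<in> V" "c \<in> V" "b \<in> W" "d \<in> W"
    by (auto simp: fps_plus_def)
  moreover from this have "f + g = (a + c) + (b + d)" by simp
  ultimately show "f + g \<in> fps_plus V W"
    using assms[THEN fps_subspaceD(2)] unfolding fps_plus_def by blast
next
  fix c f assume "f \<in> fps_plus V W"
  then obtain a b where "f = a + b" "a \<in> V" "b \<in> W"
    by (auto simp: fps_plus_def)
  moreover from this have "fps_const c * f = fps_const c * a + fps_const c * b"
    by (simp add: algebra_simps)
  ultimately show "fps_const c * f \<in> fps_plus V W"
    using assms[THEN fps_subspaceD(3)] unfolding fps_plus_def by blast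
qed

lemma fps_subspace_line: "fps_subspace (fps_line w)"
  unfolding fps_subspace_def fps_line_def
proof (intro conjI ballI allI)
  show "0 \<in> range (\<lambda>c. fps_const c * w)"
    by (rule image_eqI[of _ _ 0]) auto
next
  fix f g assume "f \<in> range (\<lambda>c. fps_const c * w)" "g \<in> range (\<lambda>c. fps_const c * w)"
  then obtain c d where "f = fps_const c * w" "g = fps_const d * w" by auto
  then have "f + g = fps_const (c + d) * w"
    by (simp add: distrib_right flip: fps_const_add)
  then show "f + g \<in> range (\<lambda>c. fps_const c * w)" by blast
next
  fix c f assume "f \<in> range (\<lambda>c. fps_const c * w)"
  then obtain d where "f = fps_const d * w" by auto
  then have "fps_const c * f = fps_const (c * d) * w"
    by (simp flip: fps_const_mult add: mult.assoc)
  then show "fps_const c * f \<in> range (\<lambda>c. fps_const c * w)" by blast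
qed

lemma fps_plus_upper:
  assumes "fps_subspace V" "fps_subspace W"
  shows "V \<subseteq> fps_plus V W" "W \<subseteq> fps_plus V W"
proof -
  show "V \<subseteq> fps_plus V W"
  proof
    fix f assume "f \<in> V"
    moreover have "f = f + 0" by simp
    ultimately show "f \<in> fps_plus V W"
      using fps_subspaceD(1)[OF assms(2)] unfolding fps_plus_def by blast
  qed
  show "W \<subseteq> fps_plus V W"
  proof
    fix f assume "f \<in> W"
    moreover have "f = 0 + f" by simp
    ultimately show "f \<in> fps_plus V W"
      using fps_subspaceD(1)[OF assms(1)] unfolding fps_plus_def by blast
  qed
qed

lemma val_count_mono:
  assumes "V \<subseteq> W" shows "val_count M V \<le> val_count M W"
  unfolding val_count_def by (rule card_mono) (use assms in auto)

lemma val_count_le: "val_count M V \<le> M"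
proof -
  have "val_count M V \<le> card {..<M}"
    unfolding val_count_def by (rule card_mono) auto
  then show ?thesis by simp
qed

text \<open>If no new order appeared below M, the coefficients of \<open>w\<close> below M could be
  cancelled one after the other by elements of \<open>V\<close>; the remainder starts at M or later,
  so \<open>tail\<close> would put \<open>w\<close> into \<open>V\<close>.\<close>

lemma val_count_strict:
  assumes V: "fps_subspace V" and W: "fps_subspace W" and sub: "V \<subseteq> W"
    and tail: "\<And>f. f \<in> W \<Longrightarrow> (\<And>j. j < M \<Longrightarrow> fps_nth f j = 0) \<Longrightarrow> f \<in> V"
    and w: "w \<in> W" "w \<notin> V"
  shows "val_count M V < val_count M W"
proof (rule ccontr)
  let ?v = "\<lambda>V. {j. j < M \<and> (\<exists>f\<in>V. f \<noteq> 0 \<and> subdegree f = j)}"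
  assume "\<not> val_count M V < val_count M W"
  then have le: "card (?v W) \<le> card (?v V)" by (simp add: val_count_def)
  have "?v V \<subseteq> ?v W" using sub by blast
  from card_seteq[OF _ this le] have eq: "?v V = ?v W" by simp
  have "\<exists>g\<in>V. \<forall>j<J. fps_nth (w - g) j = 0" if "J \<le> M" for J
    using that
  proof (induction J)
    case 0
    show ?case using fps_subspaceD(1)[OF V] by auto
  next
    case (Suc J)
    then obtain g where g: "g \<in> V" "\<forall>j<J. fps_nth (w - g) j = 0" by auto
    show ?case
    proof (cases "fps_nth (w - g) J = 0")
      case True
      then show ?thesis using g by (auto simp: less_Suc_eq)
    next
      case False
      have "subdegree (w - g) = J"
        using False g(2) by (intro subdegreeI) auto
      moreover have "w - g \<noteq> 0" using False by auto
      moreover have "w - g \<in> W" using w(1) g(1) sub fps_subspaceD(4)[OF W] by auto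
      ultimately have "J \<in> ?v W" using Suc.prems by (intro CollectI conjI bexI[of _ "w - g"]) auto
      then have "J \<in> ?v V" by (simp only: eq)
      then obtain h where h: "h \<in> V" "h \<noteq> 0" "subdegree h = J" by auto
      define c where "c = fps_nth (w - g) J / fps_nth h J"
      have hJ: "fps_nth h J \<noteq> 0" using h by auto
      have "g + fps_const c * h \<in> V"
        using g h by (intro fps_subspaceD(2,3)[OF V])
      moreover have "fps_nth (w - (g + fps_const c * h)) j = 0" if "j < Suc J" for j
      proof (cases "j = J")
        case True
        then show ?thesis using hJ by (simp add: c_def)
      next
        case False
        then have "j < J" using that by auto
        then show ?thesis using g(2) h(3) by auto
      qed
      ultimately show ?thesis by blast
    qed
  qed
  then obtain g where g: "g \<in> V" "\<forall>j<M. fps_nth (w - g) j = 0" by blast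
  have "w - g \<in> V"
    by (rule tail) (use g w(1) sub fps_subspaceD(4)[OF W] in auto)
  then have "w \<in> V" using fps_subspaceD(2)[OF V _ g(1), of "w - g"] by simp
  with w(2) show False by simp
qed

text \<open>Two new orders i < j would come from elements f and g of \<open>W\<close>. Subtracting
  from f the multiple of g that cancels its \<open>w\<close>-part gives an element of
  \<open>V\<close> that still has order i, because g has the larger order.\<close>

lemma val_count_line:
  assumes V: "fps_subspace V" and W: "W \<subseteq> fps_plus V (fps_line w)"
  shows "val_count M W \<le> val_count M V + 1"
proof (rule ccontr)
  let ?v = "\<lambda>V. {j. j < M \<and> (\<exists>f\<in>V. f \<noteq> 0 \<and> subdegree f = j)}"
  assume "\<not> ?thesis"
  moreover have "card (?v W) \<le> card (?v W - ?v V) + card (?v V)"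
    using diff_card_le_card_Diff[of "?v V" "?v W"] by simp
  ultimately have "2 \<le> card (?v W - ?v V)" by (simp add: val_count_def)
  then obtain B where B: "B \<subseteq> ?v W - ?v V" "card B = 2"
    by (meson obtain_subset_with_card_n)
  from B(2) obtain i0 j0 where "B = {i0, j0}" "i0 \<noteq> j0" by (auto simp: card_2_iff)
  with B(1) obtain i j where ij: "i \<in> ?v W - ?v V" "j \<in> ?v W - ?v V" "i < j"
    by (cases "i0 < j0") (auto simp: not_less_iff_gr_or_eq)
  from ij(1,3) obtain f where f: "f \<in> W" "f \<noteq> 0" "subdegree f = i" "i \<notin> ?v V" "i < M" "i < j"
    by blast
  from ij(2) obtain g where g: "g \<in> W" "g \<noteq> 0" "subdegree g = j" "j \<notin> ?v V" "j < M"
    by blast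
  from f(1) W obtain v c where fe: "f = v + fps_const c * w" "v \<in> V"
    by (auto simp: fps_plus_def fps_line_def)
  from g(1) W obtain u d where ge: "g = u + fps_const d * w" "u \<in> V"
    by (auto simp: fps_plus_def fps_line_def)
  have "d \<noteq> 0"
  proof
    assume "d = 0"
    then have "g \<in> V" using ge by simp
    with g(2-5) show False by blast
  qed
  have "(v + C * w) - K * (u + D * w) = (v - K * u) + (C - K * D) * w" for C D K
    by (simp add: algebra_simps)
  then have "f - fps_const (c / d) * g = v - fps_const (c / d) * u
      + (fps_const c - fps_const (c / d) * fps_const d) * w"
    unfolding fe(1) ge(1) .
  also have "fps_const (c / d) * fps_const d = fps_const c"
    using \<open>d \<noteq> 0\<close> by simp
  finally have "f - fps_const (c / d) * g = v - fps_const (c / d) * u" by simp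
  then have hV: "f - fps_const (c / d) * g \<in> V"
    using fe(2) ge(2) by (simp add: fps_subspaceD(3,4)[OF V])
  have nth: "fps_nth (f - fps_const (c / d) * g) i \<noteq> 0"
    using f g by auto
  then have "subdegree (f - fps_const (c / d) * g) = i"
  proof (rule subdegreeI)
    fix l assume "l < i"
    then have "fps_nth f l = 0" "fps_nth g l = 0"
      using f(3,6) g(3) by (auto intro!: nth_less_subdegree_zero)
    then show "fps_nth (f - fps_const (c / d) * g) l = 0" by simp
  qed
  moreover have "f - fps_const (c / d) * g \<noteq> 0" using nth by auto
  ultimately have "i \<in> ?v V" using hV f(5) by blast
  with f(4) show False by contradiction
qed

text \<open>Enlarge a space A from the intersection to \<open>Q\<close> line by line: each line
  raises the count of A by one and that of \<open>P\<close> plus A by at least one, because a vector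
  of \<open>Q\<close> outside A stays outside \<open>P\<close> plus A.\<close>

lemma val_count_grassmann:
  assumes P: "fps_subspace P" and Q: "fps_subspace Q"
    and tail: "\<And>f. (\<And>j. j < M \<Longrightarrow> fps_nth f j = 0) \<Longrightarrow> f \<in> P \<inter> Q"
  shows "val_count M P + val_count M Q \<le> val_count M (fps_plus P Q) + val_count M (P \<inter> Q)"
proof -
  \<comment> \<open>Both sides agree for A = \<open>Q\<close>, and A = \<open>P \<inter> Q\<close>
    is the case that is wanted. By \<open>val_count_le\<close>, M minus the count of A is a measure
    that drops as A grows.\<close>
  have "val_count M Q + val_count M (fps_plus P A)
      \<le> val_count M (fps_plus P Q) + val_count M A"
    if "fps_subspace A" "P \<inter> Q \<subseteq> A" "A \<subseteq> Q" for A
    using that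
  proof (induction "M - val_count M A" arbitrary: A rule: less_induct)
    case less
    show ?case
    proof (cases "A = Q")
      case True
      then show ?thesis by simp
    next
      case False
      then obtain y where y: "y \<in> Q" "y \<notin> A" using less.prems by auto
      define B where "B = fps_plus A (fps_line y)"
      have yl: "y \<in> fps_line y" unfolding fps_line_def by (rule image_eqI[of _ _ 1]) auto
      have B: "fps_subspace B" unfolding B_def
        by (intro fps_subspace_plus less.prems fps_subspace_line)
      have AB: "A \<subseteq> B" "y \<in> B"
        using fps_plus_upper[OF less.prems(1) fps_subspace_line[of y]] yl by (auto simp: B_def)
      have BY: "B \<subseteq> Q"
        using y(1) less.prems(3) fps_subspaceD[OF Q]
        by (auto simp: B_def fps_plus_def fps_line_def)
      have 1: "val_count M A < val_count M B"
        by (rule val_count_strict[OF less.prems(1) B AB(1) _ AB(2) y(2)])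
          (use tail less.prems in auto)
      have 2: "val_count M B \<le> val_count M A + 1"
        by (rule val_count_line[OF less.prems(1), of _ y]) (simp add: B_def)
      \<comment> \<open>Modular law: y = u + v with v in A forces u = y - v into
        \<open>P \<inter> Q\<close>, hence into A.\<close>
      have "y \<notin> fps_plus P A"
      proof
        assume "y \<in> fps_plus P A"
        then obtain u v where uv: "y = u + v" "u \<in> P" "v \<in> A" by (auto simp: fps_plus_def)
        have "y - v \<in> Q"
          by (rule fps_subspaceD(4)[OF Q]) (use y uv less.prems in auto)
        then have "u \<in> A" using uv less.prems by auto
        then show False using y(2) uv fps_subspaceD(2)[OF less.prems(1)] by simp
      qed
      then have 3: "val_count M (fps_plus P A) < val_count M (fps_plus P B)"
      proof (rule val_count_strict[rotated -1])
        show "fps_subspace (fps_plus P A)" "fps_subspace (fps_plus P B)"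
          using P B less.prems by (auto intro: fps_subspace_plus)
        show "fps_plus P A \<subseteq> fps_plus P B" using AB by (auto simp: fps_plus_def)
        show "y \<in> fps_plus P B" using fps_plus_upper(2)[OF P B] AB by auto
        show "f \<in> fps_plus P A" if "\<And>j. j < M \<Longrightarrow> fps_nth f j = 0" for f
          using tail[OF that] fps_plus_upper(1)[OF P less.prems(1)] by auto
      qed
      have "val_count M B \<le> M" by (rule val_count_le)
      then have "val_count M Q + val_count M (fps_plus P B)
          \<le> val_count M (fps_plus P Q) + val_count M B"
        using 1 less.prems AB by (intro less.hyps B BY) auto
      with 1 2 3 show ?thesis by linarith
    qed
  qed
  from this[of "P \<inter> Q"] have "val_count M Q + val_count M (fps_plus P (P \<inter> Q))
      \<le> val_count M (fps_plus P Q) + val_count M (P \<inter> Q)"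
    using P Q by (auto intro: fps_subspace_Int)
  moreover have "val_count M P \<le> val_count M (fps_plus P (P \<inter> Q))"
    by (intro val_count_mono fps_plus_upper P fps_subspace_Int Q)
  ultimately show ?thesis by linarith
qed

text \<open>Removing the vectors \<open>c\<close> one at a time, the last one first, cuts
  \<open>V\<close> down to the part that \<phi> sends into \<open>B\<close>. Each removal is the
  vanishing of one coordinate, so it costs at most one line.\<close>

lemma val_count_preimage:
  fixes \<phi> :: "'a::field fps \<Rightarrow> 'a fps" and c :: "nat \<Rightarrow> 'a fps"
  assumes B: "fps_subspace B"
    and add: "\<And>f g. \<phi> (f + g) = \<phi> f + \<phi> g"
    and scale: "\<And>k f. \<phi> (fps_const k * f) = fps_const k * \<phi> f"
    and V: "fps_subspace V"
    and img: "\<And>f. f \<in> V \<Longrightarrow> \<exists>l. \<phi> f - (\<Sum>i<s. fps_const (l i) * c i) \<in> B"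
  shows "val_count M V \<le> val_count M {f \<in> V. \<phi> f \<in> B} + s"
  using V img
proof (induction s arbitrary: V)
  case 0
  then have "{f \<in> V. \<phi> f \<in> B} = V" by auto
  then show ?case by simp
next
  case (Suc s)
  let ?P = "\<lambda>f. \<exists>l. \<phi> f - (\<Sum>i<s. fps_const (l i) * c i) \<in> B"
  define V' where "V' = {f \<in> V. ?P f}"
  have P_add: "?P (f + fps_const k * g)" if fg: "?P f" "?P g" for f g k
  proof -
    obtain l u where "\<phi> f - (\<Sum>i<s. fps_const (l i) * c i) \<in> B"
       "\<phi> g - (\<Sum>i<s. fps_const (u i) * c i) \<in> B" using fg by blast
    then have "(\<phi> f - (\<Sum>i<s. fps_const (l i) * c i)) + fps_const k * (\<phi> g - (\<Sum>i<s. fps_const (u i) * c i)) \<in> B"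
      by (intro fps_subspaceD(2,3)[OF B])
    also have "(\<phi> f - (\<Sum>i<s. fps_const (l i) * c i)) + fps_const k * (\<phi> g - (\<Sum>i<s. fps_const (u i) * c i))
       = (\<phi> f + fps_const k * \<phi> g) - (\<Sum>i<s. fps_const (l i + k * u i) * c i)"
      by (simp add: algebra_simps sum.distrib sum_distrib_left
          flip: fps_const_add fps_const_mult)
    also have "\<phi> f + fps_const k * \<phi> g = \<phi> (f + fps_const k * g)"
      by (simp only: add scale)
    finally show ?thesis by (intro exI[of _ "\<lambda>i. l i + k * u i"])
  qed
  have \<phi>0: "\<phi> 0 = 0" using scale[of 0 0] by simp
  have P0: "?P 0" using fps_subspaceD(1)[OF B] by (intro exI[of _ "\<lambda>_. 0"]) (simp add: \<phi>0)
  have V': "fps_subspace V'"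
    unfolding fps_subspace_def V'_def
    using fps_subspaceD[OF Suc.prems(1)] P0 P_add[where k=1] P_add[OF P0] by auto
  have "val_count M V \<le> val_count M V' + 1"
  proof (cases "V \<subseteq> V'")
    case True
    then show ?thesis using val_count_mono[OF True, of M] by simp
  next
    case False
    then obtain w where w: "w \<in> V" "w \<notin> V'" by auto
    then obtain l where l: "\<phi> w - (\<Sum>i<Suc s. fps_const (l i) * c i) \<in> B"
      using Suc.prems(2) by blast
    have ls: "l s \<noteq> 0"
    proof
      assume "l s = 0"
      then have "?P w" using l by auto
      then show False using w by (auto simp: V'_def)
    qed
    have "f \<in> fps_plus V' (fps_line w)" if f: "f \<in> V" for f
    proof -
      obtain u where u: "\<phi> f - (\<Sum>i<Suc s. fps_const (u i) * c i) \<in> B"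
        using Suc.prems(2) f by blast
      \<comment> \<open>With this ratio the coefficients at \<open>c s\<close> cancel, so f - k * w
        needs only the first s vectors.\<close>
      define k where "k = u s / l s"
      have ks: "fps_const k * fps_const (l s) = fps_const (u s)"
        using ls by (simp add: k_def)
      have "(\<phi> f - (\<Sum>i<Suc s. fps_const (u i) * c i)) - fps_const k * (\<phi> w - (\<Sum>i<Suc s. fps_const (l i) * c i)) \<in> B"
        by (intro fps_subspaceD(3,4)[OF B] l u)
      also have "(\<phi> f - (\<Sum>i<Suc s. fps_const (u i) * c i)) - fps_const k * (\<phi> w - (\<Sum>i<Suc s. fps_const (l i) * c i))
        = \<phi> f - fps_const k * \<phi> w - (\<Sum>i<s. fps_const (u i - k * l i) * c i)
          + (fps_const k * fps_const (l s) - fps_const (u s)) * c s"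
        by (simp add: algebra_simps sum_subtractf sum_distrib_left
          flip: fps_const_sub fps_const_mult)
      also have "\<dots> = \<phi> (f + fps_const (- k) * w) - (\<Sum>i<s. fps_const (u i - k * l i) * c i)"
        by (simp only: ks add scale) (simp flip: fps_const_neg)
      finally have "?P (f + fps_const (- k) * w)" by (intro exI[of _ "\<lambda>i. u i - k * l i"])
      then have "f + fps_const (- k) * w \<in> V'"
        using f w fps_subspaceD[OF Suc.prems(1)] by (auto simp: V'_def)
      moreover have "f = (f + fps_const (- k) * w) + fps_const k * w"
        by (simp flip: fps_const_neg)
      ultimately show ?thesis unfolding fps_plus_def fps_line_def by blast
    qed
    then show ?thesis by (intro val_count_line[OF V']) auto
  qed
  also have "val_count M V' \<le> val_count M {f \<in> V'. \<phi> f \<in> B} + s"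
    by (rule Suc.IH[OF V']) (auto simp: V'_def)
  also have "{f \<in> V'. \<phi> f \<in> B} \<subseteq> {f \<in> V. \<phi> f \<in> B}" by (auto simp: V'_def)
  then have "val_count M {f \<in> V'. \<phi> f \<in> B} \<le> val_count M {f \<in> V. \<phi> f \<in> B}"
    by (rule val_count_mono)
  finally show ?case by simp
qed

text \<open>Orders move up by e. Those pushed past M are the ones in [M - e, M), and all of them
  occur because \<open>V\<close> contains t^(M-e) k[[t]].\<close>

lemma val_count_shift:
  fixes V :: "'a::field fps set"
  assumes "\<And>f. (\<And>j. j < M - e \<Longrightarrow> fps_nth f j = 0) \<Longrightarrow> f \<in> V" "e \<le> M"
  shows "val_count M ((*) (fps_X ^ e) ` V) + e = val_count M V"
proof -
  let ?v = "\<lambda>V. {j. j < M \<and> (\<exists>f\<in>V. f \<noteq> 0 \<and> subdegree f = j)}"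
  let ?A = "{j. j < M - e \<and> (\<exists>f\<in>V. f \<noteq> 0 \<and> subdegree f = j)}"
  have sd: "subdegree (fps_X ^ e * f) = e + subdegree f" if "f \<noteq> 0" for f :: "'a fps"
    using that by simp
  have 1: "?v ((*) (fps_X ^ e) ` V) = (+) e ` ?A"
  proof (intro equalityI subsetI)
    fix j assume "j \<in> ?v ((*) (fps_X ^ e) ` V)"
    then obtain f where "j < M" "f \<in> V" "f \<noteq> 0" "subdegree (fps_X ^ e * f) = j" by auto
    with sd show "j \<in> (+) e ` ?A" by auto
  next
    fix j assume "j \<in> (+) e ` ?A"
    then obtain f where "f \<in> V" "f \<noteq> 0" "j = e + subdegree f" "subdegree f < M - e" by auto
    with sd show "j \<in> ?v ((*) (fps_X ^ e) ` V)"
      by (auto intro!: bexI[of _ f])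
  qed
  have "fps_X ^ j \<in> V" if "M - e \<le> j" for j
    using assms(1)[of "fps_X ^ j"] that by (auto simp: fps_X_power_nth)
  then have ex: "\<exists>f\<in>V. f \<noteq> 0 \<and> subdegree f = j" if "M - e \<le> j" for j
    using that by (intro bexI[of _ "fps_X ^ j"]) auto
  have 2: "?v V = ?A \<union> {M - e..<M}"
  proof (intro equalityI subsetI)
    fix j assume "j \<in> ?A \<union> {M - e..<M}"
    then show "j \<in> ?v V" using ex[of j] by auto
  qed (auto simp: not_less)
  have "card (?v V) = card ?A + card {M - e..<M}"
    unfolding 2 by (rule card_Un_disjoint) auto
  moreover have "card (?v ((*) (fps_X ^ e) ` V)) = card ?A"
    unfolding 1 by (rule card_image) auto
  ultimately show ?thesis using assms(2) by (simp add: val_count_def)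
qed

section \<open>Power series in several variables\<close>

text \<open>The product of \<open>mps n\<close> is the same for every n; a name without n lets its
  identities be proved for arbitrary coefficient families, before any carrier is fixed.\<close>

definition mps_mult :: "((nat \<Rightarrow>\<^sub>0 nat) \<Rightarrow> 'a::field) \<Rightarrow> ((nat \<Rightarrow>\<^sub>0 nat) \<Rightarrow> 'a) \<Rightarrow> (nat \<Rightarrow>\<^sub>0 nat) \<Rightarrow> 'a"
  where "mps_mult f g = (\<lambda>e. \<Sum>(a, b)\<in>{(a, b). a + b = e}. f a * g b)"

lemma finite_bounded_poly_mapping:
  assumes "finite A"
  shows "finite {e :: 'i \<Rightarrow>\<^sub>0 nat. Poly_Mapping.keys e \<subseteq> A \<and> (\<forall>i. Poly_Mapping.lookup e i \<le> N)}"
proof (rule finite_imageD[where f = Poly_Mapping.lookup])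
  have "finite {f. \<forall>i. (i \<in> A \<longrightarrow> f i \<in> {..N}) \<and> (i \<notin> A \<longrightarrow> f i = (0::nat))}"
    using assms by (intro finite_set_of_finite_funs) auto
  then show "finite (Poly_Mapping.lookup `
      {e :: 'i \<Rightarrow>\<^sub>0 nat. Poly_Mapping.keys e \<subseteq> A \<and> (\<forall>i. Poly_Mapping.lookup e i \<le> N)})"
    by (rule finite_subset[rotated]) (auto simp: subset_iff in_keys_iff)
qed (auto simp: inj_on_def poly_mapping_eqI)

lemma keys_add_nat: "Poly_Mapping.keys (a + b :: 'i \<Rightarrow>\<^sub>0 nat) = Poly_Mapping.keys a \<union> Poly_Mapping.keys b"
  by (auto simp: in_keys_iff lookup_add)

text \<open>The convolution depends on this, since a sum over an infinite set is 0 by convention.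
  Both summands are supported in the keys of e and bounded by its total degree.\<close>

lemma finite_add_pairs [simp]: "finite {(a, b). a + b = (e :: 'i \<Rightarrow>\<^sub>0 nat)}"
proof -
  let ?N = "\<Sum>i\<in>Poly_Mapping.keys e. Poly_Mapping.lookup e i"
  let ?B = "{a. Poly_Mapping.keys a \<subseteq> Poly_Mapping.keys e \<and> (\<forall>i. Poly_Mapping.lookup a i \<le> ?N)}"
  have le: "Poly_Mapping.lookup e i \<le> ?N" for i
    by (cases "i \<in> Poly_Mapping.keys e") (simp_all add: member_le_sum in_keys_iff)
  have "finite (?B \<times> ?B)"
    by (intro finite_cartesian_product finite_bounded_poly_mapping finite_keys)
  moreover have "{(a, b). a + b = e} \<subseteq> ?B \<times> ?B"
  proof
    fix p assume "p \<in> {(a, b). a + b = e}"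
    then obtain a b where p: "p = (a, b)" and e: "e = a + b" by auto
    have "Poly_Mapping.lookup a i \<le> ?N" "Poly_Mapping.lookup b i \<le> ?N" for i
      using le[of i] unfolding e lookup_add by linarith+
    then show "p \<in> ?B \<times> ?B"
      unfolding p mem_Times_iff mem_Collect_eq by (auto simp: e keys_add_nat)
  qed
  ultimately show ?thesis by (rule finite_subset[rotated])
qed

lemma finite_add_pairs' [simp]: "finite {p. fst p + snd p = (e :: 'i \<Rightarrow>\<^sub>0 nat)}"
  using finite_add_pairs[of e] by (simp add: case_prod_unfold)

lemma total_degree_superset:
  assumes "finite A" "Poly_Mapping.keys e \<subseteq> A"
  shows "total_degree e = (\<Sum>i\<in>A. Poly_Mapping.lookup e i)"
  unfolding total_degree_def
  by (rule sum.mono_neutral_left) (use assms in \<open>auto simp: in_keys_iff\<close>)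

lemma total_degree_add: "total_degree (a + b) = total_degree a + total_degree b"
proof -
  let ?A = "Poly_Mapping.keys a \<union> Poly_Mapping.keys b"
  show ?thesis
    by (simp add: total_degree_superset[of ?A] keys_add_nat lookup_add sum.distrib)
qed

lemma total_degree_single [simp]: "total_degree (Poly_Mapping.single i c) = c"
  by (auto simp: total_degree_def)

lemma total_degree_0_iff: "total_degree e = 0 \<longleftrightarrow> e = 0"
  by (auto simp: total_degree_def in_keys_iff poly_mapping_eq_iff fun_eq_iff)

lemma monomials_add: "a + b \<in> monomials n \<longleftrightarrow> a \<in> monomials n \<and> b \<in> monomials n"
  by (auto simp: monomials_def keys_add_nat)

lemma monomials_0 [simp]: "0 \<in> monomials n"
  by (auto simp: monomials_def)

lemma monomials_single: "Poly_Mapping.single i c \<in> monomials n \<longleftrightarrow> i \<in> {1..n} \<or> c = 0"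
  by (auto simp: monomials_def)

definition low_monomials :: "nat \<Rightarrow> nat \<Rightarrow> (nat \<Rightarrow>\<^sub>0 nat) set"
  where "low_monomials n N = {e \<in> monomials n. total_degree e \<le> N}"

lemma lookup_le_total_degree: "Poly_Mapping.lookup e i \<le> total_degree e"
  by (cases "i \<in> Poly_Mapping.keys e")
    (simp_all add: total_degree_def in_keys_iff member_le_sum)

lemma finite_low_monomials [simp]: "finite (low_monomials n N)"
proof (rule finite_subset)
  show "low_monomials n N \<subseteq>
      {e. Poly_Mapping.keys e \<subseteq> {1..n} \<and> (\<forall>i. Poly_Mapping.lookup e i \<le> N)}"
    using lookup_le_total_degree order_trans unfolding low_monomials_def monomials_def by blast
qed (rule finite_bounded_poly_mapping, simp)

lemma mps_mult_commute: "mps_mult f g = mps_mult g f"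
proof
  fix e
  show "mps_mult f g e = mps_mult g f e"
    unfolding mps_mult_def
    by (rule sum.reindex_bij_witness[of _ prod.swap prod.swap]) (auto simp: add.commute mult.commute)
qed

lemma mps_mult_distrib:
  "mps_mult (\<lambda>e. f e + g e) h = (\<lambda>e. mps_mult f h e + mps_mult g h e)"
  by (simp add: mps_mult_def fun_eq_iff case_prod_unfold distrib_right sum.distrib)

lemma mps_mult_assoc: "mps_mult (mps_mult f g) h = mps_mult f (mps_mult g h)"
proof
  fix e
  have "mps_mult (mps_mult f g) h e
      = (\<Sum>(u, c)\<in>{(u, c). u + c = e}. \<Sum>(a, b)\<in>{(a, b). a + b = u}. f a * g b * h c)"
    by (simp add: mps_mult_def case_prod_unfold sum_distrib_right)
  also have "\<dots> = (\<Sum>((u, c), a, b)\<in>Sigma {(u, c). u + c = e} (\<lambda>(u, c). {(a, b). a + b = u}). f a * g b * h c)"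
    by (simp add: sum.Sigma case_prod_unfold)
  also have "\<dots> = (\<Sum>((a, v), b, c)\<in>Sigma {(a, v). a + v = e} (\<lambda>(a, v). {(b, c). b + c = v}). f a * (g b * h c))"
    by (rule sum.reindex_bij_witness[of _ "\<lambda>((a, v), b, c). ((a + b, c), a, b)"
          "\<lambda>((u, c), a, b). ((a, b + c), b, c)"]) (auto simp: add.assoc mult.assoc)
  also have "\<dots> = (\<Sum>(a, v)\<in>{(a, v). a + v = e}. \<Sum>(b, c)\<in>{(b, c). b + c = v}. f a * (g b * h c))"
    by (simp add: sum.Sigma case_prod_unfold)
  also have "\<dots> = mps_mult f (mps_mult g h) e"
    by (simp add: mps_mult_def case_prod_unfold sum_distrib_left)
  finally show "mps_mult (mps_mult f g) h e = mps_mult f (mps_mult g h) e" .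
qed

lemma mps_mult_monom:
  "mps_mult (\<lambda>e. if e = d then c else 0) f (d + e) = c * f e"
proof -
  have "mps_mult (\<lambda>e. if e = d then c else 0) f (d + e)
      = (\<Sum>(a, b)\<in>{(d, e)}. (if a = d then c else 0) * f b)"
    unfolding mps_mult_def by (rule sum.mono_neutral_right) (auto split: if_splits)
  then show ?thesis by simp
qed

lemma mps_mult_monom_0:
  assumes "\<And>b. e \<noteq> d + b"
  shows "mps_mult (\<lambda>e. if e = d then c else 0) f e = 0"
  unfolding mps_mult_def by (rule sum.neutral) (use assms in auto)

lemma mps_mult_one: "mps_mult (\<lambda>e. if e = 0 then 1 else 0) f = f"
  using mps_mult_monom[of 0 1 f] by (simp add: fun_eq_iff)

lemma mps_mult_closed:
  assumes "f \<in> carrier (mps n)" "g \<in> carrier (mps n)"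
  shows "mps_mult f g \<in> carrier (mps n)"
proof -
  have "mps_mult f g e = 0" if "e \<notin> monomials n" for e
    unfolding mps_mult_def
    by (rule sum.neutral) (use assms that in \<open>auto simp: mps_def monomials_add\<close>)
  then show ?thesis by (simp add: mps_def)
qed

lemma mps_simps:
  "monoid.mult (mps n) = mps_mult" "one (mps n) = (\<lambda>e. if e = 0 then 1 else 0)"
  "ring.zero (mps n) = (\<lambda>e. 0)" "add (mps n) = (\<lambda>f g e. f e + g e)"
  "f \<in> carrier (mps n) \<longleftrightarrow> (\<forall>e. e \<notin> monomials n \<longrightarrow> f e = 0)"
  by (auto simp: mps_def mps_mult_def fun_eq_iff)

lemma cring_mps: "cring (mps n :: ((nat \<Rightarrow>\<^sub>0 nat) \<Rightarrow> 'a::field) ring)"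
proof (rule cringI)
  show "abelian_group (mps n :: ((nat \<Rightarrow>\<^sub>0 nat) \<Rightarrow> 'a) ring)"
  proof (rule abelian_groupI)
    fix f :: "(nat \<Rightarrow>\<^sub>0 nat) \<Rightarrow> 'a" assume "f \<in> carrier (mps n)"
    then show "\<exists>g\<in>carrier (mps n). g \<oplus>\<^bsub>mps n\<^esub> f = \<zero>\<^bsub>mps n\<^esub>"
      by (intro bexI[of _ "\<lambda>e. - f e"]) (auto simp: mps_simps)
  qed (auto simp: mps_simps add_ac)
  show "Group.comm_monoid (mps n :: ((nat \<Rightarrow>\<^sub>0 nat) \<Rightarrow> 'a) ring)"
    by (rule comm_monoidI)
      (auto simp: mps_simps(1,2) mps_mult_assoc mps_mult_one mps_mult_closed
        intro: mps_mult_commute, auto simp: mps_simps)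
qed (simp add: mps_simps mps_mult_distrib)

text \<open>The factor produced by differentiation is the exponent of X_i in a + b; it splits into
  the exponents in a and in b, and these give the two terms of the product rule.\<close>

lemma mps_deriv_mult:
  "mps_deriv i (mps_mult f g) = (\<lambda>e. mps_mult (mps_deriv i f) g e + mps_mult f (mps_deriv i g) e)"
proof
  fix e
  let ?s = "Poly_Mapping.single i (1::nat)"
  let ?l = "\<lambda>a. Poly_Mapping.lookup a i"
  let ?P = "{(a, b). a + b = e + ?s}"
  have split: "a = (a - ?s) + ?s" if "?l a \<noteq> 0" for a
    using that by (intro poly_mapping_eqI) (auto simp: lookup_add lookup_minus lookup_single when_def)
  \<comment> \<open>Pairs in which X_i is absent from a carry the factor 0; each of the others
    arises from exactly one pair with sum e by multiplying a by X_i. The second term is the same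
    with the roles exchanged.\<close>
  have half: "(\<Sum>(a, b)\<in>?P. of_nat (?l a) * (f a * g b)) = mps_mult (mps_deriv i f) g e" for f g :: "(nat \<Rightarrow>\<^sub>0 nat) \<Rightarrow> 'a"
  proof -
    have "mps_mult (mps_deriv i f) g e
        = (\<Sum>(a, b)\<in>{(a, b)\<in>?P. ?l a \<noteq> 0}. of_nat (?l a) * (f a * g b))"
      unfolding mps_mult_def
    proof (rule sum.reindex_bij_witness[of _ "\<lambda>(a, b). (a - ?s, b)" "\<lambda>(a, b). (a + ?s, b)"])
      fix p assume p: "p \<in> {(a, b)\<in>?P. ?l a \<noteq> 0}"
      obtain a b where ab: "p = (a, b)" by force
      with p have l: "?l a \<noteq> 0" and s: "a + b = e + ?s" by auto
      have "(a - ?s) + b + ?s = e + ?s" using split[OF l] s by (metis add.assoc add.commute)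
      then show "(case p of (a, b) \<Rightarrow> (a - ?s, b)) \<in> {(a, b). a + b = e}" using ab by simp
      show "(case case p of (a, b) \<Rightarrow> (a - ?s, b) of (a, b) \<Rightarrow> (a + ?s, b)) = p"
        using ab split[OF l] by simp
    qed (auto simp: mps_deriv_def lookup_add add_ac)
    also have "\<dots> = (\<Sum>(a, b)\<in>?P. of_nat (?l a) * (f a * g b))"
      by (rule sum.mono_neutral_left) (auto intro: ccontr)
    finally show ?thesis ..
  qed
  have "mps_deriv i (mps_mult f g) e = (\<Sum>(a, b)\<in>?P. of_nat (?l (a + b)) * (f a * g b))"
    unfolding mps_deriv_def mps_mult_def sum_distrib_left
  proof (rule sum.cong)
    fix p assume "p \<in> ?P"
    then obtain a b where ab: "p = (a, b)" "a + b = e + ?s" by auto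
    then have "?l (a + b) = Suc (?l e)" by (simp add: lookup_add)
    then show "of_nat (Suc (?l e)) * (case p of (a, b) \<Rightarrow> f a * g b)
        = (case p of (a, b) \<Rightarrow> of_nat (?l (a + b)) * (f a * g b))"
      by (simp add: ab(1))
  qed simp
  also have "\<dots> = (\<Sum>(a, b)\<in>?P. of_nat (?l a) * (f a * g b)) + (\<Sum>(a, b)\<in>?P. of_nat (?l b) * (f a * g b))"
    by (simp add: case_prod_unfold lookup_add algebra_simps sum.distrib)
  also have "(\<Sum>(a, b)\<in>?P. of_nat (?l b) * (f a * g b)) = (\<Sum>(a, b)\<in>?P. of_nat (?l a) * (g a * f b))"
    by (rule sum.reindex_bij_witness[of _ prod.swap prod.swap]) (auto simp: add.commute mult.commute)
  finally show "mps_deriv i (mps_mult f g) e = mps_mult (mps_deriv i f) g e + mps_mult f (mps_deriv i g) e"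
    unfolding half by (simp add: mps_mult_commute)
qed

lemma mps_deriv_closed: "i \<in> {1..n} \<Longrightarrow> f \<in> carrier (mps n) \<Longrightarrow> mps_deriv i f \<in> carrier (mps n)"
  by (auto simp: mps_simps mps_deriv_def monomials_add)

lemma mps_deriv_add: "mps_deriv i (\<lambda>e. f e + g e) = (\<lambda>e. mps_deriv i f e + mps_deriv i g e)"
  by (simp add: mps_deriv_def algebra_simps)

lemma mps_deriv_diff: "mps_deriv i (\<lambda>e. f e - g e) = (\<lambda>e. mps_deriv i f e - mps_deriv i g e)"
  by (simp add: mps_deriv_def algebra_simps)

definition order_ge :: "nat \<Rightarrow> ((nat \<Rightarrow>\<^sub>0 nat) \<Rightarrow> 'a::field) \<Rightarrow> bool"
  where "order_ge d f \<longleftrightarrow> (\<forall>e. total_degree e < d \<longrightarrow> f e = 0)"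

lemma order_ge_mult:
  assumes "order_ge c f" "order_ge d g"
  shows "order_ge (c + d) (mps_mult f g)"
  unfolding order_ge_def
proof (intro allI impI)
  fix e assume "total_degree e < c + d"
  then have "f a * g b = 0" if "a + b = e" for a b
    using that assms by (cases "total_degree a < c") (auto simp: order_ge_def total_degree_add)
  then show "mps_mult f g e = 0"
    unfolding mps_mult_def by (intro sum.neutral) auto
qed

section \<open>Evaluation of power series at nonunits of k[[t]]\<close>

definition mono_val :: "nat \<Rightarrow> (nat \<Rightarrow> 'a::field fps) \<Rightarrow> (nat \<Rightarrow>\<^sub>0 nat) \<Rightarrow> 'a fps"
  where "mono_val n \<xi> e = (\<Prod>i\<in>{1..n}. \<xi> i ^ Poly_Mapping.lookup e i)"

text \<open>\<open>mps_eval\<close> with values in k[[t]], where coefficients are indexed by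
  naturals. Cutting off at degree j loses nothing at t^j once every \<xi> has order at least 1,
  which the locale \<open>evaluation\<close> assumes.\<close>

definition ev :: "nat \<Rightarrow> (nat \<Rightarrow> 'a::field fps) \<Rightarrow> ((nat \<Rightarrow>\<^sub>0 nat) \<Rightarrow> 'a) \<Rightarrow> 'a fps"
  where "ev n \<xi> f = Abs_fps (\<lambda>j. \<Sum>e\<in>low_monomials n j. f e * fps_nth (mono_val n \<xi> e) j)"

lemma mps_eval_eq_ev:
  assumes "\<And>i. i \<in> {1..n} \<Longrightarrow> x i = fps_to_fls (\<xi> i)"
  shows "mps_eval n x f = fps_to_fls (ev n \<xi> f)"
proof -
  have prod: "fps_to_fls (prod h A) = (\<Prod>i\<in>A. fps_to_fls (h i))" for A :: "nat set" and h :: "nat \<Rightarrow> 'a fps"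
    by (induction A rule: infinite_finite_induct) (simp_all add: fls_times_fps_to_fls)
  have "(\<Prod>i\<in>{1..n}. x i ^ Poly_Mapping.lookup e i) = fps_to_fls (mono_val n \<xi> e)" for e
    unfolding mono_val_def prod fps_to_fls_power by (rule prod.cong) (simp_all only: assms)
  then have "fls_nth (\<Prod>i\<in>{1..n}. x i ^ Poly_Mapping.lookup e i) (int j) = fps_nth (mono_val n \<xi> e) j" for e j
    by (simp only: fps_to_fls_nth) simp
  then show ?thesis
    unfolding mps_eval_def ev_def low_monomials_def by (simp only:)
qed

lemma ev_add: "ev n \<xi> (\<lambda>e. f e + g e) = ev n \<xi> f + ev n \<xi> g"
  by (rule fps_ext) (simp add: ev_def distrib_right sum.distrib)

lemma ev_diff: "ev n \<xi> (\<lambda>e. f e - g e) = ev n \<xi> f - ev n \<xi> g"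
  by (rule fps_ext) (simp add: ev_def left_diff_distrib sum_subtractf)

lemma ev_scale: "ev n \<xi> (\<lambda>e. c * f e) = fps_const c * ev n \<xi> f"
  by (rule fps_ext) (simp add: ev_def sum_distrib_left mult.assoc)

lemma ev_zero: "ev n \<xi> (\<lambda>e. 0) = 0"
  by (rule fps_ext) (simp add: ev_def)

lemma mono_val_add: "mono_val n \<xi> (a + b) = mono_val n \<xi> a * mono_val n \<xi> b"
  by (simp add: mono_val_def lookup_add power_add prod.distrib)

lemma mono_val_0 [simp]: "mono_val n \<xi> 0 = 1"
  by (simp add: mono_val_def)

lemma mono_val_single:
  assumes "i \<in> {1..n}"
  shows "mono_val n \<xi> (Poly_Mapping.single i c) = \<xi> i ^ c"
proof -
  have "mono_val n \<xi> (Poly_Mapping.single i c) = (\<Prod>j\<in>{1..n}. if j = i then \<xi> i ^ c else 1)"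
    unfolding mono_val_def by (rule prod.cong) (auto simp: lookup_single when_def)
  also have "\<dots> = \<xi> i ^ c" using assms by simp
  finally show ?thesis .
qed

locale evaluation =
  fixes n :: nat and \<xi> :: "nat \<Rightarrow> 'a::field fps"
  assumes nonunit: "\<And>i. i \<in> {1..n} \<Longrightarrow> fps_nth (\<xi> i) 0 = 0"
begin

lemma mono_val_order:
  assumes "e \<in> monomials n"
  shows "\<exists>h. mono_val n \<xi> e = fps_X ^ total_degree e * h"
proof -
  have "\<exists>h. \<xi> i = fps_X * h" if "i \<in> {1..n}" for i
  proof
    show "\<xi> i = fps_X * fps_shift 1 (\<xi> i)"
      by (rule fps_ext) (simp add: nonunit[OF that])
  qed
  then obtain h where h: "\<And>i. i \<in> {1..n} \<Longrightarrow> \<xi> i = fps_X * h i" by metis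
  have "mono_val n \<xi> e = (\<Prod>i\<in>{1..n}. fps_X ^ Poly_Mapping.lookup e i * h i ^ Poly_Mapping.lookup e i)"
    unfolding mono_val_def by (rule prod.cong) (auto simp: h power_mult_distrib)
  also have "\<dots> = fps_X ^ total_degree e * (\<Prod>i\<in>{1..n}. h i ^ Poly_Mapping.lookup e i)"
    using assms by (subst total_degree_superset[of "{1..n}"])
      (auto simp: monomials_def prod.distrib power_sum)
  finally show ?thesis by blast
qed

lemma mono_val_nth_0:
  assumes "e \<in> monomials n" "j < total_degree e"
  shows "fps_nth (mono_val n \<xi> e * g) j = 0"
proof -
  obtain h where h: "mono_val n \<xi> e = fps_X ^ total_degree e * h"
    using mono_val_order[OF assms(1)] by blast
  show ?thesis
    unfolding h mult.assoc using assms(2) by (simp add: fps_X_power_mult_nth)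
qed

text \<open>A polynomial truncation, so that identities between values of series can be checked
  coefficientwise on finite sums of monomials.\<close>

definition ev_below :: "nat \<Rightarrow> ((nat \<Rightarrow>\<^sub>0 nat) \<Rightarrow> 'a) \<Rightarrow> 'a fps"
  where "ev_below N f = (\<Sum>e\<in>low_monomials n N. fps_const (f e) * mono_val n \<xi> e)"

lemma ev_nth:
  assumes "j \<le> N"
  shows "fps_nth (ev n \<xi> f) j = fps_nth (ev_below N f) j"
proof -
  have "fps_nth (ev n \<xi> f) j = (\<Sum>e\<in>low_monomials n j. f e * fps_nth (mono_val n \<xi> e) j)"
    by (simp add: ev_def)
  also have "\<dots> = (\<Sum>e\<in>low_monomials n N. f e * fps_nth (mono_val n \<xi> e) j)"
  proof (rule sum.mono_neutral_left)
    show "\<forall>e\<in>low_monomials n N - low_monomials n j. f e * fps_nth (mono_val n \<xi> e) j = 0"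
      using mono_val_nth_0[of _ j 1] by (force simp: low_monomials_def not_le)
    show "low_monomials n j \<subseteq> low_monomials n N"
      using assms by (auto simp: low_monomials_def)
  qed simp
  finally show ?thesis by (simp add: ev_below_def fps_sum_nth)
qed

text \<open>At t^N both factors may be replaced by their truncations. The product of these differs
  from the truncation of the product only in monomials of degree above N, which do not reach
  t^N.\<close>

lemma ev_mult: "ev n \<xi> (mps_mult f g) = ev n \<xi> f * ev n \<xi> g"
proof (rule fps_ext)
  fix N
  let ?L = "low_monomials n N"
  let ?t = "\<lambda>a b. fps_nth (fps_const (f a * g b) * mono_val n \<xi> (a + b)) N"
  have "fps_nth (ev n \<xi> f * ev n \<xi> g) N = fps_nth (ev_below N f * ev_below N g) N"
    unfolding fps_mult_nth by (rule sum.cong) (auto simp: ev_nth[where N = N])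
  also have "ev_below N f * ev_below N g
      = (\<Sum>a\<in>?L. \<Sum>b\<in>?L. fps_const (f a * g b) * mono_val n \<xi> (a + b))"
    unfolding ev_below_def sum_product mono_val_add
    by (simp flip: fps_const_mult add: mult_ac)
  also have "fps_nth \<dots> N = (\<Sum>(a, b)\<in>?L \<times> ?L. ?t a b)"
    by (simp add: fps_sum_nth sum.cartesian_product case_prod_unfold)
  also have "\<dots> = (\<Sum>(a, b)\<in>{(a, b). a + b \<in> ?L}. ?t a b)"
  proof (rule sum.mono_neutral_right)
    show "\<forall>p\<in>?L \<times> ?L - {(a, b). a + b \<in> ?L}. (case p of (a, b) \<Rightarrow> ?t a b) = 0"
    proof
      fix p assume "p \<in> ?L \<times> ?L - {(a, b). a + b \<in> ?L}"
      then obtain a b where p: "p = (a, b)" and *: "a \<in> ?L" "b \<in> ?L" "a + b \<notin> ?L" by auto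
      from * have "a + b \<in> monomials n" "N < total_degree (a + b)"
        by (auto simp: low_monomials_def monomials_add)
      then show "(case p of (a, b) \<Rightarrow> ?t a b) = 0"
        using mono_val_nth_0[of "a + b" N 1] by (simp add: p)
    qed
    show "{(a, b). a + b \<in> ?L} \<subseteq> ?L \<times> ?L"
      by (auto simp: low_monomials_def monomials_add total_degree_add)
  qed simp
  also have "{(a, b). a + b \<in> ?L} = snd ` Sigma ?L (\<lambda>e. {(a, b). a + b = e})"
    by (force simp: image_iff)
  also have "(\<Sum>(a, b)\<in>snd ` Sigma ?L (\<lambda>e. {(a, b). a + b = e}). ?t a b)
      = (\<Sum>(e, a, b)\<in>Sigma ?L (\<lambda>e. {(a, b). a + b = e}). ?t a b)"
    by (subst sum.reindex) (auto simp: inj_on_def case_prod_unfold)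
  also have "\<dots> = (\<Sum>e\<in>?L. \<Sum>(a, b)\<in>{(a, b). a + b = e}. ?t a b)"
    unfolding case_prod_unfold
    by (subst sum.Sigma) (auto simp: case_prod_unfold intro!: sum.cong)
  also have "\<dots> = (\<Sum>e\<in>?L. mps_mult f g e * fps_nth (mono_val n \<xi> e) N)"
    unfolding mps_mult_def sum_distrib_right by (intro sum.cong refl) auto
  also have "\<dots> = fps_nth (ev n \<xi> (mps_mult f g)) N"
    by (simp add: ev_def)
  finally show "fps_nth (ev n \<xi> (mps_mult f g)) N = fps_nth (ev n \<xi> f * ev n \<xi> g) N" ..
qed

lemma ev_monom:
  assumes "d \<in> monomials n"
  shows "ev n \<xi> (\<lambda>e. if e = d then c else 0) = fps_const c * mono_val n \<xi> d"
proof (rule fps_ext)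
  fix j
  have d: "d \<in> low_monomials n (j + total_degree d)" using assms by (auto simp: low_monomials_def)
  have "ev_below (j + total_degree d) (\<lambda>e. if e = d then c else 0)
    = (\<Sum>e\<in>low_monomials n (j + total_degree d). if e = d then fps_const c * mono_val n \<xi> d else 0)"
    unfolding ev_below_def by (rule sum.cong) auto
  also have "\<dots> = fps_const c * mono_val n \<xi> d" using d by simp
  finally show "fps_nth (ev n \<xi> (\<lambda>e. if e = d then c else 0)) j = fps_nth (fps_const c * mono_val n \<xi> d) j"
    by (simp add: ev_nth[of j "j + total_degree d"])
qed

lemma ev_one: "ev n \<xi> (\<lambda>e. if e = 0 then 1 else 0) = 1"
  using ev_monom[of 0 1] by simp

lemma ev_var: "i \<in> {1..n} \<Longrightarrow> ev n \<xi> (mps_var i) = \<xi> i"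
  using ev_monom[of "Poly_Mapping.single i 1" 1] mono_val_single[of i n \<xi> 1]
  by (simp add: mps_var_def monomials_single)

lemma ev_nth_0: "fps_nth (ev n \<xi> f) 0 = f 0"
proof -
  have "low_monomials n 0 = {0}" by (auto simp: low_monomials_def total_degree_0_iff)
  then show ?thesis by (simp add: ev_def)
qed

text \<open>Checked at t^N on truncations. Differentiation lowers degrees by one, so f is cut at
  \<open>Suc N\<close> and its partial derivatives at N; removing one X_i matches the two index
  sets.\<close>

lemma ev_chain_rule:
  "fps_deriv (ev n \<xi> f) = (\<Sum>i\<in>{1..n}. ev n \<xi> (mps_deriv i f) * fps_deriv (\<xi> i))"
proof (rule fps_ext)
  fix N
  let ?s = "\<lambda>i. Poly_Mapping.single i (1::nat)"
  let ?l = "\<lambda>e i. Poly_Mapping.lookup e i"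
  have deriv_prod: "fps_deriv (prod h A) = (\<Sum>i\<in>A. prod h (A - {i}) * fps_deriv (h i))"
    if "finite A" for A :: "nat set" and h :: "nat \<Rightarrow> 'a fps"
    using that
  proof (induction A rule: finite_induct)
    case (insert k A)
    have "prod h (insert k A - {i}) = h k * prod h (A - {i})" if "i \<in> A" for i
      using insert that by (simp add: insert_Diff_if) (metis)
    then have "(\<Sum>i\<in>A. prod h (insert k A - {i}) * fps_deriv (h i)) = h k * (\<Sum>i\<in>A. prod h (A - {i}) * fps_deriv (h i))"
      by (simp add: sum_distrib_left mult.assoc)
    then show ?case using insert by (simp add: mult.commute)
  qed simp
  \<comment> \<open>For exponent 0 the subtraction \<open>e - ?s i\<close> is truncated, but then
    the factor \<open>?l e i\<close> vanishes.\<close>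
  have mono_deriv: "fps_deriv (mono_val n \<xi> e)
      = (\<Sum>i\<in>{1..n}. of_nat (?l e i) * (mono_val n \<xi> (e - ?s i) * fps_deriv (\<xi> i)))" for e
  proof -
    have "(\<Prod>j\<in>{1..n} - {i}. \<xi> j ^ ?l e j) * fps_deriv (\<xi> i ^ ?l e i)
        = of_nat (?l e i) * (mono_val n \<xi> (e - ?s i) * fps_deriv (\<xi> i))" if i: "i \<in> {1..n}" for i
    proof -
      have "(\<Prod>j\<in>{1..n} - {i}. \<xi> j ^ ?l e j) = (\<Prod>j\<in>{1..n} - {i}. \<xi> j ^ ?l (e - ?s i) j)"
        by (rule prod.cong) (auto simp: lookup_minus lookup_single when_def)
      moreover have "mono_val n \<xi> (e - ?s i)
          = \<xi> i ^ (?l e i - 1) * (\<Prod>j\<in>{1..n} - {i}. \<xi> j ^ ?l (e - ?s i) j)"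
        unfolding mono_val_def using i
        by (subst prod.remove[of _ i]) (auto simp: lookup_minus lookup_single)
      ultimately show ?thesis
        by (simp add: fps_deriv_power fps_of_nat mult_ac)
    qed
    then show ?thesis
      unfolding mono_val_def by (subst deriv_prod) (auto intro!: sum.cong simp: mono_val_def)
  qed
  let ?L = "low_monomials n (Suc N)"
  let ?t = "\<lambda>i e. f (e + ?s i) * of_nat (Suc (?l e i)) * fps_nth (mono_val n \<xi> e * fps_deriv (\<xi> i)) N"
  have part: "(\<Sum>e\<in>?L. f e * of_nat (?l e i) * fps_nth (mono_val n \<xi> (e - ?s i) * fps_deriv (\<xi> i)) N)
      = fps_nth (ev n \<xi> (mps_deriv i f) * fps_deriv (\<xi> i)) N" if i: "i \<in> {1..n}" for i
  proof -
    have split: "e = (e - ?s i) + ?s i" if "?l e i \<noteq> 0" for e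
      using that by (intro poly_mapping_eqI) (auto simp: lookup_add lookup_minus lookup_single when_def)
    have "(\<Sum>e\<in>?L. f e * of_nat (?l e i) * fps_nth (mono_val n \<xi> (e - ?s i) * fps_deriv (\<xi> i)) N)
        = (\<Sum>e\<in>{e \<in> ?L. ?l e i \<noteq> 0}. f e * of_nat (?l e i) * fps_nth (mono_val n \<xi> (e - ?s i) * fps_deriv (\<xi> i)) N)"
      by (rule sum.mono_neutral_right) auto
    also have "\<dots> = (\<Sum>e\<in>low_monomials n N. ?t i e)"
    proof (rule sum.reindex_bij_witness[of _ "\<lambda>e. e + ?s i" "\<lambda>e. e - ?s i"])
      fix e assume e: "e \<in> {e \<in> ?L. ?l e i \<noteq> 0}"
      then have s: "e - ?s i + ?s i = e" using split[of e] by auto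
      then show "e - ?s i + ?s i = e" .
      from e have "e - ?s i + ?s i \<in> ?L" unfolding s by simp
      then show "e - ?s i \<in> low_monomials n N"
        by (simp add: low_monomials_def monomials_add total_degree_add)
      have "Suc (?l (e - ?s i) i) = ?l e i" using e by (simp add: lookup_minus lookup_single)
      then show "?t i (e - ?s i) = f e * of_nat (?l e i) * fps_nth (mono_val n \<xi> (e - ?s i) * fps_deriv (\<xi> i)) N"
        by (simp only: s)
    next
      fix e assume "e \<in> low_monomials n N"
      then show "e + ?s i \<in> {e \<in> ?L. ?l e i \<noteq> 0}"
        using i by (auto simp: low_monomials_def monomials_add total_degree_add monomials_single lookup_add lookup_single)
    qed simp
    also have "\<dots> = fps_nth (ev_below N (mps_deriv i f) * fps_deriv (\<xi> i)) N"
      unfolding ev_below_def sum_distrib_right fps_sum_nth mps_deriv_def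
      by (rule sum.cong) (simp_all only: mult.assoc fps_mult_left_const_nth, simp add: mult_ac)
    also have "\<dots> = fps_nth (ev n \<xi> (mps_deriv i f) * fps_deriv (\<xi> i)) N"
      unfolding fps_mult_nth by (rule sum.cong) (auto simp: ev_nth[where N = N])
    finally show ?thesis .
  qed
  have "fps_nth (fps_deriv (ev n \<xi> f)) N = fps_nth (fps_deriv (ev_below (Suc N) f)) N"
    by (simp add: ev_nth[where N = "Suc N"])
  also have "fps_deriv (ev_below (Suc N) f)
      = (\<Sum>e\<in>?L. \<Sum>i\<in>{1..n}. fps_const (f e * of_nat (?l e i)) * (mono_val n \<xi> (e - ?s i) * fps_deriv (\<xi> i)))"
    unfolding ev_below_def fps_deriv_sum
    by (rule sum.cong) (simp_all add: mono_deriv sum_distrib_left fps_of_nat mult.assoc flip: fps_const_mult)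
  also have "fps_nth \<dots> N
      = (\<Sum>i\<in>{1..n}. \<Sum>e\<in>?L. f e * of_nat (?l e i) * fps_nth (mono_val n \<xi> (e - ?s i) * fps_deriv (\<xi> i)) N)"
    by (subst sum.swap) (simp add: fps_sum_nth)
  also have "\<dots> = fps_nth (\<Sum>i\<in>{1..n}. ev n \<xi> (mps_deriv i f) * fps_deriv (\<xi> i)) N"
    unfolding fps_sum_nth by (rule sum.cong) (simp_all only: part)
  finally show "fps_nth (fps_deriv (ev n \<xi> f)) N
      = fps_nth (\<Sum>i\<in>{1..n}. ev n \<xi> (mps_deriv i f) * fps_deriv (\<xi> i)) N" .
qed

end

section \<open>Relations among the derivatives\<close>

lemma ev_sum: "ev n \<xi> (\<lambda>e. \<Sum>i\<in>A. f i e) = (\<Sum>i\<in>A. ev n \<xi> (f i))"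
  by (induction A rule: infinite_finite_induct) (simp_all add: ev_zero ev_add)

lemma mps_deriv_sum: "mps_deriv i (\<lambda>e. \<Sum>j\<in>A. f j e) = (\<lambda>e. \<Sum>j\<in>A. mps_deriv i (f j) e)"
  by (simp add: mps_deriv_def sum_distrib_left)

lemma mps_deriv_zero: "mps_deriv i (\<lambda>e. 0) = (\<lambda>e. 0)"
  by (simp add: mps_deriv_def)

lemma mps_var_mult: "mps_mult (mps_var i) f (Poly_Mapping.single i 1 + e) = f e"
  using mps_mult_monom[of "Poly_Mapping.single i 1" 1 f e] by (simp add: mps_var_def)

lemma mps_var_mult_0:
  assumes "Poly_Mapping.lookup e i = 0"
  shows "mps_mult (mps_var i) f e = 0"
proof -
  have "e \<noteq> Poly_Mapping.single i 1 + b" for b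
    using assms by (auto simp: lookup_add)
  then show ?thesis
    using mps_mult_monom_0[of e "Poly_Mapping.single i 1" 1 f] by (simp add: mps_var_def)
qed

lemma single_diff_add:
  assumes "Poly_Mapping.lookup e i \<noteq> (0::nat)"
  shows "Poly_Mapping.single i 1 + (e - Poly_Mapping.single i 1) = e"
  using assms by (intro poly_mapping_eqI) (auto simp: lookup_add lookup_minus lookup_single when_def)

lemma mps_var_mult_nth:
  "mps_mult (mps_var i) f e
    = (if Poly_Mapping.lookup e i = 0 then 0 else f (e - Poly_Mapping.single i 1))"
  using mps_var_mult_0[of e i f] mps_var_mult[of i f "e - Poly_Mapping.single i 1"] single_diff_add[of e i]
  by auto

lemma mps_var_closed: "i \<in> {1..n} \<Longrightarrow> mps_var i \<in> carrier (mps n)"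
  by (auto simp: mps_simps mps_var_def monomials_single)

text \<open>Sorting exponents by their residue modulo d expresses a series through 1, t, ...,
  t^(d-1) over k[[t^d]]. For t^d = x_1 this is what turns statements about all series into finite
  sums.\<close>

lemma fps_split_residues:
  fixes g :: "'a::field fps"
  assumes "0 < d"
  shows "g = (\<Sum>j<d. fps_X ^ j * Abs_fps (\<lambda>k. if d dvd k then fps_nth g (j + k) else 0))"
proof (rule fps_ext)
  fix k
  have "fps_nth (\<Sum>j<d. fps_X ^ j * Abs_fps (\<lambda>k. if d dvd k then fps_nth g (j + k) else 0)) k
      = (\<Sum>j<d. if j = k mod d then fps_nth g k else 0)"
    unfolding fps_sum_nth
  proof (rule sum.cong)
    fix j assume j: "j \<in> {..<d}"
    have "j \<le> k \<and> d dvd (k - j) \<longleftrightarrow> j = k mod d"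
    proof
      assume "j \<le> k \<and> d dvd (k - j)"
      then obtain l where "k = j + d * l"
        by (metis dvdE le_add_diff_inverse)
      then show "j = k mod d" using j by simp
    next
      assume "j = k mod d" then show "j \<le> k \<and> d dvd (k - j)"
        by (simp add: minus_mod_eq_mult_div)
    qed
    then show "fps_nth (fps_X ^ j * Abs_fps (\<lambda>k. if d dvd k then fps_nth g (j + k) else 0)) k
        = (if j = k mod d then fps_nth g k else 0)"
      by (auto simp: fps_X_power_mult_nth not_less)
  qed simp
  also have "\<dots> = fps_nth g k" using assms by simp
  finally show "fps_nth g k = fps_nth (\<Sum>j<d. fps_X ^ j * Abs_fps (\<lambda>k. if d dvd k then fps_nth g (j + k) else 0)) k" ..
qed

section \<open>The ring of values and its conductor\<close>

context evaluation
begin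

abbreviation "E \<equiv> ev n \<xi>"
abbreviation "P \<equiv> carrier (mps n :: ((nat \<Rightarrow>\<^sub>0 nat) \<Rightarrow> 'a) ring)"

definition R :: "'a fps set"
  where "R = E ` P"

lemma P_add: "g \<in> P \<Longrightarrow> h \<in> P \<Longrightarrow> (\<lambda>e. g e + h e) \<in> P"
  and P_diff: "g \<in> P \<Longrightarrow> h \<in> P \<Longrightarrow> (\<lambda>e. g e - h e) \<in> P"
  and P_scale: "g \<in> P \<Longrightarrow> (\<lambda>e. k * g e) \<in> P"
  and P_zero: "(\<lambda>e. 0) \<in> P"
  by (auto simp: mps_simps)

lemma P_sum: "(\<And>i. i \<in> A \<Longrightarrow> g i \<in> P) \<Longrightarrow> (\<lambda>e. \<Sum>i\<in>A. g i e) \<in> P"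
  by (auto simp: mps_simps)

lemma E_in_R: "g \<in> P \<Longrightarrow> E g \<in> R"
  by (simp add: R_def)

lemma R_obtain:
  assumes "z \<in> R" obtains g where "g \<in> P" "E g = z"
  using assms by (auto simp: R_def)

lemma R_add:
  assumes "y \<in> R" "z \<in> R" shows "y + z \<in> R"
proof -
  obtain g where "g \<in> P" "E g = y" using assms(1) by (rule R_obtain)
  moreover obtain h where "h \<in> P" "E h = z" using assms(2) by (rule R_obtain)
  ultimately show ?thesis using E_in_R[OF P_add[of g h]] by (simp add: ev_add)
qed

lemma R_diff:
  assumes "y \<in> R" "z \<in> R" shows "y - z \<in> R"
proof -
  obtain g where "g \<in> P" "E g = y" using assms(1) by (rule R_obtain)
  moreover obtain h where "h \<in> P" "E h = z" using assms(2) by (rule R_obtain)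
  ultimately show ?thesis using E_in_R[OF P_diff[of g h]] by (simp add: ev_diff)
qed

lemma R_mult:
  assumes "y \<in> R" "z \<in> R" shows "y * z \<in> R"
proof -
  obtain g where "g \<in> P" "E g = y" using assms(1) by (rule R_obtain)
  moreover obtain h where "h \<in> P" "E h = z" using assms(2) by (rule R_obtain)
  ultimately show ?thesis using E_in_R[OF mps_mult_closed[of g n h]] by (simp add: ev_mult)
qed

lemma R_const: "fps_const k \<in> R"
proof -
  have "E (\<lambda>e. k * (if e = 0 then 1 else 0)) = fps_const k"
    by (simp only: ev_scale ev_one) simp
  moreover have "(\<lambda>e. k * (if e = 0 then 1 else 0)) \<in> P" by (auto simp: mps_simps)
  ultimately show ?thesis using E_in_R by metis
qed

lemma R_01: "0 \<in> R" "1 \<in> R"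
  using R_const[of 0] R_const[of 1] by simp_all

lemma R_sum: "(\<And>i. i \<in> A \<Longrightarrow> g i \<in> R) \<Longrightarrow> sum g A \<in> R"
  by (induction A rule: infinite_finite_induct) (auto intro: R_add R_01)

lemma R_power: "z \<in> R \<Longrightarrow> z ^ k \<in> R"
  by (induction k) (auto intro: R_mult R_01)

lemma R_subspace: "fps_subspace R"
  by (auto simp: fps_subspace_def intro: R_01 R_add R_mult R_const)

lemma R_\<xi>: "i \<in> {1..n} \<Longrightarrow> \<xi> i \<in> R"
  using E_in_R[OF mps_var_closed] ev_var by metis

text \<open>A power of X_1 goes to a power of t^d, so every series in t^d is the value of a series
  in X_1, and \<open>R\<close> contains k[[t^d]].\<close>

lemma ev_univariate:
  assumes "1 \<le> n" "0 < d" "\<xi> 1 = fps_X ^ d"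
  shows "ev n \<xi> (\<lambda>e. if Poly_Mapping.keys e \<subseteq> {1} then u (Poly_Mapping.lookup e 1) else 0)
    = Abs_fps (\<lambda>k. if d dvd k then u (k div d) else 0)" (is "ev n \<xi> ?g = _")
proof (rule fps_ext)
  fix k
  let ?s = "Poly_Mapping.single (1::nat)"
  have s: "e = ?s (Poly_Mapping.lookup e 1)" if "Poly_Mapping.keys e \<subseteq> {1}" for e :: "nat \<Rightarrow>\<^sub>0 nat"
    using that by (intro poly_mapping_eqI) (auto simp: lookup_single when_def in_keys_iff)
  have "fps_nth (ev n \<xi> ?g) k = (\<Sum>e\<in>low_monomials n k. ?g e * fps_nth (mono_val n \<xi> e) k)"
    by (simp add: ev_def)
  also have "\<dots> = (\<Sum>e\<in>?s ` {..k}. ?g e * fps_nth (mono_val n \<xi> e) k)"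
  proof (rule sum.mono_neutral_right)
    show "?s ` {..k} \<subseteq> low_monomials n k"
      using assms(1) by (auto simp: low_monomials_def monomials_single)
    show "\<forall>e\<in>low_monomials n k - ?s ` {..k}. ?g e * fps_nth (mono_val n \<xi> e) k = 0"
    proof
      fix e assume e: "e \<in> low_monomials n k - ?s ` {..k}"
      have "\<not> Poly_Mapping.keys e \<subseteq> {1}"
      proof
        assume "Poly_Mapping.keys e \<subseteq> {1}"
        from s[OF this] e show False
          using lookup_le_total_degree[of e 1]
          by (metis (mono_tags, lifting) DiffD1 DiffD2 atMost_iff image_eqI low_monomials_def mem_Collect_eq order_trans)
      qed
      then show "?g e * fps_nth (mono_val n \<xi> e) k = 0" by simp
    qed
  qed simp
  also have "\<dots> = (\<Sum>l\<le>k. u l * fps_nth (fps_X ^ (d * l)) k)"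
    using assms by (subst sum.reindex)
      (auto simp: inj_on_def mono_val_single power_mult intro!: sum.cong dest: arg_cong[where f = "\<lambda>e. Poly_Mapping.lookup e 1"])
  also have "\<dots> = (\<Sum>l\<le>k. if d * l = k then u l else 0)"
    by (rule sum.cong) (auto simp: fps_X_power_nth)
  also have "\<dots> = (if d dvd k then u (k div d) else 0)"
  proof (cases "d dvd k")
    case True
    then obtain l where "k = d * l" by auto
    then show ?thesis using assms(2) by (simp add: sum.delta)
  next
    case False
    then have "d * l \<noteq> k" for l by auto
    then show ?thesis using False by simp
  qed
  finally show "fps_nth (ev n \<xi> ?g) k = fps_nth (Abs_fps (\<lambda>k. if d dvd k then u (k div d) else 0)) k"
    by simp
qed

text \<open>Finitely many powers of t generate k[[t]] over k[[t^d]], a subring of \<open>R\<close>.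
  A common denominator of them therefore carries all of k[[t]] into \<open>R\<close>, and up to a
  unit it is a power of t.\<close>

lemma conductor_exists:
  assumes n: "1 \<le> n" and d: "0 < d" "\<xi> 1 = fps_X ^ d"
    and frac: "\<And>j. \<exists>b\<in>R. b \<noteq> 0 \<and> b * fps_X ^ j \<in> R"
  shows "\<exists>c. \<forall>g. fps_X ^ c * g \<in> R"
proof -
  obtain b where b: "\<And>j. b j \<in> R" "\<And>j. b j \<noteq> 0" "\<And>j. b j * fps_X ^ j \<in> R"
    using frac by metis
  define B where "B = prod b {..<d}"
  have "prod b A \<in> R" for A :: "nat set"
    by (induction A rule: infinite_finite_induct) (auto intro: R_mult R_01 b)
  note prod_R = this
  have BX: "B * fps_X ^ j \<in> R" if "j < d" for j
  proof -
    have "B = b j * prod b ({..<d} - {j})" unfolding B_def using that by (intro prod.remove) auto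
    then have "B * fps_X ^ j = (b j * fps_X ^ j) * prod b ({..<d} - {j})" by (simp only: mult_ac)
    then show ?thesis using R_mult[OF b(3) prod_R] by metis
  qed
  have Bg: "B * g \<in> R" for g
  proof -
    define u where "u j = (\<lambda>e. if Poly_Mapping.keys e \<subseteq> {1::nat} then fps_nth g (j + d * Poly_Mapping.lookup e 1) else 0)" for j
    have Eu: "E (u j) = Abs_fps (\<lambda>k. if d dvd k then fps_nth g (j + k) else 0)" for j
      unfolding u_def using ev_univariate[OF n d, of "\<lambda>l. fps_nth g (j + d * l)"]
      by (simp add: dvd_mult_div_cancel cong: if_cong)
    have uP: "u j \<in> P" for j using n by (auto simp: u_def mps_simps monomials_def)
    have "B * g = (\<Sum>j<d. (B * fps_X ^ j) * E (u j))"
      unfolding Eu mult.assoc sum_distrib_left[symmetric] fps_split_residues[OF d(1), of g, symmetric] ..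
    also have "\<dots> \<in> R" by (intro R_sum R_mult BX E_in_R uP) auto
    finally show ?thesis .
  qed
  have "B \<noteq> 0" unfolding B_def using b(2) by simp
  define h where "h = fps_shift (subdegree B) B"
  have h0: "fps_nth h 0 \<noteq> 0" using \<open>B \<noteq> 0\<close> by (simp add: h_def)
  have Bh: "B = fps_X ^ subdegree B * h"
    unfolding h_def by (metis mult.commute subdegree_decompose)
  \<comment> \<open>The unit part of B is absorbed into g, which ranges over all of k[[t]].\<close>
  have "fps_X ^ subdegree B * g \<in> R" for g
  proof -
    have "B * (inverse h * g) = fps_X ^ subdegree B * (h * inverse h) * g"
      by (subst Bh) (simp only: mult_ac)
    also have "h * inverse h = 1" using h0 by (rule inverse_mult_eq_1')
    finally have "B * (inverse h * g) = fps_X ^ subdegree B * g" by (simp only: mult_1_right)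
    then show ?thesis using Bg[of "inverse h * g"] by (simp only:)
  qed
  then show ?thesis by blast
qed

end

text \<open>Here \<open>ord1\<close> is the order of x_1 and \<open>cond\<close> is any exponent
  with t^cond k[[t]] inside \<open>R\<close>, not only the least one. The assumption
  \<open>ker_order\<close> expresses that the presentation ideal lies in (X)^2.\<close>

locale branch_presentation = evaluation n \<xi>
  for n :: nat and \<xi> :: "nat \<Rightarrow> 'a::field_char_0 fps" +
  fixes ord1 cond m :: nat and f :: "nat \<Rightarrow> (nat \<Rightarrow>\<^sub>0 nat) \<Rightarrow> 'a"
  assumes n_pos: "1 \<le> n" and ord1_pos: "0 < ord1" and \<xi>_1: "\<xi> 1 = fps_X ^ ord1"
    and cond: "\<And>g. fps_X ^ cond * g \<in> R"
    and f_carrier: "\<And>j. j \<in> {1..m} \<Longrightarrow> f j \<in> P"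
    and f_ker: "\<And>j. j \<in> {1..m} \<Longrightarrow> E (f j) = 0"
    and ker_order: "\<And>g. g \<in> P \<Longrightarrow> E g = 0 \<Longrightarrow> order_ge 2 g"
    and ker_gen: "\<And>g. g \<in> P \<Longrightarrow> E g = 0 \<Longrightarrow> g \<in> Idl\<^bsub>mps n\<^esub> (f ` {1..m})"
begin

text \<open>The image of the Jacobian matrix; only the values of a vector on \<open>{1..n}\<close> matter.\<close>

definition N :: "(nat \<Rightarrow> 'a fps) set"
  where "N = {v. \<exists>c. (\<forall>j\<in>{1..m}. c j \<in> R) \<and>
    (\<forall>i\<in>{1..n}. v i = (\<Sum>j\<in>{1..m}. E (mps_deriv i (f j)) * c j))}"

lemma R_cond: "cond \<le> k \<Longrightarrow> fps_X ^ k * g \<in> R"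
  using cond[of "fps_X ^ (k - cond) * g"] by (simp flip: power_add mult.assoc)

lemma N_cong: "v \<in> N \<Longrightarrow> (\<And>i. i \<in> {1..n} \<Longrightarrow> v i = w i) \<Longrightarrow> w \<in> N"
  by (auto simp: N_def)

lemma N_add:
  assumes "v \<in> N" "w \<in> N" shows "(\<lambda>i. v i + w i) \<in> N"
proof -
  from assms obtain c d where "\<forall>j\<in>{1..m}. c j \<in> R" "\<forall>j\<in>{1..m}. d j \<in> R"
    "\<forall>i\<in>{1..n}. v i = (\<Sum>j\<in>{1..m}. E (mps_deriv i (f j)) * c j)"
    "\<forall>i\<in>{1..n}. w i = (\<Sum>j\<in>{1..m}. E (mps_deriv i (f j)) * d j)"
    unfolding N_def by blast
  then show ?thesis
    unfolding N_def by (intro CollectI exI[of _ "\<lambda>j. c j + d j"])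
      (simp add: R_add distrib_left sum.distrib)
qed

lemma N_scale:
  assumes "v \<in> N" "\<rho> \<in> R" shows "(\<lambda>i. \<rho> * v i) \<in> N"
proof -
  from assms obtain c where "\<forall>j\<in>{1..m}. c j \<in> R"
    "\<forall>i\<in>{1..n}. v i = (\<Sum>j\<in>{1..m}. E (mps_deriv i (f j)) * c j)"
    unfolding N_def by blast
  then show ?thesis
    unfolding N_def by (intro CollectI exI[of _ "\<lambda>j. \<rho> * c j"])
      (simp add: R_mult assms(2) sum_distrib_left mult_ac)
qed

lemma N_zero: "(\<lambda>i. 0) \<in> N"
  unfolding N_def by (intro CollectI exI[of _ "\<lambda>j. 0"]) (simp add: R_01)

lemma N_sum: "(\<And>k. k \<in> A \<Longrightarrow> v k \<in> N) \<Longrightarrow> (\<lambda>i. \<Sum>k\<in>A. v k i) \<in> N"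
  by (induction A rule: infinite_finite_induct) (simp_all add: N_zero N_add)

lemma N_diff: "v \<in> N \<Longrightarrow> w \<in> N \<Longrightarrow> (\<lambda>i. v i - w i) \<in> N"
  using N_add[OF _ N_scale[OF _ R_const[of "- 1"]], of v w] by (simp flip: fps_const_neg)

text \<open>If E g = 0, the product rule for h * g loses the term with E g, so the gradient of h * g
  is a multiple of that of g. Hence the relations with gradient in \<open>N\<close> form an ideal,
  and it contains every f_j.\<close>

lemma ker_grad:
  assumes "g \<in> P" "E g = 0" shows "(\<lambda>i. E (mps_deriv i g)) \<in> N"
proof -
  let ?K = "{g \<in> P. E g = 0 \<and> (\<lambda>i. E (mps_deriv i g)) \<in> N}"
  interpret mps: cring "mps n :: ((nat \<Rightarrow>\<^sub>0 nat) \<Rightarrow> 'a) ring" by (rule cring_mps)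
  have left: "mps_mult h g \<in> ?K" if g: "g \<in> ?K" and h: "h \<in> P" for g h
  proof -
    have "(\<lambda>i. E h * E (mps_deriv i g)) \<in> N" using g by (intro N_scale E_in_R h) auto
    then have "(\<lambda>i. E (mps_deriv i (mps_mult h g))) \<in> N"
      by (rule N_cong) (use g in \<open>simp add: mps_deriv_mult ev_add ev_mult\<close>)
    then show ?thesis using g h by (simp add: ev_mult mps_mult_closed)
  qed
  have "ideal ?K (mps n)"
  proof (rule idealI)
    show "subgroup ?K (add_monoid (mps n))"
    proof (rule mps.add.subgroupI)
      show "?K \<noteq> {}"
        using N_zero P_zero by (auto simp: ev_zero mps_deriv_zero intro!: exI[of _ "\<lambda>e. 0"])
    next
      fix g assume g: "g \<in> ?K"
      have "\<ominus>\<^bsub>mps n\<^esub> g = (\<lambda>e. 0 - g e)"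
      proof (rule mps.minus_equality)
        show "(\<lambda>e. 0 - g e) \<oplus>\<^bsub>mps n\<^esub> g = \<zero>\<^bsub>mps n\<^esub>" by (simp add: mps_simps(3,4))
      qed (use g P_diff[OF P_zero] in auto)
      moreover have "(\<lambda>i. E (mps_deriv i (\<lambda>e. 0 - g e))) \<in> N"
        unfolding mps_deriv_diff ev_diff mps_deriv_zero ev_zero using g by (intro N_diff N_zero) auto
      ultimately show "\<ominus>\<^bsub>mps n\<^esub> g \<in> ?K"
        using g P_diff[OF P_zero, of g] ev_diff[of n \<xi> "\<lambda>e. 0" g] by (simp add: ev_zero)
    next
      fix g h assume "g \<in> ?K" "h \<in> ?K"
      then show "g \<oplus>\<^bsub>mps n\<^esub> h \<in> ?K"
        using N_add[of "\<lambda>i. E (mps_deriv i g)" "\<lambda>i. E (mps_deriv i h)"] P_add[of g h]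
        by (simp add: mps_simps(4) ev_add mps_deriv_add)
    qed auto
  qed (use left mps.ring_axioms in \<open>auto simp: mps_simps(1) mps_mult_commute\<close>)
  moreover have "f ` {1..m} \<subseteq> ?K"
  proof
    fix g assume "g \<in> f ` {1..m}"
    then obtain j where j: "j \<in> {1..m}" "g = f j" by blast
    have "(\<lambda>i. E (mps_deriv i (f j))) \<in> N"
      unfolding N_def using j(1)
      by (intro CollectI exI[of _ "\<lambda>k. if k = j then 1 else 0"]) (auto simp: R_01 if_distrib cong: if_cong)
    then show "g \<in> ?K" using j f_carrier f_ker by simp
  qed
  ultimately have "Idl\<^bsub>mps n\<^esub> (f ` {1..m}) \<subseteq> ?K" by (rule mps.genideal_minimal)
  then show ?thesis using ker_gen[OF assms] by blast
qed

end

text \<open>R^n modulo \<open>N\<close> is the module of differentials; it has no torsion exactly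
  when \<open>N\<close> is saturated. Phrasing this with vectors avoids cosets in everything that
  follows.\<close>

locale torsion_free_branch = branch_presentation +
  assumes torsion_free: "\<And>\<rho> v. \<lbrakk>\<rho> \<in> R; \<rho> \<noteq> 0; \<And>i. i \<in> {1..n} \<Longrightarrow> v i \<in> R; (\<lambda>i. \<rho> * v i) \<in> N\<rbrakk> \<Longrightarrow> v \<in> N"
begin

text \<open>The defect of \<open>dF\<close> from the multiple of \<open>dx\<^sub>1\<close> with the same image in \<open>k((t)) dt\<close>, with
  denominators cleared.  It is a derivation, and the claim is that it vanishes modulo \<open>N\<close>.\<close>

definition defect :: "((nat \<Rightarrow>\<^sub>0 nat) \<Rightarrow> 'a) \<Rightarrow> nat \<Rightarrow> 'a fps"
  where "defect g i = fps_X ^ cond * (fps_deriv (\<xi> 1) * E (mps_deriv i g)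
    - (if i = 1 then fps_deriv (E g) else 0))"

lemma defect_in_R: "defect g i \<in> R"
  unfolding defect_def by (rule cond)

lemma defect_mult: "defect (mps_mult g h) i = E g * defect h i + E h * defect g i"
  by (simp add: defect_def mps_deriv_mult ev_add ev_mult algebra_simps)

lemma defect_add: "defect (\<lambda>e. g e + h e) i = defect g i + defect h i"
  by (simp add: defect_def mps_deriv_add ev_add algebra_simps)

lemma defect_diff: "defect (\<lambda>e. g e - h e) i = defect g i - defect h i"
  by (simp add: defect_def mps_deriv_diff ev_diff algebra_simps)

lemma defect_ker:
  assumes "g \<in> P" "E g = 0" shows "defect g \<in> N"
  using N_scale[OF ker_grad[OF assms] cond[of "fps_deriv (\<xi> 1)"]]
  by (rule N_cong) (simp add: defect_def assms(2) mult.assoc)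

text \<open>Two lifts of one element differ by a relation, and the defect of a relation is a
  multiple of its gradient. So \<open>defect\<close> induces a derivation from R to R^n modulo
  \<open>N\<close>, and lifts may be chosen at will.\<close>

lemma defect_cong:
  assumes "g \<in> P" "h \<in> P" "E g = E h" "defect g \<in> N"
  shows "defect h \<in> N"
proof -
  have "defect (\<lambda>e. h e - g e) \<in> N"
    by (rule defect_ker) (use assms in \<open>auto simp: ev_diff intro: P_diff\<close>)
  from N_add[OF this assms(4)] show ?thesis
    by (rule N_cong) (simp add: defect_diff)
qed

text \<open>For a series in X_1 alone the chain rule has a single term, which cancels in the only
  entry that could survive. This holds exactly, for infinite series too.\<close>

lemma defect_univariate:
  assumes "\<And>e. g e \<noteq> 0 \<Longrightarrow> Poly_Mapping.keys e \<subseteq> {1}" "i \<in> {1..n}"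
  shows "defect g i = 0"
proof -
  have 0: "E (mps_deriv j g) = 0" if "j \<noteq> 1" for j
  proof -
    have "mps_deriv j g = (\<lambda>e. 0)"
      using assms(1) that by (fastforce simp: mps_deriv_def keys_add_nat)
    then show ?thesis by (simp add: ev_zero)
  qed
  have "fps_deriv (E g) = (\<Sum>j\<in>{1..n}. E (mps_deriv j g) * fps_deriv (\<xi> j))"
    by (rule ev_chain_rule)
  also have "\<dots> = (\<Sum>j\<in>{1}. E (mps_deriv j g) * fps_deriv (\<xi> j))"
    by (rule sum.mono_neutral_right) (use n_pos 0 in auto)
  finally have "fps_deriv (E g) = E (mps_deriv 1 g) * fps_deriv (\<xi> 1)" by simp
  then show ?thesis using 0[of i] by (simp add: defect_def mult.commute)
qed

text \<open>Since \<open>(t^k)^{a_1}\<close> is a power of \<open>x_1\<close>, the derivation kills it.\<close>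

lemma defect_power:
  assumes g: "g \<in> P" "E g = fps_X ^ k"
  shows "defect g \<in> N"
proof -
  define pw where "pw j = ((mps_mult g) ^^ j) (\<lambda>e. if e = 0 then 1 else 0)" for j
  have pw: "pw j \<in> P \<and> E (pw j) = (E g) ^ j \<and> (\<forall>i\<in>{1..n}. defect (pw j) i = of_nat j * (E g) ^ (j - 1) * defect g i)" for j
  proof (induction j)
    case 0
    have "defect (\<lambda>e. if e = 0 then 1 else 0) i = 0" if "i \<in> {1..n}" for i
      by (rule defect_univariate) (use that in \<open>auto split: if_splits\<close>)
    then show ?case by (auto simp: pw_def ev_one mps_simps)
  next
    case (Suc j)
    have S: "pw (Suc j) = mps_mult g (pw j)" by (simp add: pw_def)
    have "defect (pw (Suc j)) i = of_nat (Suc j) * E g ^ j * defect g i" if "i \<in> {1..n}" for i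
    proof -
      have "defect (pw j) i = of_nat j * E g ^ (j - 1) * defect g i" "E (pw j) = E g ^ j"
        using Suc that by auto
      then show ?thesis unfolding S defect_mult by (cases j) (simp_all add: algebra_simps)
    qed
    moreover have "pw (Suc j) \<in> P" using Suc g(1) unfolding S by (intro mps_mult_closed) auto
    moreover have "E (pw (Suc j)) = E g ^ Suc j" using Suc unfolding S ev_mult by simp
    ultimately show ?case by simp
  qed
  \<comment> \<open>X_1^k lifts the same element t^(ord1 k) as the power g^ord1, and its defect is
    0.\<close>
  define h :: "(nat \<Rightarrow>\<^sub>0 nat) \<Rightarrow> 'a" where "h = (\<lambda>e. if e = Poly_Mapping.single 1 k then (1::'a) else 0)"
  have hP: "h \<in> P" using n_pos by (auto simp: h_def mps_simps monomials_single)
  have "E h = fps_X ^ (ord1 * k)"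
    unfolding h_def using n_pos
    by (subst ev_monom) (auto simp: monomials_single mono_val_single \<xi>_1[unfolded One_nat_def] power_mult)
  also have "\<dots> = E (pw ord1)" using pw[of ord1] g(2) by (simp only: power_mult[symmetric] mult.commute)
  finally have Eh: "E h = E (pw ord1)" .
  have "defect h \<in> N"
    by (rule N_cong[OF N_zero], rule sym, rule defect_univariate) (auto simp: h_def split: if_splits)
  from defect_cong[OF hP _ Eh this] have "defect (pw ord1) \<in> N" using pw[of ord1] by blast
  \<comment> \<open>The power rule for \<open>defect\<close> makes this a multiple of
    \<open>defect g\<close>; the multiplier is nonzero in characteristic 0, so saturation removes
    it.\<close>
  then have "(\<lambda>i. (of_nat ord1 * E g ^ (ord1 - 1)) * defect g i) \<in> N"
    by (rule N_cong) (use pw[of ord1] in auto)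
  then show ?thesis
  proof (rule torsion_free[rotated -1])
    show "of_nat ord1 * E g ^ (ord1 - 1) \<in> R"
      unfolding fps_of_nat[symmetric] by (intro R_mult R_const R_power E_in_R g)
    show "of_nat ord1 * E g ^ (ord1 - 1) \<noteq> 0"
      using ord1_pos g by simp
  qed (rule defect_in_R)
qed

text \<open>An element of t^cond k[[t]] is a finite sum of products of some t^(cond+j), whose defect
  lies in \<open>N\<close>, with a series in x_1, whose defect is 0. Applying the product rule to
  each term takes the place of continuity.\<close>

lemma defect_conductor:
  assumes h: "h \<in> P" "E h = fps_X ^ cond * g"
  shows "defect h \<in> N"
proof -
  define u where "u j = (\<lambda>e. if Poly_Mapping.keys e \<subseteq> {1::nat} then fps_nth g (j + ord1 * Poly_Mapping.lookup e 1) else 0)" for j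
  have Eu: "E (u j) = Abs_fps (\<lambda>k. if ord1 dvd k then fps_nth g (j + k) else 0)" for j
    unfolding u_def using ev_univariate[OF n_pos ord1_pos \<xi>_1, of "\<lambda>l. fps_nth g (j + ord1 * l)"]
    by (simp add: dvd_mult_div_cancel cong: if_cong)
  have uP: "u j \<in> P" for j using n_pos by (auto simp: u_def mps_simps monomials_def)
  have du: "defect (u j) i = 0" if "i \<in> {1..n}" for i j
    by (rule defect_univariate) (use that in \<open>auto simp: u_def split: if_splits\<close>)
  have "\<exists>p\<in>P. E p = fps_X ^ (cond + j)" for j
    using R_cond[of "cond + j" 1] by (auto elim: R_obtain)
  then obtain p where p: "\<And>j. p j \<in> P" "\<And>j. E (p j) = fps_X ^ (cond + j)" by metis
  define H where "H = (\<lambda>e. \<Sum>j<ord1. mps_mult (p j) (u j) e)"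
  have HP: "H \<in> P" unfolding H_def by (intro P_sum mps_mult_closed p uP)
  have "E H = fps_X ^ cond * (\<Sum>j<ord1. fps_X ^ j * Abs_fps (\<lambda>k. if ord1 dvd k then fps_nth g (j + k) else 0))"
    unfolding H_def ev_sum ev_mult p Eu by (simp add: power_add sum_distrib_left mult.assoc)
  then have EH: "E H = E h" unfolding h fps_split_residues[OF ord1_pos, of g, symmetric] .
  have "defect H i = (\<Sum>j<ord1. defect (mps_mult (p j) (u j)) i)" for i
    unfolding H_def by (induction ord1) (simp_all add: defect_add, simp add: defect_def mps_deriv_def ev_zero)
  then have "defect H i = (\<Sum>j<ord1. E (u j) * defect (p j) i)" if "i \<in> {1..n}" for i
    using du[OF that] by (simp add: defect_mult)
  moreover have "(\<lambda>i. \<Sum>j<ord1. E (u j) * defect (p j) i) \<in> N"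
    by (intro N_sum N_scale defect_power[OF p] E_in_R uP)
  ultimately have "defect H \<in> N" by (metis (lifting) N_cong)
  then show ?thesis using defect_cong[OF HP h(1) EH] by simp
qed

text \<open>Multiplication by t^cond moves every element into t^cond k[[t]]. As t^cond and the
  product both have defect in \<open>N\<close>, the product rule leaves t^cond times the defect of h
  in \<open>N\<close>, and saturation divides by t^cond.\<close>

lemma defect_zero:
  assumes h: "h \<in> P" shows "defect h \<in> N"
proof -
  obtain g where g: "g \<in> P" "E g = fps_X ^ cond * 1" using cond[of 1] by (auto elim: R_obtain)
  have "defect (mps_mult g h) \<in> N"
    by (rule defect_conductor[of _ "E h"]) (use g h in \<open>auto simp: ev_mult intro: mps_mult_closed\<close>)
  from N_diff[OF this N_scale[OF defect_conductor[OF g] E_in_R[OF h]]]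
  have "(\<lambda>i. fps_X ^ cond * defect h i) \<in> N"
    by (rule N_cong) (simp add: defect_mult g)
  then show ?thesis
    by (rule torsion_free[rotated -1]) (use cond[of 1] defect_in_R in auto)
qed

text \<open>Lift the coefficients c_j to series d_j and take \<Sum> d_j f_j: the terms that
  differentiate d_j vanish because f_j evaluates to 0.\<close>

lemma N_gradient:
  assumes "v \<in> N"
  shows "\<exists>g\<in>P. E g = 0 \<and> (\<forall>i\<in>{1..n}. v i = E (mps_deriv i g))"
proof -
  from assms obtain c where c: "\<forall>j\<in>{1..m}. c j \<in> R"
    "\<forall>i\<in>{1..n}. v i = (\<Sum>j\<in>{1..m}. E (mps_deriv i (f j)) * c j)"
    unfolding N_def by blast
  from c(1) have "\<forall>j\<in>{1..m}. \<exists>g\<in>P. E g = c j" by (auto elim: R_obtain)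
  then obtain d where d: "\<And>j. j \<in> {1..m} \<Longrightarrow> d j \<in> P" "\<And>j. j \<in> {1..m} \<Longrightarrow> E (d j) = c j"
    by metis
  show ?thesis
  proof (intro bexI conjI ballI)
    show "(\<lambda>e. \<Sum>j\<in>{1..m}. mps_mult (d j) (f j) e) \<in> P"
      by (intro P_sum mps_mult_closed d f_carrier)
    show "E (\<lambda>e. \<Sum>j\<in>{1..m}. mps_mult (d j) (f j) e) = 0"
      unfolding ev_sum ev_mult by (rule sum.neutral) (use f_ker in auto)
    show "v i = E (mps_deriv i (\<lambda>e. \<Sum>j\<in>{1..m}. mps_mult (d j) (f j) e))" if "i \<in> {1..n}" for i
      unfolding mps_deriv_sum ev_sum mps_deriv_mult ev_add ev_mult c(2)[rule_format, OF that]
      by (rule sum.cong) (use f_ker d in \<open>auto simp: mult.commute\<close>)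
  qed
qed

lemma deriv_\<xi>_1: "fps_deriv (\<xi> 1) = fps_const (of_nat ord1) * fps_X ^ (ord1 - 1)"
  unfolding \<xi>_1 by (simp add: fps_deriv_power)

text \<open>The defects of the X_k, combined with weights v_k, lie in \<open>N\<close>. The i-th
  entry is t^cond x_1' v_i, from which for i = 1 a multiple of the given relation, that is 0, is
  subtracted. So a nonzero multiple of v lies in \<open>N\<close>.\<close>

lemma relation_gradient:
  assumes v: "\<And>i. i \<in> {1..n} \<Longrightarrow> v i \<in> R" and rel: "(\<Sum>i\<in>{1..n}. v i * fps_deriv (\<xi> i)) = 0"
  shows "\<exists>g\<in>P. E g = 0 \<and> (\<forall>i\<in>{1..n}. v i = E (mps_deriv i g))"
proof -
  have var: "mps_deriv i (mps_var j) = (\<lambda>e. if i = j \<and> e = 0 then 1 else (0::'a))" for i j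
    by (auto simp: mps_deriv_def mps_var_def fun_eq_iff poly_mapping_eq_iff lookup_add lookup_single when_def
      split: if_splits)
  have Evar: "E (mps_deriv i (mps_var j)) = (if i = j then 1 else 0)" for i j
    unfolding var by (cases "i = j") (simp_all add: ev_one ev_zero)
  let ?\<rho> = "fps_X ^ cond * fps_deriv (\<xi> 1)"
  have "(\<lambda>i. \<Sum>k\<in>{1..n}. v k * defect (mps_var k) i) \<in> N"
    by (intro N_sum N_scale defect_zero v mps_var_closed)
  then have "(\<lambda>i. ?\<rho> * v i) \<in> N"
  proof (rule N_cong)
    fix i assume i: "i \<in> {1..n}"
    have "(\<Sum>k\<in>{1..n}. v k * defect (mps_var k) i)
        = (\<Sum>k\<in>{1..n}. if i = k then ?\<rho> * v k else 0)
          - (if i = 1 then fps_X ^ cond * (\<Sum>k\<in>{1..n}. v k * fps_deriv (\<xi> k)) else 0)"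
    proof (cases "i = 1")
      case True
      have "v k * defect (mps_var k) i = (if i = k then ?\<rho> * v k else 0)
          - fps_X ^ cond * (v k * fps_deriv (\<xi> k))" if "k \<in> {1..n}" for k
        unfolding defect_def Evar ev_var[OF that] using True by (simp add: algebra_simps)
      then show ?thesis using True by (simp add: sum_subtractf sum_distrib_left)
    next
      case False
      then have "v k * defect (mps_var k) i = (if i = k then ?\<rho> * v k else 0)" for k
        unfolding defect_def Evar by simp
      then show ?thesis using False by simp
    qed
    then show "(\<Sum>k\<in>{1..n}. v k * defect (mps_var k) i) = ?\<rho> * v i" using i rel by simp
  qed
  then have "v \<in> N"
  proof (rule torsion_free[rotated -1])
    show "?\<rho> \<noteq> 0" unfolding deriv_\<xi>_1 using ord1_pos by simp
  qed (use cond v in auto)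
  then show ?thesis by (rule N_gradient)
qed

end

section \<open>The bound on the type\<close>

text \<open>Adjoin the vectors one at a time. Each lies outside the space built so far, or it would
  be a combination of earlier ones modulo \<open>V\<close>; so each contributes a new order below
  M.\<close>

lemma val_count_independent:
  assumes V: "fps_subspace V" and W: "fps_subspace W" and sub: "V \<subseteq> W"
    and tail: "\<And>f. (\<And>j. j < M \<Longrightarrow> fps_nth f j = 0) \<Longrightarrow> f \<in> V"
    and A: "finite A" and w: "\<And>p. p \<in> A \<Longrightarrow> w p \<in> W"
    and indep: "\<And>l p. (\<Sum>p\<in>A. fps_const (l p) * w p) \<in> V \<Longrightarrow> p \<in> A \<Longrightarrow> l p = 0"
  shows "card A + val_count M V \<le> val_count M W"
proof -
  have "\<exists>Z. fps_subspace Z \<and> V \<subseteq> Z \<and> Z \<subseteq> W \<and> card B + val_count M V \<le> val_count M Z \<and>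
      (\<forall>f\<in>Z. \<exists>l. f - (\<Sum>p\<in>B. fps_const (l p) * w p) \<in> V)" if "finite B" "B \<subseteq> A" for B
    using that
  proof (induction B rule: finite_induct)
    case empty
    then show ?case using V sub by (intro exI[of _ V]) auto
  next
    case (insert q B)
    then obtain Z where Z: "fps_subspace Z" "V \<subseteq> Z" "Z \<subseteq> W" "card B + val_count M V \<le> val_count M Z"
      and rep: "\<And>f. f \<in> Z \<Longrightarrow> \<exists>l. f - (\<Sum>p\<in>B. fps_const (l p) * w p) \<in> V" by blast
    define Y' where "Y' = fps_plus Z (fps_line (w q))"
    have Y': "fps_subspace Y'" "Z \<subseteq> Y'"
      unfolding Y'_def using Z(1) fps_subspace_line fps_subspace_plus fps_plus_upper(1) by blast+
    have "w q \<in> fps_line (w q)" unfolding fps_line_def by (rule image_eqI[of _ _ 1]) auto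
    then have wq: "w q \<in> Y'"
      unfolding Y'_def using fps_plus_upper(2)[OF Z(1) fps_subspace_line] by blast
    have sumB: "(\<Sum>p\<in>insert q B. fps_const ((l(q := k)) p) * w p)
        = fps_const k * w q + (\<Sum>p\<in>B. fps_const (l p) * w p)" for l k
    proof -
      have "(\<Sum>p\<in>B. fps_const ((l(q := k)) p) * w p) = (\<Sum>p\<in>B. fps_const (l p) * w p)"
        by (rule sum.cong) (use insert.hyps in auto)
      then show ?thesis using insert.hyps by simp
    qed
    have "w q \<notin> Z"
    proof
      assume "w q \<in> Z"
      from rep[OF this] obtain l where l: "w q - (\<Sum>p\<in>B. fps_const (l p) * w p) \<in> V" by blast
      \<comment> \<open>Coefficient -1 at q and 0 outside the vectors used so far: a relation over
        all of A that contradicts \<open>indep\<close>.\<close>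
      define l' where "l' p = (if p \<in> insert q B then (l(q := - 1)) p else 0)" for p
      have "(\<Sum>p\<in>A. fps_const (l' p) * w p) = (\<Sum>p\<in>insert q B. fps_const (l' p) * w p)"
        by (rule sum.mono_neutral_right) (use A insert.prems in \<open>auto simp: l'_def\<close>)
      also have "\<dots> = (\<Sum>p\<in>insert q B. fps_const ((l(q := - 1)) p) * w p)"
        by (rule sum.cong) (auto simp: l'_def)
      also have "\<dots> = - (w q - (\<Sum>p\<in>B. fps_const (l p) * w p))"
        unfolding sumB by (simp flip: fps_const_neg)
      also have "\<dots> \<in> V" using l by (rule fps_subspaceD(5)[OF V])
      finally have "l' q = 0" by (rule indep) (use insert.prems in auto)
      then show False by (simp add: l'_def)
    qed
    from val_count_strict[OF Z(1) Y' _ wq this, of M] tail Z(2)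
    have "val_count M Z < val_count M Y'" by blast
    then have "card (insert q B) + val_count M V \<le> val_count M Y'"
      using Z(4) insert.hyps by simp
    moreover have "Y' \<subseteq> W"
    proof
      fix f assume "f \<in> Y'"
      then obtain a k where "f = a + fps_const k * w q" "a \<in> Z"
        by (auto simp: Y'_def fps_plus_def fps_line_def)
      moreover have "w q \<in> W" using w insert.prems by auto
      ultimately show "f \<in> W" using Z(3) fps_subspaceD(2,3)[OF W] by blast
    qed
    moreover have "\<exists>l. f - (\<Sum>p\<in>insert q B. fps_const (l p) * w p) \<in> V" if "f \<in> Y'" for f
    proof -
      from that obtain a k where a: "f = a + fps_const k * w q" "a \<in> Z"
        by (auto simp: Y'_def fps_plus_def fps_line_def)
      from rep[OF a(2)] obtain l where "a - (\<Sum>p\<in>B. fps_const (l p) * w p) \<in> V" by blast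
      then have "f - (\<Sum>p\<in>insert q B. fps_const ((l(q := k)) p) * w p) \<in> V"
        unfolding sumB a(1) by simp
      then show ?thesis by blast
    qed
    ultimately show ?case using Y' Z(2) by blast
  qed
  from this[OF A] obtain Z where "Z \<subseteq> W" "card A + val_count M V \<le> val_count M Z" by blast
  then show ?thesis using val_count_mono[of Z W M] by simp
qed

lemma fps_subspace_image_mult:
  assumes "fps_subspace V" shows "fps_subspace ((*) w ` V)"
  unfolding fps_subspace_def
proof (intro conjI ballI allI)
  show "0 \<in> (*) w ` V" using fps_subspaceD(1)[OF assms] by (auto intro!: image_eqI[of _ _ 0])
next
  fix f g assume "f \<in> (*) w ` V" "g \<in> (*) w ` V"
  then obtain a b where "f = w * a" "g = w * b" "a \<in> V" "b \<in> V" by auto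
  then show "f + g \<in> (*) w ` V"
    using fps_subspaceD(2)[OF assms] by (auto intro!: image_eqI[of _ _ "a + b"] simp: distrib_left)
next
  fix k f assume "f \<in> (*) w ` V"
  then obtain a where "f = w * a" "a \<in> V" by auto
  then show "fps_const k * f \<in> (*) w ` V"
    using fps_subspaceD(3)[OF assms] by (auto intro!: image_eqI[of _ _ "fps_const k * a"])
qed

definition fps_euler :: "'a::field_char_0 fps \<Rightarrow> 'a fps"
  where "fps_euler g = fps_X * fps_deriv g"

lemma fps_euler_nth: "fps_nth (fps_euler g) k = of_nat k * fps_nth g k"
  by (cases k) (auto simp: fps_euler_def)

lemma fps_euler_add: "fps_euler (g + h) = fps_euler g + fps_euler h"
  by (simp add: fps_euler_def distrib_left)

lemma fps_euler_scale: "fps_euler (fps_const k * g) = fps_const k * fps_euler g"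
  by (simp add: fps_euler_def mult.left_commute)

text \<open>The coefficient of t^k is multiplied by k, which is nonzero for k > 0 in characteristic
  0; so orders are kept on series without constant term.\<close>

lemma val_count_euler:
  assumes "\<And>g. g \<in> V \<Longrightarrow> fps_nth g 0 = 0"
  shows "val_count M (fps_euler ` V) = val_count M V"
proof -
  have eq0: "fps_euler g = 0 \<longleftrightarrow> g = 0" if "g \<in> V" for g
  proof
    assume "fps_euler g = 0"
    then have "of_nat k * fps_nth g k = 0" for k by (metis fps_euler_nth fps_zero_nth)
    then have "fps_nth g k = 0" for k using assms[OF that] by (cases k) auto
    then show "g = 0" by (simp add: fps_ext)
  qed (simp add: fps_euler_def)
  have sd: "subdegree (fps_euler g) = subdegree g" if "g \<in> V" "g \<noteq> 0" for g
  proof (rule subdegreeI)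
    have "subdegree g \<noteq> 0" using that assms by (metis nth_subdegree_nonzero)
    then show "fps_nth (fps_euler g) (subdegree g) \<noteq> 0" using that by (simp add: fps_euler_nth)
  next
    fix i assume "i < subdegree g"
    then have "fps_nth g i = 0" by (rule nth_less_subdegree_zero)
    then show "fps_nth (fps_euler g) i = 0" by (simp add: fps_euler_nth)
  qed
  have "{j. j < M \<and> (\<exists>h\<in>fps_euler ` V. h \<noteq> 0 \<and> subdegree h = j)}
      = {j. j < M \<and> (\<exists>g\<in>V. g \<noteq> 0 \<and> subdegree g = j)}"
    using eq0 sd by auto
  then show ?thesis by (simp add: val_count_def)
qed

lemma card_increasing_pairs:
  "2 * card {(i, j). i \<in> {2..n} \<and> j \<in> {2..n} \<and> i < j} = (n - 1) * (n - 2 :: nat)"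
proof -
  have "{(i, j). i \<in> {2..n} \<and> j \<in> {2..n} \<and> i < j} = prod.swap ` (SIGMA j:{2..n}. {2..<j})"
    by force
  then have "card {(i, j). i \<in> {2..n} \<and> j \<in> {2..n} \<and> i < j} = card (SIGMA j:{2..n}. {2..<j})"
    by (simp add: card_image)
  also have "\<dots> = (\<Sum>j\<in>{2..n}. j - 2)" by simp
  finally have "card {(i, j). i \<in> {2..n} \<and> j \<in> {2..n} \<and> i < j} = (\<Sum>j\<in>{2..n}. j - 2)" .
  moreover have "2 * (\<Sum>j\<in>{2..n}. j - 2) = (n - 1) * (n - 2)"
  proof (induction n)
    case (Suc n)
    show ?case
    proof (cases "2 \<le> Suc n")
      case True
      then obtain k where k: "n = Suc k" by (cases n) auto
      have "{2..Suc n} = insert (Suc n) {2..n}" using True by auto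
      then have "2 * (\<Sum>j\<in>{2..Suc n}. j - 2) = 2 * (Suc n - 2) + 2 * (\<Sum>j\<in>{2..n}. j - 2)" by simp
      also have "\<dots> = 2 * (Suc n - 2) + (n - 1) * (n - 2)" using Suc by simp
      also have "\<dots> = (Suc n - 1) * (Suc n - 2)" unfolding k by (cases k) auto
      finally show ?thesis .
    qed auto
  qed simp
  ultimately show ?thesis by simp
qed

lemma mps_euler: "mps_mult (mps_var j) (mps_deriv j g) e = of_nat (Poly_Mapping.lookup e j) * g e"
proof (cases "Poly_Mapping.lookup e j = 0")
  case False
  have s: "e - Poly_Mapping.single j 1 + Poly_Mapping.single j 1 = e"
    using single_diff_add[OF False] by (simp add: add.commute)
  have "Suc (Poly_Mapping.lookup (e - Poly_Mapping.single j 1) j) = Poly_Mapping.lookup e j"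
    using False by (simp add: lookup_minus lookup_single)
  then show ?thesis using False unfolding mps_var_mult_nth mps_deriv_def s by simp
qed (simp add: mps_var_mult_0)

section \<open>Differentials modulo x_1 and relations of order two\<close>

context torsion_free_branch
begin

text \<open>The image of the differentials in k((t)) dt, written in the basis dt/t. In this basis
  dx_1 becomes \<theta> x_1 = \<open>ord1\<close> x_1, which makes it comparable with x_1
  itself.\<close>

definition tD :: "'a fps set"
  where "tD = {fps_X * (\<Sum>i\<in>{1..n}. v i * fps_deriv (\<xi> i)) | v. \<forall>i\<in>{1..n}. v i \<in> R}"

definition U :: "'a fps set"
  where "U = fps_plus R tD"

definition m\<^sub>R :: "'a fps set"
  where "m\<^sub>R = {y \<in> R. fps_nth y 0 = 0}"

definition W :: "'a fps set"
  where "W = {y \<in> m\<^sub>R. fps_euler y \<in> (*) (\<xi> 1) ` U}"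

lemma tD_subspace: "fps_subspace tD"
  unfolding fps_subspace_def
proof (intro conjI ballI allI)
  show "0 \<in> tD"
    unfolding tD_def by (intro CollectI exI[of _ "\<lambda>_. 0"]) (simp add: R_01)
next
  fix g h assume "g \<in> tD" "h \<in> tD"
  then obtain v w where "\<forall>i\<in>{1..n}. v i \<in> R" "\<forall>i\<in>{1..n}. w i \<in> R"
    "g = fps_X * (\<Sum>i\<in>{1..n}. v i * fps_deriv (\<xi> i))" "h = fps_X * (\<Sum>i\<in>{1..n}. w i * fps_deriv (\<xi> i))"
    unfolding tD_def by blast
  then show "g + h \<in> tD"
    unfolding tD_def by (intro CollectI exI[of _ "\<lambda>i. v i + w i"])
      (simp add: R_add distrib_left distrib_right sum.distrib)
next
  fix k g assume "g \<in> tD"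
  then obtain v where "\<forall>i\<in>{1..n}. v i \<in> R" "g = fps_X * (\<Sum>i\<in>{1..n}. v i * fps_deriv (\<xi> i))"
    unfolding tD_def by blast
  then show "fps_const k * g \<in> tD"
    unfolding tD_def by (intro CollectI exI[of _ "\<lambda>i. fps_const k * v i"])
      (simp add: R_mult R_const sum_distrib_left mult_ac)
qed

lemma U_subspace: "fps_subspace U"
  unfolding U_def by (intro fps_subspace_plus R_subspace tD_subspace)

lemma euler_in_tD:
  assumes "g \<in> P" shows "fps_euler (E g) \<in> tD"
  unfolding tD_def fps_euler_def ev_chain_rule
  by (intro CollectI exI[of _ "\<lambda>i. E (mps_deriv i g)"]) (simp add: E_in_R mps_deriv_closed assms)

text \<open>As \<theta> x_1 is \<open>ord1\<close> times x_1, the part x_1 R of x_1 \<open>U\<close>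
  consists of multiples of dx_1, and the part x_1 \<open>tD\<close> has coefficients divisible by
  x_1. Moving both to the left leaves a genuine relation for \<open>relation_gradient\<close>; the
  correction at dx_1 is invisible for j \<ge> 2.\<close>

lemma relation_mod_x\<^sub>1:
  assumes p: "\<And>j. j \<in> {1..n} \<Longrightarrow> p j \<in> R"
    and mem: "fps_X * (\<Sum>j\<in>{1..n}. p j * fps_deriv (\<xi> j)) \<in> (*) (\<xi> 1) ` U"
  shows "\<exists>V g. (\<forall>j\<in>{1..n}. V j \<in> P) \<and> g \<in> P \<and> E g = 0 \<and>
    (\<forall>j\<in>{2..n}. p j = \<xi> 1 * E (V j) + E (mps_deriv j g))"
proof -
  obtain u v where u: "u \<in> R" and v: "\<forall>j\<in>{1..n}. v j \<in> R"
    and eq: "fps_X * (\<Sum>j\<in>{1..n}. p j * fps_deriv (\<xi> j))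
      = \<xi> 1 * (u + fps_X * (\<Sum>j\<in>{1..n}. v j * fps_deriv (\<xi> j)))"
    using mem unfolding U_def fps_plus_def tD_def by blast
  \<comment> \<open>The inverse of \<open>ord1\<close>, so that x_1 = t k x_1'.\<close>
  define k where "k = fps_const (1 / of_nat ord1 :: 'a)"
  have "k * fps_const (of_nat ord1) = 1" using ord1_pos by (simp add: k_def)
  then have "k * fps_deriv (\<xi> 1) = fps_X ^ (ord1 - 1)"
    unfolding deriv_\<xi>_1 mult.assoc[symmetric] by simp
  moreover have "\<xi> 1 = fps_X * fps_X ^ (ord1 - 1)" using ord1_pos unfolding \<xi>_1 by (cases ord1) simp_all
  ultimately have x1: "\<xi> 1 = fps_X * (k * fps_deriv (\<xi> 1))" by metis
  have "\<xi> 1 * (u + fps_X * (\<Sum>j\<in>{1..n}. v j * fps_deriv (\<xi> j)))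
      = \<xi> 1 * u + fps_X * (\<xi> 1 * (\<Sum>j\<in>{1..n}. v j * fps_deriv (\<xi> j)))"
    by (simp only: distrib_left mult.left_commute)
  also have "\<xi> 1 * u = fps_X * (k * u * fps_deriv (\<xi> 1))"
    by (subst x1) (simp only: mult_ac)
  finally have "fps_X * (\<Sum>j\<in>{1..n}. p j * fps_deriv (\<xi> j))
      = fps_X * (k * u * fps_deriv (\<xi> 1) + \<xi> 1 * (\<Sum>j\<in>{1..n}. v j * fps_deriv (\<xi> j)))"
    unfolding eq by (simp only: distrib_left)
  then have eq': "(\<Sum>j\<in>{1..n}. p j * fps_deriv (\<xi> j))
      = k * u * fps_deriv (\<xi> 1) + \<xi> 1 * (\<Sum>j\<in>{1..n}. v j * fps_deriv (\<xi> j))"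
    by simp
  define w where "w j = p j - \<xi> 1 * v j - (if j = 1 then k * u else 0)" for j
  have "(\<Sum>j\<in>{1..n}. w j * fps_deriv (\<xi> j))
      = (\<Sum>j\<in>{1..n}. p j * fps_deriv (\<xi> j)) - \<xi> 1 * (\<Sum>j\<in>{1..n}. v j * fps_deriv (\<xi> j))
        - (\<Sum>j\<in>{1..n}. if j = 1 then k * u * fps_deriv (\<xi> 1) else 0)"
    unfolding sum_distrib_left sum_subtractf[symmetric]
    by (rule sum.cong) (auto simp: w_def algebra_simps)
  also have "(\<Sum>j\<in>{1..n}. if j = 1 then k * u * fps_deriv (\<xi> 1) else 0) = k * u * fps_deriv (\<xi> 1)"
    using n_pos by simp
  finally have rel: "(\<Sum>j\<in>{1..n}. w j * fps_deriv (\<xi> j)) = 0" using eq' by simp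
  have wR: "w j \<in> R" if "j \<in> {1..n}" for j
    using p[OF that] v that u R_\<xi>[of 1] n_pos unfolding w_def k_def
    by (auto intro!: R_diff R_mult R_const R_01)
  obtain g where g: "g \<in> P" "E g = 0" "\<And>j. j \<in> {1..n} \<Longrightarrow> w j = E (mps_deriv j g)"
    using relation_gradient[OF wR rel] by blast
  have "\<forall>j\<in>{1..n}. \<exists>h\<in>P. E h = v j" using v by (auto elim: R_obtain)
  then obtain V where V: "\<And>j. j \<in> {1..n} \<Longrightarrow> V j \<in> P" "\<And>j. j \<in> {1..n} \<Longrightarrow> E (V j) = v j" by metis
  have "p j = \<xi> 1 * E (V j) + E (mps_deriv j g)" if "j \<in> {2..n}" for j
    using g(3)[of j] V(2)[of j] that by (auto simp: w_def algebra_simps)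
  then show ?thesis using g V by blast
qed

text \<open>Euler's formula, applied to the lowest form of a lift, pushes the order of the lift up to 4.\<close>

lemma W_order:
  assumes y: "y \<in> W"
  shows "\<exists>A\<in>R. \<exists>G\<in>P. order_ge 4 G \<and> y = \<xi> 1 * A + E G"
proof -
  from y have yR: "y \<in> R" and y0: "fps_nth y 0 = 0" and mem: "fps_euler y \<in> (*) (\<xi> 1) ` U"
    by (auto simp: W_def m\<^sub>R_def)
  obtain F where F: "F \<in> P" "E F = y" using yR by (rule R_obtain)
  have "fps_X * (\<Sum>j\<in>{1..n}. E (mps_deriv j F) * fps_deriv (\<xi> j)) \<in> (*) (\<xi> 1) ` U"
    using mem unfolding fps_euler_def F(2)[symmetric] ev_chain_rule .
  from relation_mod_x\<^sub>1[OF E_in_R[OF mps_deriv_closed[OF _ F(1)]] this]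
  obtain V g where V: "\<And>j. j \<in> {1..n} \<Longrightarrow> V j \<in> P" and g: "g \<in> P" "E g = 0"
    and rel: "\<And>j. j \<in> {2..n} \<Longrightarrow> E (mps_deriv j F) = \<xi> 1 * E (V j) + E (mps_deriv j g)" by blast
  \<comment> \<open>Subtracting the relation g keeps the value of the lift and makes its partial
    derivatives for j \<ge> 2 evaluate into x_1 R.\<close>
  define K where "K = (\<lambda>e. F e - g e)"
  have KP: "K \<in> P" and EK: "E K = y" unfolding K_def by (auto intro: P_diff F g simp: ev_diff F g)
  have EKj: "E (mps_deriv j K) = \<xi> 1 * E (V j)" if "j \<in> {2..n}" for j
    unfolding K_def mps_deriv_diff ev_diff using rel[OF that] by simp
  have one: "1 \<in> {1..n}" using n_pos by simp
  \<comment> \<open>The difference evaluates to 0, so it is a relation and has neither constant nor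
    linear terms.\<close>
  have H: "order_ge 2 (\<lambda>e. mps_deriv j K e - mps_mult (mps_var 1) (V j) e)" if j: "j \<in> {2..n}" for j
  proof (rule ker_order)
    show "(\<lambda>e. mps_deriv j K e - mps_mult (mps_var 1) (V j) e) \<in> P"
      by (intro P_diff mps_deriv_closed mps_mult_closed mps_var_closed KP V) (use j one in auto)
    show "E (\<lambda>e. mps_deriv j K e - mps_mult (mps_var 1) (V j) e) = 0"
      unfolding ev_diff ev_mult EKj[OF j] ev_var[OF one] by simp
  qed
  \<comment> \<open>The constant term vanishes since y lies in m. A monomial of degree 1 or 2
    without X_1 contains some X_j with j \<ge> 2; after differentiation by X_j it has degree at most
    1, where by \<open>H\<close> only multiples of X_1 occur.\<close>
  have K_low: "K e = 0" if e: "e \<in> monomials n" "Poly_Mapping.lookup e 1 = 0" "total_degree e \<le> 2" for e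
  proof (cases "e = 0")
    case True
    have "K 0 = fps_nth (E K) 0" by (rule ev_nth_0[symmetric])
    then show ?thesis using True y0 EK by simp
  next
    case False
    then obtain j where j: "Poly_Mapping.lookup e j \<noteq> 0"
      by (metis poly_mapping_eqI lookup_zero)
    then have "j \<in> Poly_Mapping.keys e" by (simp add: in_keys_iff)
    then have "j \<in> {1..n}" using e(1) by (auto simp: monomials_def)
    moreover have "j \<noteq> 1" using j e(2) by auto
    ultimately have j2: "j \<in> {2..n}" by auto
    define d where "d = e - Poly_Mapping.single j 1"
    have ed: "e = d + Poly_Mapping.single j 1"
      using single_diff_add[OF j] by (simp add: d_def add.commute)
    have "total_degree d < 2" using e(3) unfolding ed total_degree_add by simp
    then have "mps_deriv j K d = mps_mult (mps_var 1) (V j) d"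
      using H[OF j2] unfolding order_ge_def by auto
    also have "\<dots> = 0" by (rule mps_var_mult_0) (use e(2) in \<open>simp add: d_def lookup_minus\<close>)
    finally show ?thesis
      unfolding mps_deriv_def ed[symmetric] by (metis mult_eq_0_iff of_nat_eq_0_iff nat.distinct(1))
  qed
  \<comment> \<open>On monomials of degree d without X_1 the Euler sum over j \<ge> 2 multiplies by
    d, so the factor 1/3 removes the cubic ones. The value changes only by a multiple of
    x_1.\<close>
  define F' where "F' = (\<lambda>e. K e - (1 / 3) * (\<Sum>j\<in>{2..n}. mps_mult (mps_var j) (mps_deriv j K) e))"
  have F'P: "F' \<in> P"
    unfolding F'_def by (intro P_diff P_scale P_sum mps_mult_closed mps_var_closed mps_deriv_closed KP) auto
  define B where "B = fps_const (1 / 3) * (\<Sum>j\<in>{2..n}. \<xi> j * E (V j))"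
  have B: "B \<in> R" unfolding B_def by (intro R_mult R_const R_sum R_\<xi> E_in_R V) auto
  have "E F' = y - fps_const (1 / 3) * (\<Sum>j\<in>{2..n}. \<xi> j * (\<xi> 1 * E (V j)))"
    unfolding F'_def ev_diff ev_scale ev_sum ev_mult EK
    by (intro arg_cong2[where f = minus] arg_cong2[where f = times] sum.cong refl) (auto simp: ev_var EKj)
  also have "\<dots> = y - \<xi> 1 * B"
    unfolding B_def sum_distrib_left by (simp add: mult_ac)
  finally have EF': "E F' = y - \<xi> 1 * B" .
  have F'_low: "F' e = 0" if e: "e \<in> monomials n" "Poly_Mapping.lookup e 1 = 0" "total_degree e < 4" for e
  proof -
    have "total_degree e = (\<Sum>j\<in>{1..n}. Poly_Mapping.lookup e j)"
      using e(1) by (intro total_degree_superset) (auto simp: monomials_def)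
    also have "\<dots> = (\<Sum>j\<in>{2..n}. Poly_Mapping.lookup e j)"
      by (rule sum.mono_neutral_right) (use e(2) in \<open>auto simp: numeral_2_eq_2 not_less_eq_eq le_Suc_eq\<close>)
    finally have td: "of_nat (total_degree e) = (\<Sum>j\<in>{2..n}. of_nat (Poly_Mapping.lookup e j) :: 'a)"
      by simp
    have "F' e = K e - (1 / 3) * (of_nat (total_degree e) * K e)"
      unfolding F'_def mps_euler td sum_distrib_right ..
    moreover have "total_degree e = 3 \<or> K e = 0" using K_low[OF e(1,2)] e(3) by linarith
    ultimately show ?thesis by auto
  qed
  \<comment> \<open>X_1 * A collects the monomials divisible by X_1 and G the others, so
    \<open>F'_low\<close> gives G order 4.\<close>
  define A where "A = (\<lambda>e. F' (e + Poly_Mapping.single 1 1))"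
  define G where "G = (\<lambda>e. if Poly_Mapping.lookup e 1 = 0 then F' e else 0)"
  have AP: "A \<in> P" using F'P by (auto simp: A_def mps_simps monomials_add)
  have GP: "G \<in> P" using F'P by (auto simp: G_def mps_simps)
  have "order_ge 4 G"
    unfolding order_ge_def
  proof (intro allI impI)
    fix e assume "total_degree e < 4"
    then show "G e = 0"
      using F'_low[of e] F'P by (cases "e \<in> monomials n") (auto simp: G_def mps_simps)
  qed
  moreover have "F' = (\<lambda>e. mps_mult (mps_var 1) A e + G e)"
  proof
    fix e
    show "F' e = mps_mult (mps_var 1) A e + G e"
    proof (cases "Poly_Mapping.lookup e 1 = 0")
      case False
      then show ?thesis
        using single_diff_add[OF False] by (simp add: mps_var_mult_nth A_def G_def add.commute)
    qed (simp add: mps_var_mult_0 G_def)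
  qed
  then have "E F' = \<xi> 1 * E A + E G" using one by (simp add: ev_add ev_mult ev_var)
  then have "y = \<xi> 1 * (E A + B) + E G" using EF' by (simp add: algebra_simps)
  ultimately show ?thesis using AP GP B by (blast intro: R_add E_in_R)
qed

text \<open>A relation among the \<open>x\<^sub>i dx\<^sub>j\<close> with \<open>i < j\<close> would make a strictly triangular matrix the Hessian
  of a power series at 0.\<close>

lemma x_dx_independent:
  defines "I \<equiv> {(i, j). i \<in> {2..n} \<and> j \<in> {2..n} \<and> i < j}"
  assumes mem: "(\<Sum>p\<in>I. fps_const (l p) * (\<xi> (fst p) * fps_euler (\<xi> (snd p))))
      \<in> fps_plus ((*) (\<xi> 1) ` U) (fps_euler ` m\<^sub>R)"
    and p: "p \<in> I"
  shows "l p = 0"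
proof -
  \<comment> \<open>The coefficients, extended by 0 to a strictly upper triangular matrix.\<close>
  define L where "L i j = (if (i, j) \<in> I then l (i, j) else 0)" for i j
  let ?s = "\<lambda>i. Poly_Mapping.single i (1::nat)"
  obtain u y where u: "u \<in> U" and y: "y \<in> m\<^sub>R"
    and eq: "(\<Sum>p\<in>I. fps_const (l p) * (\<xi> (fst p) * fps_euler (\<xi> (snd p)))) = \<xi> 1 * u + fps_euler y"
    using mem unfolding fps_plus_def by blast
  obtain G where G: "G \<in> P" "E G = y" using y by (auto simp: m\<^sub>R_def elim: R_obtain)
  \<comment> \<open>The coefficient of dx_j after \<theta> y has been moved to the left; the sum of
    the q_j \<theta> x_j then lies in x_1 \<open>U\<close>.\<close>
  define q where "q j = (\<Sum>i\<in>{1..n}. fps_const (L i j) * \<xi> i) - E (mps_deriv j G)" for j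
  have qR: "q j \<in> R" if "j \<in> {1..n}" for j
    unfolding q_def by (intro R_diff R_sum R_mult R_const R_\<xi> E_in_R mps_deriv_closed G that)
  have "(\<Sum>p\<in>I. fps_const (l p) * (\<xi> (fst p) * fps_euler (\<xi> (snd p))))
      = (\<Sum>p\<in>I. fps_const (L (fst p) (snd p)) * (\<xi> (fst p) * fps_euler (\<xi> (snd p))))"
    by (rule sum.cong) (auto simp: L_def)
  also have "\<dots> = (\<Sum>p\<in>{1..n} \<times> {1..n}. fps_const (L (fst p) (snd p)) * (\<xi> (fst p) * fps_euler (\<xi> (snd p))))"
    by (rule sum.mono_neutral_left) (auto simp: I_def L_def)
  also have "\<dots> = (\<Sum>i\<in>{1..n}. \<Sum>j\<in>{1..n}. fps_const (L i j) * (\<xi> i * fps_euler (\<xi> j)))"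
    by (simp add: sum.cartesian_product case_prod_unfold)
  also have "\<dots> = (\<Sum>j\<in>{1..n}. \<Sum>i\<in>{1..n}. fps_const (L i j) * (\<xi> i * fps_euler (\<xi> j)))"
    by (rule sum.swap)
  also have "\<dots> = fps_X * (\<Sum>j\<in>{1..n}. (\<Sum>i\<in>{1..n}. fps_const (L i j) * \<xi> i) * fps_deriv (\<xi> j))"
    unfolding fps_euler_def sum_distrib_left sum_distrib_right by (simp only: mult_ac)
  finally have "fps_X * (\<Sum>j\<in>{1..n}. (\<Sum>i\<in>{1..n}. fps_const (L i j) * \<xi> i) * fps_deriv (\<xi> j))
      = \<xi> 1 * u + fps_X * (\<Sum>j\<in>{1..n}. E (mps_deriv j G) * fps_deriv (\<xi> j))"
    using eq unfolding fps_euler_def G(2)[symmetric] ev_chain_rule by simp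
  then have "fps_X * (\<Sum>j\<in>{1..n}. q j * fps_deriv (\<xi> j)) = \<xi> 1 * u"
    unfolding q_def left_diff_distrib sum_subtractf right_diff_distrib by simp
  then have "fps_X * (\<Sum>j\<in>{1..n}. q j * fps_deriv (\<xi> j)) \<in> (*) (\<xi> 1) ` U"
    using imageI[OF u, of "(*) (\<xi> 1)"] by (simp only:)
  from relation_mod_x\<^sub>1[OF qR this]
  obtain V g where V: "\<And>j. j \<in> {1..n} \<Longrightarrow> V j \<in> P" and g: "g \<in> P" "E g = 0"
    and rel: "\<And>j. j \<in> {2..n} \<Longrightarrow> q j = \<xi> 1 * E (V j) + E (mps_deriv j g)" by blast
  define K where "K = (\<lambda>e. G e + g e)"
  have KP: "K \<in> P" unfolding K_def by (intro P_add G g)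
  have one: "1 \<in> {1..n}" using n_pos by simp
  \<comment> \<open>Compare coefficients of X_i: a relation has no linear term, and X_1 * V_j
    contributes nothing for i \<ge> 2. So this block of L is the Hessian of K at 0, which is
    symmetric.\<close>
  have hess: "L i j = mps_deriv j K (?s i)" if i: "i \<in> {2..n}" and j: "j \<in> {2..n}" for i j
  proof -
    define h where "h = (\<lambda>e. ((\<Sum>i\<in>{1..n}. L i j * mps_var i e) - mps_deriv j K e) - mps_mult (mps_var 1) (V j) e)"
    have "order_ge 2 h"
    proof (rule ker_order)
      show "h \<in> P"
        unfolding h_def by (intro P_diff P_sum P_scale mps_deriv_closed mps_mult_closed mps_var_closed KP V)
          (use j one in auto)
      have "E h = ((\<Sum>i\<in>{1..n}. fps_const (L i j) * E (mps_var i)) - E (mps_deriv j K)) - \<xi> 1 * E (V j)"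
        unfolding h_def ev_diff ev_mult ev_sum ev_scale ev_var[OF one] ..
      also have "(\<Sum>i\<in>{1..n}. fps_const (L i j) * E (mps_var i)) = (\<Sum>i\<in>{1..n}. fps_const (L i j) * \<xi> i)"
        by (rule sum.cong) (auto simp: ev_var)
      also have "E (mps_deriv j K) = E (mps_deriv j G) + E (mps_deriv j g)"
        unfolding K_def mps_deriv_add ev_add ..
      finally have "E h = q j - (\<xi> 1 * E (V j) + E (mps_deriv j g))"
        unfolding q_def by (simp only: algebra_simps)
      then show "E h = 0" using rel[OF j] by simp
    qed
    then have "h (?s i) = 0" by (simp add: order_ge_def)
    moreover have "i = k" if "?s i = ?s k" for k
      using arg_cong[OF that, of Poly_Mapping.keys] by simp
    then have "(\<Sum>k\<in>{1..n}. L k j * mps_var k (?s i)) = (\<Sum>k\<in>{1..n}. if k = i then L i j else 0)"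
      by (intro sum.cong) (auto simp: mps_var_def)
    moreover have "mps_mult (mps_var 1) (V j) (?s i) = 0"
      by (rule mps_var_mult_0) (use i in \<open>auto simp: lookup_single\<close>)
    ultimately show ?thesis using i by (simp add: h_def)
  qed
  obtain i j where ij: "p = (i, j)" "i \<in> {2..n}" "j \<in> {2..n}" "i < j" using p by (auto simp: I_def)
  have "L i j = K (?s i + ?s j)" using hess[OF ij(2,3)] ij(4) by (simp add: mps_deriv_def lookup_single)
  also have "\<dots> = L j i" using hess[OF ij(3,2)] ij(4) by (simp add: mps_deriv_def lookup_single add.commute)
  also have "\<dots> = 0" using ij by (simp add: L_def I_def)
  finally show ?thesis using ij p by (simp add: L_def)
qed

end

lemma fps_low_zero:
  assumes "\<And>j. j < k \<Longrightarrow> fps_nth g j = 0"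
  shows "g = fps_X ^ k * fps_shift k g"
  by (rule fps_ext) (use assms in \<open>auto simp: fps_X_power_mult_nth\<close>)

section \<open>The two estimates for the dimension of \<open>W\<close> over x_1 R\<close>

context torsion_free_branch
begin

lemma low_zero_in_R:
  assumes "\<And>j. j < k \<Longrightarrow> fps_nth g j = 0" "cond \<le> k"
  shows "g \<in> R"
  using R_cond[OF assms(2)] fps_low_zero[OF assms(1)] by metis

lemma tD_mult:
  assumes "u \<in> R" "g \<in> tD" shows "u * g \<in> tD"
proof -
  obtain v where "\<forall>i\<in>{1..n}. v i \<in> R" "g = fps_X * (\<Sum>i\<in>{1..n}. v i * fps_deriv (\<xi> i))"
    using assms(2) unfolding tD_def by blast
  then show ?thesis
    unfolding tD_def by (intro CollectI exI[of _ "\<lambda>i. u * v i"])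
      (simp add: assms(1) R_mult sum_distrib_left mult_ac)
qed

lemma euler_\<xi>_in_tD: "i \<in> {1..n} \<Longrightarrow> fps_euler (\<xi> i) \<in> tD"
  using euler_in_tD[OF mps_var_closed] ev_var by metis

lemma \<xi>_1_in_tD: "\<xi> 1 \<in> tD"
proof -
  have "fps_euler (\<xi> 1) = fps_const (of_nat ord1) * fps_X ^ ord1"
    unfolding fps_euler_def deriv_\<xi>_1 using ord1_pos by (cases ord1) (simp_all add: mult.left_commute)
  then have "\<xi> 1 = fps_const (1 / of_nat ord1) * fps_euler (\<xi> 1)"
    using ord1_pos unfolding \<xi>_1 by (simp flip: mult.assoc)
  moreover have "fps_const (1 / of_nat ord1) * fps_euler (\<xi> 1) \<in> tD"
    using n_pos by (intro tD_mult R_const euler_\<xi>_in_tD) simp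
  ultimately show ?thesis by (simp only:)
qed

lemma x\<^sub>1U_in_tD: "(*) (\<xi> 1) ` U \<subseteq> tD"
proof
  fix g assume "g \<in> (*) (\<xi> 1) ` U"
  then obtain u h where uh: "g = \<xi> 1 * (u + h)" "u \<in> R" "h \<in> tD"
    by (auto simp: U_def fps_plus_def)
  have "u * \<xi> 1 + \<xi> 1 * h \<in> tD"
    using uh n_pos by (intro fps_subspaceD(2)[OF tD_subspace] tD_mult \<xi>_1_in_tD R_\<xi>) auto
  also have "u * \<xi> 1 + \<xi> 1 * h = g" unfolding uh(1) by (simp only: distrib_left mult.commute)
  finally show "g \<in> tD" .
qed

lemma m\<^sub>R_subspace: "fps_subspace m\<^sub>R"
  using R_subspace by (auto simp: fps_subspace_def m\<^sub>R_def)

lemma W_subspace: "fps_subspace W"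
  unfolding fps_subspace_def W_def
  using fps_subspaceD[OF m\<^sub>R_subspace] fps_subspaceD[OF fps_subspace_image_mult[OF U_subspace, of "\<xi> 1"]]
  by (auto simp: fps_euler_add fps_euler_scale fps_euler_def[of 0])

lemma euler_m\<^sub>R_subspace: "fps_subspace (fps_euler ` m\<^sub>R)"
  unfolding fps_subspace_def
proof (intro conjI ballI allI)
  show "0 \<in> fps_euler ` m\<^sub>R"
    using fps_subspaceD(1)[OF m\<^sub>R_subspace] by (rule image_eqI[rotated]) (simp add: fps_euler_def)
qed (use fps_subspaceD(2,3)[OF m\<^sub>R_subspace] in
  \<open>auto simp flip: fps_euler_add fps_euler_scale\<close>)

text \<open>Dividing the coefficient of t^k by k inverts \<theta>, and the quotient keeps its
  vanishing low coefficients, which places it in \<open>R\<close>.\<close>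

lemma low_zero_in_euler_m\<^sub>R:
  assumes g: "\<And>j. j < cond + ord1 \<Longrightarrow> fps_nth g j = 0"
  shows "g \<in> fps_euler ` m\<^sub>R"
proof -
  \<comment> \<open>At k = 0 division by 0 gives 0, the constant term that membership in m asks
    for.\<close>
  define h where "h = Abs_fps (\<lambda>k. fps_nth g k / of_nat k)"
  have "g = fps_euler h"
  proof (rule fps_ext)
    fix k show "fps_nth g k = fps_nth (fps_euler h) k"
      using g[of 0] ord1_pos by (cases "k = 0") (simp_all add: fps_euler_nth h_def)
  qed
  moreover have "h \<in> R" by (rule low_zero_in_R[of "cond + ord1"]) (simp_all add: h_def g)
  ultimately show ?thesis by (auto simp: m\<^sub>R_def h_def)
qed

text \<open>Dividing by x_1 = t^ord1 still leaves order \<open>cond\<close>; this fixes the common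
  cutoff \<open>cond + ord1\<close>.\<close>

lemma low_zero_in_x\<^sub>1R:
  assumes g: "\<And>j. j < cond + ord1 \<Longrightarrow> fps_nth g j = 0"
  shows "g \<in> (*) (\<xi> 1) ` R"
proof (rule image_eqI)
  show "g = \<xi> 1 * (fps_X ^ cond * fps_shift (cond + ord1) g)"
    unfolding \<xi>_1 mult.assoc[symmetric] power_add[symmetric] add.commute[of ord1]
    by (rule fps_low_zero[OF g])
qed (rule cond)

lemma R_subset_U: "R \<subseteq> U"
  unfolding U_def by (rule fps_plus_upper(1)[OF R_subspace tD_subspace])

text \<open>Multiplication by x_1 lowers the counts of \<open>U\<close> and of \<open>R\<close> by
  the same \<open>ord1\<close>. Passing from R to m loses at most 1, passing from \<open>U\<close>
  to \<open>tD\<close> at least 1, and the two cancel in the dimension formula for x_1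
  \<open>U\<close> and \<theta> m, whose intersection is contained in the image of \<open>W\<close>
  under \<theta>.\<close>

lemma pairs_bound:
  "card {(i, j). i \<in> {2..n} \<and> j \<in> {2..n} \<and> i < j} + val_count (cond + ord1) ((*) (\<xi> 1) ` R)
    \<le> val_count (cond + ord1) W"
proof -
  let ?I = "{(i, j). i \<in> {2..n} \<and> j \<in> {2..n} \<and> i < j}"
  let ?M = "cond + ord1"
  let ?A = "(*) (\<xi> 1) ` U" and ?B = "fps_euler ` m\<^sub>R"
  have A: "fps_subspace ?A" by (rule fps_subspace_image_mult[OF U_subspace])
  note B = euler_m\<^sub>R_subspace
  have tail: "g \<in> ?A \<inter> ?B" if "\<And>j. j < ?M \<Longrightarrow> fps_nth g j = 0" for g
    using low_zero_in_euler_m\<^sub>R[OF that] low_zero_in_x\<^sub>1R[OF that] R_subset_U by auto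
  have 1: "val_count ?M ?A + ord1 = val_count ?M U"
    unfolding \<xi>_1 by (rule val_count_shift) (use low_zero_in_R R_subset_U in auto)
  have 2: "val_count ?M ((*) (\<xi> 1) ` R) + ord1 = val_count ?M R"
    unfolding \<xi>_1 by (rule val_count_shift) (use low_zero_in_R in auto)
  have 3: "val_count ?M ?B = val_count ?M m\<^sub>R"
    by (rule val_count_euler) (simp add: m\<^sub>R_def)
  have 4: "val_count ?M R \<le> val_count ?M m\<^sub>R + 1"
  proof (rule val_count_line[OF m\<^sub>R_subspace, of _ 1])
    show "R \<subseteq> fps_plus m\<^sub>R (fps_line 1)"
    proof
      fix g assume "g \<in> R"
      then have "g - fps_const (fps_nth g 0) \<in> m\<^sub>R" by (simp add: m\<^sub>R_def R_diff R_const)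
      moreover have "g = (g - fps_const (fps_nth g 0)) + fps_const (fps_nth g 0) * 1" by simp
      ultimately show "g \<in> fps_plus m\<^sub>R (fps_line 1)"
        unfolding fps_plus_def fps_line_def by blast
    qed
  qed
  have BtD: "?B \<subseteq> tD" using euler_in_tD by (auto simp: m\<^sub>R_def elim!: R_obtain)
  \<comment> \<open>The element 1 separates the two: everything in \<open>tD\<close> is divisible by
    t.\<close>
  have 5: "val_count ?M tD < val_count ?M U"
  proof (rule val_count_strict[OF tD_subspace U_subspace])
    show "tD \<subseteq> U" unfolding U_def by (rule fps_plus_upper(2)[OF R_subspace tD_subspace])
    show "1 \<in> U" using R_subset_U R_01 by auto
    show "1 \<notin> tD"
    proof
      assume "1 \<in> tD"
      then obtain h :: "'a fps" where "1 = fps_X * h" by (auto simp: tD_def)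
      from arg_cong[OF this, of "\<lambda>g. fps_nth g 0"] show False by simp
    qed
  qed (use tail BtD in auto)
  have 6: "val_count ?M ?A + val_count ?M ?B \<le> val_count ?M (fps_plus ?A ?B) + val_count ?M (?A \<inter> ?B)"
    by (rule val_count_grassmann[OF A B tail])
  have 7: "card ?I + val_count ?M (fps_plus ?A ?B) \<le> val_count ?M tD"
  proof (rule val_count_independent)
    show "fps_subspace (fps_plus ?A ?B)" by (rule fps_subspace_plus[OF A B])
    show "fps_plus ?A ?B \<subseteq> tD"
      using x\<^sub>1U_in_tD BtD fps_subspaceD(2)[OF tD_subspace] unfolding fps_plus_def by blast
    show "g \<in> fps_plus ?A ?B" if "\<And>j. j < ?M \<Longrightarrow> fps_nth g j = 0" for g
      using tail[OF that] fps_plus_upper(1)[OF A B] by blast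
    show "finite ?I" by (rule finite_subset[of _ "{2..n} \<times> {2..n}"]) auto
    show "\<xi> (fst p) * fps_euler (\<xi> (snd p)) \<in> tD" if "p \<in> ?I" for p
      using that by (intro tD_mult R_\<xi> euler_\<xi>_in_tD) auto
  qed (rule tD_subspace, rule x_dx_independent)
  have "?A \<inter> ?B \<subseteq> fps_euler ` W" 
  proof
    fix g assume g: "g \<in> ?A \<inter> ?B"
    then obtain y where "y \<in> m\<^sub>R" "g = fps_euler y" by blast
    then show "g \<in> fps_euler ` W" using g by (intro image_eqI[of _ _ y]) (simp_all add: W_def)
  qed
  then have 8: "val_count ?M (?A \<inter> ?B) \<le> val_count ?M (fps_euler ` W)" by (rule val_count_mono)
  have 9: "val_count ?M (fps_euler ` W) = val_count ?M W"
    by (rule val_count_euler) (simp add: W_def m\<^sub>R_def)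
  from 1 2 3 4 5 6 7 8 9 show ?thesis by linarith
qed

text \<open>Impose the conditions x_i y \<in> x_1 R on \<open>W\<close> one by one. The products lie
  in C, which s elements span modulo x_1 R, so each condition costs at most s. What survives all n
  of them lies in the socle, which exceeds x_1 R by at most r.\<close>

lemma type_bound:
  assumes soc: "\<And>y. y \<in> R \<Longrightarrow> (\<And>i. i \<in> {1..n} \<Longrightarrow> \<xi> i * y \<in> (*) (\<xi> 1) ` R) \<Longrightarrow>
        \<exists>l. y - (\<Sum>i<r. fps_const (l i) * z i) \<in> (*) (\<xi> 1) ` R"
    and red: "\<And>y. y \<in> C \<Longrightarrow> \<exists>l. y - (\<Sum>i<s. fps_const (l i) * c i) \<in> (*) (\<xi> 1) ` R"
    and m5: "\<And>g. g \<in> P \<Longrightarrow> order_ge 5 g \<Longrightarrow> E g \<in> C"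
    and C_add: "\<And>y u. y \<in> C \<Longrightarrow> u \<in> R \<Longrightarrow> \<xi> 1 * u + y \<in> C"
  shows "(n - 1) * (n - 2) \<le> 2 * (r + n * s)"
proof -
  let ?M = "cond + ord1" and ?xR = "(*) (\<xi> 1) ` R"
  have xR: "fps_subspace ?xR" by (rule fps_subspace_image_mult[OF R_subspace])
  \<comment> \<open>Order 4 from \<open>W_order\<close> and one further variable make up the order 5
    in \<open>m5\<close>.\<close>
  have W_C: "\<xi> i * y \<in> C" if y: "y \<in> W" and i: "i \<in> {1..n}" for y i
  proof -
    obtain A G where AG: "A \<in> R" "G \<in> P" "order_ge 4 G" "y = \<xi> 1 * A + E G"
      using W_order[OF y] by blast
    have "order_ge 1 (mps_var i :: _ \<Rightarrow> 'a)"
      by (auto simp: order_ge_def mps_var_def)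
    from order_ge_mult[OF this AG(3)] have "order_ge 5 (mps_mult (mps_var i) G)" by simp
    from C_add[OF m5[OF mps_mult_closed[OF mps_var_closed[OF i] AG(2)] this] R_mult[OF R_\<xi>[OF i] AG(1)]]
    show ?thesis unfolding AG(4) by (simp add: ev_mult ev_var[OF i] algebra_simps)
  qed
  define V where "V k = {y \<in> W. \<forall>i\<in>{1..k}. \<xi> i * y \<in> ?xR}" for k
  have V: "fps_subspace (V k)" for k
    unfolding fps_subspace_def
  proof (intro conjI ballI allI)
    show "0 \<in> V k" using fps_subspaceD(1)[OF W_subspace] fps_subspaceD(1)[OF xR] by (simp add: V_def)
  next
    fix g h assume "g \<in> V k" "h \<in> V k"
    then show "g + h \<in> V k"
      using fps_subspaceD(2)[OF W_subspace] fps_subspaceD(2)[OF xR] by (simp add: V_def distrib_left)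
  next
    fix a g assume "g \<in> V k"
    then show "fps_const a * g \<in> V k"
      using fps_subspaceD(3)[OF W_subspace] fps_subspaceD(3)[OF xR]
      by (simp add: V_def mult.left_commute[of _ "fps_const a"])
  qed
  have "val_count ?M W \<le> val_count ?M (V k) + k * s" if "k \<le> n" for k
    using that
  proof (induction k)
    case 0
    have "V 0 = W" by (simp add: V_def)
    then show ?case by simp
  next
    case (Suc k)
    have "val_count ?M (V k) \<le> val_count ?M {y \<in> V k. \<xi> (Suc k) * y \<in> ?xR} + s"
      by (rule val_count_preimage[OF xR _ _ V, where c = c])
        (use Suc.prems red[OF W_C] in \<open>auto simp: V_def distrib_left mult.left_commute\<close>)
    also have "{y \<in> V k. \<xi> (Suc k) * y \<in> ?xR} = V (Suc k)"
      by (auto simp: V_def atLeastAtMostSuc_conv)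
    finally show ?case using Suc by simp
  qed
  from this[of n] have 1: "val_count ?M W \<le> val_count ?M (V n) + n * s" by simp
  \<comment> \<open>Here \<phi> is the identity, so the condition is membership of y itself in x_1
    R.\<close>
  have "val_count ?M (V n) \<le> val_count ?M {y \<in> V n. y \<in> ?xR} + r"
    by (rule val_count_preimage[OF xR _ _ V, where \<phi> = "\<lambda>y. y" and c = z])
      (use soc in \<open>auto simp: V_def W_def m\<^sub>R_def\<close>)
  also have "val_count ?M {y \<in> V n. y \<in> ?xR} \<le> val_count ?M ?xR"
    by (rule val_count_mono) auto
  finally have "val_count ?M (V n) \<le> val_count ?M ?xR + r" by simp
  then have "card {(i, j). i \<in> {2..n} \<and> j \<in> {2..n} \<and> i < j} \<le> r + n * s"
    using 1 pairs_bound by linarith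
  then show ?thesis unfolding card_increasing_pairs[symmetric] by simp
qed

end

section \<open>From abstract rings to power series\<close>

lemma subr_simps:
  "carrier (subr R) = R" "monoid.mult (subr R) = (*)" "add (subr R) = (+)"
  "one (subr R) = 1" "ring.zero (subr R) = 0"
  by (auto simp: ring_of_type_algebra_def fun_eq_iff)

lemma fps_to_fls_sum: "fps_to_fls (sum g A) = (\<Sum>i\<in>A. fps_to_fls (g i))"
  by (induction A rule: infinite_finite_induct) auto

lemma subr_closed:
  assumes "cring (subr R)" "range fls_const \<subseteq> R"
  shows "a \<in> R \<Longrightarrow> b \<in> R \<Longrightarrow> a + b \<in> R" "a \<in> R \<Longrightarrow> b \<in> R \<Longrightarrow> a * b \<in> R"
    "a \<in> R \<Longrightarrow> - a \<in> R" "a \<in> R \<Longrightarrow> a ^ k \<in> R"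
    "(\<And>i. i \<in> S \<Longrightarrow> h i \<in> R) \<Longrightarrow> sum h S \<in> R"
proof -
  interpret cring "subr R" by fact
  show add: "a \<in> R \<Longrightarrow> b \<in> R \<Longrightarrow> a + b \<in> R" for a b
    using a_closed[unfolded subr_simps] .
  show mult: "a \<in> R \<Longrightarrow> b \<in> R \<Longrightarrow> a * b \<in> R" for a b
    using m_closed[unfolded subr_simps] .
  have c: "fls_const k \<in> R" for k using assms(2) by auto
  show "a \<in> R \<Longrightarrow> - a \<in> R" using mult[OF c[of "- 1"], of a] by simp
  have "0 \<in> R" "1 \<in> R" using c[of 0] c[of 1] by simp_all
  then show "a \<in> R \<Longrightarrow> a ^ k \<in> R" "(\<And>i. i \<in> S \<Longrightarrow> h i \<in> R) \<Longrightarrow> sum h S \<in> R"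
    by (induction k, auto intro: mult, induction S rule: infinite_finite_induct, auto intro: add)
qed

text \<open>Multiply a monic equation of degree k + 1 by z^k: since z * y = 1, the leading term
  becomes y and all others become polynomials in z over R.\<close>

lemma integral_inverse:
  assumes R: "cring (subr R)" "range fls_const \<subseteq> R"
    and y: "integral_over R y" and z: "z \<in> R" "z * y = 1"
  shows "y \<in> R"
proof -
  note cl = subr_closed[OF R]
  obtain p :: "'a fls poly" where p: "Polynomial.lead_coeff p = 1" "\<And>i. Polynomial.coeff p i \<in> R" "Polynomial.poly p y = 0"
    using y unfolding integral_over_def by blast
  have pe: "(\<Sum>i\<le>Polynomial.degree p. Polynomial.coeff p i * y ^ i) = 0"
    using p(3) by (simp add: poly_altdef)
  show ?thesis
  proof (cases "Polynomial.degree p")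
    case 0
    then show ?thesis using pe p(1) by simp
  next
    case (Suc k)
    have zy: "z ^ k * y ^ i = z ^ (k - i)" if "i \<le> k" for i
    proof -
      have "z ^ k = z ^ (k - i) * z ^ i" using that by (simp flip: power_add)
      then have "z ^ k * y ^ i = z ^ (k - i) * (z * y) ^ i" by (simp only: power_mult_distrib mult.assoc)
      then show ?thesis using z(2) by simp
    qed
    have "0 = z ^ k * (\<Sum>i\<le>Suc k. Polynomial.coeff p i * y ^ i)" using pe Suc by simp
    also have "\<dots> = (\<Sum>i\<le>k. Polynomial.coeff p i * (z ^ k * y ^ i)) + z ^ k * y ^ k * y"
      using p(1) Suc by (simp add: sum_distrib_left distrib_left mult_ac)
    also have "(\<Sum>i\<le>k. Polynomial.coeff p i * (z ^ k * y ^ i)) = (\<Sum>i\<le>k. Polynomial.coeff p i * z ^ (k - i))"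
      by (rule sum.cong) (simp_all add: zy)
    also have "z ^ k * y ^ k = 1" using zy[of k] by simp
    finally have "y = - (\<Sum>i\<le>k. Polynomial.coeff p i * z ^ (k - i))"
      by (simp add: eq_neg_iff_add_eq_0 add.commute)
    moreover have "- (\<Sum>i\<le>k. Polynomial.coeff p i * z ^ (k - i)) \<in> R"
      by (intro cl(2-5) p(2) z(1))
    ultimately show ?thesis by (simp only:)
  qed
qed

text \<open>\<open>ring.dimension\<close> is built by repeated line extension, so induction along it
  collects one coset representative per line. Equality of cosets is then read as membership of a
  difference in \<open>J\<close>.\<close>

lemma quot_dim_span:
  assumes R: "cring (subr R)" "range fls_const \<subseteq> R"
    and fps: "R \<subseteq> range fps_to_fls"
    and J: "ideal J (subr R)" and V: "V \<subseteq> R" and dim: "quot_dim R V J d"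
  shows "\<exists>z. \<forall>y. fps_to_fls y \<in> V \<longrightarrow>
    (\<exists>l. fps_to_fls (y - (\<Sum>i<d. fps_const (l i) * z i)) \<in> J)"
proof -
  note cl = subr_closed[OF R]
  interpret J: ideal J "subr R" by fact
  interpret Q: ring "subr R Quot J" by (rule J.quotient_is_ring)
  let ?c = "\<lambda>y. J +>\<^bsub>subr R\<^esub> y"
  have add: "?c a \<oplus>\<^bsub>subr R Quot J\<^esub> ?c b = ?c (a + b)" if "a \<in> R" "b \<in> R" for a b
    using J.a_rcos_sum[of a b] that by (simp add: FactRing_def subr_simps)
  have mult: "?c a \<otimes>\<^bsub>subr R Quot J\<^esub> ?c b = ?c (a * b)" if "a \<in> R" "b \<in> R" for a b
    using J.rcoset_mult_add[of a b] that by (simp add: FactRing_def subr_simps)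
  have "\<exists>v. (\<forall>i<d. v i \<in> R) \<and> (\<forall>e\<in>B. \<exists>l. e = ?c (\<Sum>i<d. fls_const (l i) * v i))"
    if "Q.dimension d K B" "K \<subseteq> range (\<lambda>k. ?c (fls_const k))" for K B
    using that
  proof (induction rule: Q.dimension.induct)
    case (zero_dim K)
    have "?c 0 = J" 
      using J.a_rcos_const additive_subgroup.zero_closed[OF J.is_additive_subgroup]
      by (simp add: subr_simps)
    then show ?case by (simp add: FactRing_def)
  next
    case (Suc_dim w B d K)
    then obtain v where v: "\<forall>i<d. v i \<in> R" "\<forall>e\<in>B. \<exists>l. e = ?c (\<Sum>i<d. fls_const (l i) * v i)" by blast
    obtain w0 where w0: "w0 \<in> R" "w = ?c w0"
      using Suc_dim.hyps(1) by (auto simp: FactRing_def A_RCOSETS_def' subr_simps)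
    have "\<exists>l. e = ?c (\<Sum>i<Suc d. fls_const (l i) * (v(d := w0)) i)" if e: "e \<in> Q.line_extension K w B" for e
    proof -
      obtain k b where kb: "k \<in> K" "b \<in> B" "e = k \<otimes>\<^bsub>subr R Quot J\<^esub> w \<oplus>\<^bsub>subr R Quot J\<^esub> b"
        using e by (auto simp: Q.line_extension_mem_iff)
      obtain k0 where k0: "k = ?c (fls_const k0)" using kb(1) Suc_dim.prems by blast
      obtain l where l: "b = ?c (\<Sum>i<d. fls_const (l i) * v i)" using kb(2) v(2) by blast
      have kR: "fls_const c \<in> R" for c using R(2) by auto
      have sR: "(\<Sum>i<d. fls_const (l i) * v i) \<in> R" using v(1) kR by (intro cl) auto
      have "e = ?c (fls_const k0 * w0 + (\<Sum>i<d. fls_const (l i) * v i))"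
        unfolding kb(3) k0 l w0(2) by (simp add: mult add w0(1) kR sR cl)
      also have "fls_const k0 * w0 + (\<Sum>i<d. fls_const (l i) * v i)
          = (\<Sum>i<Suc d. fls_const ((l(d := k0)) i) * (v(d := w0)) i)" by simp
      finally show ?thesis by blast
    qed
    moreover have "\<forall>i<Suc d. (v(d := w0)) i \<in> R" using v(1) w0 by (auto simp: less_Suc_eq)
    ultimately show ?case by blast
  qed
  from this[OF dim[unfolded quot_dim_def]] obtain v where vR: "\<forall>i<d. v i \<in> R"
    and v: "\<And>y. y \<in> V \<Longrightarrow> \<exists>l. ?c y = ?c (\<Sum>i<d. fls_const (l i) * v i)" by blast
  have "\<exists>l. y - (\<Sum>i<d. fls_const (l i) * v i) \<in> J" if y: "y \<in> V" for y
  proof -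
    obtain l where "?c y = ?c (\<Sum>i<d. fls_const (l i) * v i)" using v[OF y] by blast
    moreover have "y \<in> ?c y" using y V by (intro J.a_rcos_self) (auto simp: subr_simps)
    ultimately obtain h where "h \<in> J" "y = h + (\<Sum>i<d. fls_const (l i) * v i)"
      by (auto simp: a_r_coset_def' subr_simps)
    then show ?thesis by (intro exI[of _ l]) simp
  qed
  note span = this
  have "\<forall>i. \<exists>z. i < d \<longrightarrow> v i = fps_to_fls z" using vR fps by blast
  then obtain z where z: "\<And>i. i < d \<Longrightarrow> v i = fps_to_fls (z i)" by metis
  have "fps_to_fls (y - (\<Sum>i<d. fps_const (l i) * z i)) = fps_to_fls y - (\<Sum>i<d. fls_const (l i) * v i)" for y l
    by (simp add: fps_to_fls_sum fls_times_fps_to_fls z)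
  then show ?thesis using span by metis
qed

section \<open>Orders of power series and powers of the maximal ideals\<close>

lemma ideal_order_ge: "ideal {g \<in> carrier (mps n :: ((nat \<Rightarrow>\<^sub>0 nat) \<Rightarrow> 'a::field) ring). order_ge d g} (mps n)"
proof (rule idealI)
  interpret mps: cring "mps n :: ((nat \<Rightarrow>\<^sub>0 nat) \<Rightarrow> 'a) ring" by (rule cring_mps)
  show "ring (mps n :: ((nat \<Rightarrow>\<^sub>0 nat) \<Rightarrow> 'a) ring)" by (rule mps.ring_axioms)
  show "subgroup {g \<in> carrier (mps n :: ((nat \<Rightarrow>\<^sub>0 nat) \<Rightarrow> 'a) ring). order_ge d g} (add_monoid (mps n))"
  proof (rule mps.add.subgroupI)
    show "{g \<in> carrier (mps n :: ((nat \<Rightarrow>\<^sub>0 nat) \<Rightarrow> 'a) ring). order_ge d g} \<noteq> {}"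
      by (auto simp: mps_simps order_ge_def intro!: exI[of _ "\<lambda>e. 0"])
  next
    fix g :: "(nat \<Rightarrow>\<^sub>0 nat) \<Rightarrow> 'a" assume g: "g \<in> {g \<in> carrier (mps n). order_ge d g}"
    have "\<ominus>\<^bsub>mps n\<^esub> g = (\<lambda>e. - g e)"
      by (rule mps.minus_equality) (use g in \<open>auto simp: mps_simps\<close>)
    then show "\<ominus>\<^bsub>mps n\<^esub> g \<in> {g \<in> carrier (mps n). order_ge d g}"
      using g by (auto simp: mps_simps order_ge_def)
  qed (auto simp: mps_simps order_ge_def)
next
  fix g h :: "(nat \<Rightarrow>\<^sub>0 nat) \<Rightarrow> 'a"
  assume *: "g \<in> {g \<in> carrier (mps n). order_ge d g}" "h \<in> carrier (mps n)"
  have "order_ge 0 h" by (simp add: order_ge_def)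
  then have "order_ge d (mps_mult h g)" using order_ge_mult[of 0 h d g] * by simp
  then show "h \<otimes>\<^bsub>mps n\<^esub> g \<in> {g \<in> carrier (mps n). order_ge d g}"
    and "g \<otimes>\<^bsub>mps n\<^esub> h \<in> {g \<in> carrier (mps n). order_ge d g}"
    using * by (simp_all add: mps_simps(1) mps_mult_closed mps_mult_commute[of g h])
qed

lemma ideal_prod_order_ge:
  assumes "I \<subseteq> {g. order_ge c g}" "J \<subseteq> {g. order_ge d g}"
  shows "ideal_prod (mps n) I J \<subseteq> {g. order_ge (c + d) g}"
proof
  fix g assume "g \<in> ideal_prod (mps n) I J"
  then show "g \<in> {g. order_ge (c + d) g}"
  proof (induction rule: ideal_prod.induct)
    case (prod i j)
    then show ?case using assms order_ge_mult[of c i d j] by (auto simp: mps_simps(1))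
  next
    case (sum g h)
    then show ?case by (simp add: mps_simps(4) order_ge_def)
  qed
qed

text \<open>Variables have order 1 and orders add under multiplication. This converts the condition
  that I lies in (X)^2 into \<open>ker_order\<close>.\<close>

lemma maximal_ideal_square_order_ge:
  "ideal_power (mps n) (Idl\<^bsub>mps n\<^esub> (mps_var ` {1..n})) 2 \<subseteq> {g :: (nat \<Rightarrow>\<^sub>0 nat) \<Rightarrow> 'a::field. order_ge 2 g}"
proof -
  interpret mps: cring "mps n :: ((nat \<Rightarrow>\<^sub>0 nat) \<Rightarrow> 'a) ring" by (rule cring_mps)
  let ?I = "Idl\<^bsub>mps n\<^esub> (mps_var ` {1..n}) :: ((nat \<Rightarrow>\<^sub>0 nat) \<Rightarrow> 'a) set"
  have "order_ge 1 (mps_var i :: _ \<Rightarrow> 'a)" for i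
    by (auto simp: order_ge_def mps_var_def)
  then have "?I \<subseteq> {g \<in> carrier (mps n). order_ge 1 g}"
    by (intro mps.genideal_minimal ideal_order_ge) (auto intro: mps_var_closed)
  then have I: "?I \<subseteq> {g. order_ge 1 g}" by blast
  \<comment> \<open>The square unfolds to a product of the whole ring, of order 0, with I and then
    with I again.\<close>
  have "ideal_prod (mps n) (carrier (mps n)) ?I \<subseteq> {g. order_ge (0 + 1) g}"
    by (rule ideal_prod_order_ge[OF _ I]) (simp add: order_ge_def)
  from ideal_prod_order_ge[OF this I] show ?thesis
    by (simp add: ideal_power_def numeral_2_eq_2 nat_pow_def ideals_set_def)
qed

context evaluation
begin

text \<open>Each monomial is divided by its variable of least index, so it is counted exactly once,
  and the sum stays finite although g is a series.\<close>

lemma order_ge_decomposition: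
  assumes g: "g \<in> P" "order_ge (Suc d) g"
  shows "\<exists>h. (\<forall>i\<in>{1..n}. h i \<in> P \<and> order_ge d (h i)) \<and> E g = (\<Sum>i\<in>{1..n}. \<xi> i * E (h i))"
proof -
  let ?s = "\<lambda>i. Poly_Mapping.single i (1::nat)"
  define h where "h i = (\<lambda>e. if i = Min (Poly_Mapping.keys (e + ?s i)) then g (e + ?s i) else 0)" for i
  have hP: "h i \<in> P" if "i \<in> {1..n}" for i
    using g(1) by (auto simp: h_def mps_simps monomials_add)
  have "order_ge d (h i)" for i
    using g(2) by (auto simp: h_def order_ge_def total_degree_add)
  moreover have "g = (\<lambda>e. \<Sum>i\<in>{1..n}. mps_mult (mps_var i) (h i) e)"
  proof
    fix e
    have t: "mps_mult (mps_var i) (h i) e = (if i = Min (Poly_Mapping.keys e) \<and> e \<noteq> 0 then g e else 0)" for i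
    proof (cases "Poly_Mapping.lookup e i = 0")
      case True
      have "i \<noteq> Min (Poly_Mapping.keys e)" if "e \<noteq> 0"
        using Min_in[of "Poly_Mapping.keys e"] that True by (auto simp: in_keys_iff)
      then show ?thesis using True by (auto simp: mps_var_mult_0)
    next
      case False
      then have "e - ?s i + ?s i = e" "e \<noteq> 0" using single_diff_add[OF False] by (auto simp: add.commute)
      moreover from this(1) have "h i (e - ?s i) = (if i = Min (Poly_Mapping.keys e) then g e else 0)"
        unfolding h_def by (simp only:)
      ultimately show ?thesis using False by (simp only: mps_var_mult_nth) simp
    qed
    show "g e = (\<Sum>i\<in>{1..n}. mps_mult (mps_var i) (h i) e)"
    proof (cases "e \<in> monomials n \<and> e \<noteq> 0")
      case True
      then have "Min (Poly_Mapping.keys e) \<in> Poly_Mapping.keys e" by (intro Min_in) auto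
      then have "Min (Poly_Mapping.keys e) \<in> {1..n}"
        using True unfolding monomials_def by blast
      then show ?thesis unfolding t using True by simp
    next
      case False
      then have "g e = 0" using g by (auto simp: mps_simps order_ge_def total_degree_def)
      moreover from this have "(\<Sum>i\<in>{1..n}. mps_mult (mps_var i) (h i) e) = 0"
        unfolding t by (intro sum.neutral) simp
      ultimately show ?thesis by simp
    qed
  qed
  from arg_cong[OF this, of E] have "E g = (\<Sum>i\<in>{1..n}. E (mps_var i) * E (h i))"
    unfolding ev_sum ev_mult .
  then have "E g = (\<Sum>i\<in>{1..n}. \<xi> i * E (h i))" by (simp add: ev_var)
  ultimately show ?thesis using hP by blast
qed

text \<open>Splitting off one variable at a time is a finite operation even for series, so the value
  lands in the algebraic power of the ideal, without taking a closure.\<close>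

lemma order_ge_ideal_power:
  assumes I: "\<And>i. i \<in> {1..n} \<Longrightarrow> fps_to_fls (\<xi> i) \<in> I" and "1 \<le> n"
    and g: "g \<in> P" "order_ge d g"
  shows "fps_to_fls (E g) \<in> ideal_power (subr (fps_to_fls ` R)) I d"
  using g
proof (induction d arbitrary: g)
  case 0
  then show ?case using E_in_R by (simp add: ideal_power_def nat_pow_def ideals_set_def subr_simps)
next
  case (Suc d)
  let ?S = "subr (fps_to_fls ` R)"
  have pw: "ideal_power ?S I (Suc d) = ideal_prod ?S (ideal_power ?S I d) I"
    by (simp add: ideal_power_def nat_pow_def ideals_set_def)
  obtain h where h: "\<And>i. i \<in> {1..n} \<Longrightarrow> h i \<in> P \<and> order_ge d (h i)"
    and eq: "E g = (\<Sum>i\<in>{1..n}. \<xi> i * E (h i))"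
    using order_ge_decomposition[OF Suc.prems] by blast
  have tm: "fps_to_fls (\<xi> i * E (h i)) \<in> ideal_prod ?S (ideal_power ?S I d) I" if "i \<in> {1..n}" for i
    using ideal_prod.prod[OF Suc.IH[of "h i"] I[OF that], where R = ?S] h[OF that]
    by (simp add: subr_simps fls_times_fps_to_fls mult.commute)
  \<comment> \<open>\<open>ideal_prod\<close> is built from products by binary sums, so the
    induction starts with one term; here n \<ge> 1 enters.\<close>
  have "fps_to_fls (\<Sum>i\<in>B. \<xi> i * E (h i)) \<in> ideal_prod ?S (ideal_power ?S I d) I"
    if "finite B" "B \<noteq> {}" "B \<subseteq> {1..n}" for B
    using that
  proof (induction B rule: finite_ne_induct)
    case (singleton i)
    then show ?case using tm by simp
  next
    case (insert i B)
    then show ?case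
      using ideal_prod.sum[OF tm[of i], of "fps_to_fls (\<Sum>i\<in>B. \<xi> i * E (h i))"] by (simp add: subr_simps)
  qed
  from this[of "{1..n}"] show ?case using assms(2) unfolding pw eq by simp
qed

end

section \<open>Torsion in the cokernel of the Jacobian matrix\<close>

context branch_presentation
begin

text \<open>The map \<phi> carries \<open>N\<close> onto the Jacobian image, so \<rho> v \<in>
  \<open>N\<close> makes the coset of v a torsion element. That coset is then zero, which brings v
  back into \<open>N\<close>.\<close>

lemma torsion_freeI:
  fixes x :: "nat \<Rightarrow> 'a fls"
  defines "S \<equiv> fps_to_fls ` R"
  assumes x: "\<And>i. i \<in> {1..n} \<Longrightarrow> x i = fps_to_fls (\<xi> i)"
    and tors: "torsion (subr S) (differentials S n x m f) = {\<zero>\<^bsub>differentials S n x m f\<^esub>}"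
    and \<rho>: "\<rho> \<in> R" "\<rho> \<noteq> 0" and v: "\<And>i. i \<in> {1..n} \<Longrightarrow> v i \<in> R" and mem: "(\<lambda>i. \<rho> * v i) \<in> N"
  shows "v \<in> N"
proof -
  let ?M = "free_module S n"
  define J where "J = jacobian_image S n x m f"
  define \<phi> where "\<phi> w = (\<lambda>i\<in>{1..n}. fps_to_fls (w i))" for w :: "nat \<Rightarrow> 'a fps"
  have me: "mps_eval n x g = fps_to_fls (E g)" for g by (rule mps_eval_eq_ev) (rule x)
  have \<phi>_eq: "\<phi> w = \<phi> u \<longleftrightarrow> (\<forall>i\<in>{1..n}. w i = u i)" for w u
    by (auto simp: \<phi>_def fun_eq_iff restrict_def)
  have J_iff: "J = \<phi> ` N"
  proof (intro equalityI subsetI)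
    fix w assume "w \<in> J"
    then obtain c where c: "c \<in> {1..m} \<rightarrow>\<^sub>E S"
      and w: "w = (\<lambda>i\<in>{1..n}. \<Sum>j\<in>{1..m}. mps_eval n x (mps_deriv i (f j)) * c j)"
      by (auto simp: J_def jacobian_image_def)
    have "\<forall>j\<in>{1..m}. \<exists>b\<in>R. c j = fps_to_fls b" using c by (force simp: S_def PiE_def Pi_def)
    then obtain b where b: "\<And>j. j \<in> {1..m} \<Longrightarrow> b j \<in> R \<and> c j = fps_to_fls (b j)" by metis
    define u where "u i = (\<Sum>j\<in>{1..m}. E (mps_deriv i (f j)) * b j)" for i
    have "w = \<phi> u"
      unfolding w \<phi>_def u_def fps_to_fls_sum me
      by (intro ext) (auto simp: restrict_def fls_times_fps_to_fls b intro!: sum.cong)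
    moreover have "u \<in> N" unfolding N_def u_def using b by blast
    ultimately show "w \<in> \<phi> ` N" by blast
  next
    fix w assume "w \<in> \<phi> ` N"
    then obtain u b where u: "w = \<phi> u" and b: "\<forall>j\<in>{1..m}. b j \<in> R"
        "\<forall>i\<in>{1..n}. u i = (\<Sum>j\<in>{1..m}. E (mps_deriv i (f j)) * b j)"
      by (auto simp: N_def)
    show "w \<in> J"
      unfolding J_def jacobian_image_def
    proof (rule image_eqI)
      show "(\<lambda>j\<in>{1..m}. fps_to_fls (b j)) \<in> {1..m} \<rightarrow>\<^sub>E S" using b(1) by (auto simp: S_def)
      show "w = (\<lambda>i\<in>{1..n}. \<Sum>j\<in>{1..m}. mps_eval n x (mps_deriv i (f j)) * (\<lambda>j\<in>{1..m}. fps_to_fls (b j)) j)"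
        unfolding u \<phi>_def me
        by (intro ext) (auto simp: restrict_def b(2) fps_to_fls_sum fls_times_fps_to_fls intro!: sum.cong)
    qed
  qed
  have \<phi>_add: "\<phi> h \<oplus>\<^bsub>?M\<^esub> \<phi> u = \<phi> (\<lambda>i. h i + u i)" for h u
    by (auto simp: free_module_def \<phi>_def fun_eq_iff restrict_def)
  have \<phi>_smult: "fps_to_fls \<rho> \<odot>\<^bsub>?M\<^esub> \<phi> u = \<phi> (\<lambda>i. \<rho> * u i)" for u
    by (auto simp: free_module_def \<phi>_def fun_eq_iff restrict_def fls_times_fps_to_fls)
  have coset: "J +>\<^bsub>?M\<^esub> \<phi> u = {\<phi> (\<lambda>i. h i + u i) | h. h \<in> N}" for u
    unfolding J_iff a_r_coset_def' by (auto simp: \<phi>_add)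
  have coset_N: "J +>\<^bsub>?M\<^esub> \<phi> u = J" if "u \<in> N" for u
  proof -
    have "\<exists>k\<in>N. \<phi> h = \<phi> (\<lambda>i. k i + u i)" if "h \<in> N" for h
      by (intro bexI[of _ "\<lambda>i. h i - u i"] N_diff that \<open>u \<in> N\<close>) simp
    then show ?thesis unfolding coset unfolding J_iff using N_add[OF _ that] by blast
  qed
  define w where "w = J +>\<^bsub>?M\<^esub> \<phi> v"
  have "\<phi> v \<in> carrier ?M" using v by (auto simp: free_module_def \<phi>_def S_def)
  then have "w \<in> carrier (differentials S n x m f)"
    unfolding differentials_def quotient_module_def J_def[symmetric] w_def
    by (simp add: A_RCOSETS_def') blast
  moreover have "fps_to_fls \<rho> \<in> carrier (subr S) - {\<zero>\<^bsub>subr S\<^esub>}"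
    using \<rho> by (auto simp: subr_simps S_def)
  moreover have "fps_to_fls \<rho> \<odot>\<^bsub>differentials S n x m f\<^esub> w = \<zero>\<^bsub>differentials S n x m f\<^esub>"
  proof -
    \<comment> \<open>The scalar action is a union over all representatives of the coset: each must
      give J, and there must be at least one.\<close>
    have "J +>\<^bsub>?M\<^esub> (fps_to_fls \<rho> \<odot>\<^bsub>?M\<^esub> b) = J" if "b \<in> w" for b
    proof -
      obtain h where h: "h \<in> N" "b = \<phi> (\<lambda>i. h i + v i)" using \<open>b \<in> w\<close> unfolding w_def coset by blast
      have "(\<lambda>i. \<rho> * h i + \<rho> * v i) \<in> N" by (intro N_add N_scale h \<rho> mem)
      then have "(\<lambda>i. \<rho> * (h i + v i)) \<in> N" by (simp add: distrib_left)
      then show ?thesis unfolding h(2) \<phi>_smult by (rule coset_N)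
    qed
    moreover have "w \<noteq> {}" unfolding w_def coset using N_zero by blast
    ultimately show ?thesis
      by (simp add: differentials_def quotient_module_def J_def[symmetric])
  qed
  ultimately have "w \<in> torsion (subr S) (differentials S n x m f)"
    unfolding torsion_def by blast
  then have "w = J" unfolding tors by (simp add: differentials_def quotient_module_def J_def)
  moreover have "\<phi> v \<in> w" unfolding w_def coset using N_zero by force
  ultimately obtain u where "u \<in> N" "\<phi> v = \<phi> u" unfolding J_iff by auto
  then show ?thesis using N_cong[of u v] by (auto simp: \<phi>_eq)
qed

end

theorem theorem5p7:
  fixes R :: "'a::{alg_closed_field, field_char_0} fls set"
    and x :: "nat \<Rightarrow> 'a fls" and \<alpha> :: "nat \<Rightarrow> 'a fps" and a :: "nat \<Rightarrow> nat"
    and f :: "nat \<Rightarrow> (nat \<Rightarrow>\<^sub>0 nat) \<Rightarrow> 'a"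
    and n m s r :: nat
  assumes R: "complete_branch R"
    and edim_R: "has_edim R n"
    and x_gen: "Idl\<^bsub>subr R\<^esub> (x ` {1..n}) = max_ideal (subr R)"
    and x_eq: "\<And>i. i \<in> {1..n} \<Longrightarrow> x i = fps_to_fls (\<alpha> i) * fls_X ^ a i"
    and x_mem: "x ` {1..n} \<subseteq> max_ideal (subr R)"
    and \<alpha>_unit: "\<And>i. i \<in> {1..n} \<Longrightarrow> \<alpha> i dvd 1"
    and \<alpha>_1: "\<alpha> 1 = 1"
    and a_mono: "mono_on {1..n} a"
    and f_mem: "\<And>j. j \<in> {1..m} \<Longrightarrow> f j \<in> carrier (mps n)"
    and pres_surj: "mps_eval n x ` carrier (mps n) = R"
    and pres_ker: "a_kernel (mps n) (subr R) (mps_eval n x) = Idl\<^bsub>mps n\<^esub> (f ` {1..m})"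
    and pres_min: "Idl\<^bsub>mps n\<^esub> (f ` {1..m}) \<subseteq>
      ideal_power (mps n) (Idl\<^bsub>mps n\<^esub> (mps_var ` {1..n})) 2"
    and red_type: "has_reduced_type R (x 1) s"
    and cm_type: "has_cm_type R (x 1) r"
    and cond_sub: "conductor R \<subseteq> ideal_power (subr R) (max_ideal (subr R)) 2"
    and edim_S: "has_edim (conductor_extension R (x 1)) (n + s)"
    and type_le: "real r \<le> (real n ^ 2 - 3 * real n - 2 * real n * real s) / 2"
    and m5: "ideal_power (subr R) (max_ideal (subr R)) 5 \<subseteq> conductor_plus R (x 1)"
  shows "torsion (subr R) (differentials R n x m f) \<noteq> {\<zero>\<^bsub>differentials R n x m f\<^esub>}"
proof
  assume tors: "torsion (subr R) (differentials R n x m f) = {\<zero>\<^bsub>differentials R n x m f\<^esub>}"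
  have const_R: "range fls_const \<subseteq> R" and int: "integral_closure R = range fps_to_fls"
    and loc: "is_local (subr R)"
    using R by (auto simp: complete_branch_def)
  have ring: "cring (subr R)" using loc by (simp add: is_local_def)
  interpret A: cring "subr R" by (rule ring)
  note cl = subr_closed[OF ring const_R]
  have frac: "\<exists>b\<in>R. b \<noteq> 0 \<and> b * fps_to_fls g \<in> R" for g
  proof -
    have "fps_to_fls g \<in> frac_field R" using int by (auto simp: integral_closure_def)
    then obtain p q where "p \<in> R" "q \<in> R" "q \<noteq> 0" "fps_to_fls g = p / q" by (auto simp: frac_field_def)
    then show ?thesis by (intro bexI[of _ q]) auto
  qed
  have R_fps: "R \<subseteq> range fps_to_fls"
    using pres_surj by (auto simp: mps_eval_def)
  \<comment> \<open>For n = 0 all values would be constants, and t could not be a fraction of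
    elements of R.\<close>
  have n1: "1 \<le> n"
  proof (rule ccontr)
    assume "\<not> 1 \<le> n"
    then have n0: "n = 0" by simp
    have "low_monomials 0 j = {0}" for j by (auto simp: low_monomials_def monomials_def total_degree_def)
    then have "ev 0 \<xi> g = fps_const (g 0)" for \<xi> and g :: "(nat \<Rightarrow>\<^sub>0 nat) \<Rightarrow> 'a"
      by (intro fps_ext) (simp add: ev_def)
    then have "mps_eval n x g = fps_to_fls (fps_const (g 0))" for g
      using mps_eval_eq_ev[of n x "\<lambda>_. 0" g] n0 by simp
    then have const: "\<exists>k. b = fps_to_fls (fps_const k)" if "b \<in> R" for b using that pres_surj by auto
    obtain b where b: "b \<in> R" "b \<noteq> 0" "b * fps_to_fls fps_X \<in> R" using frac by blast
    obtain k l where kl: "b = fps_to_fls (fps_const k)" "b * fps_to_fls fps_X = fps_to_fls (fps_const l)"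
      using const b by blast
    have "fps_to_fls (fps_const k * fps_X) = fps_to_fls (fps_const l)"
      unfolding fls_times_fps_to_fls using kl by (simp only:)
    then have "fps_const k * fps_X = fps_const l" by (simp only: fps_to_fls_eq_iff)
    from arg_cong[OF this, of "\<lambda>g. fps_nth g 1"] have "k = 0" by simp
    then show False using b(2) kl(1) by simp
  qed
  have max: "maximalideal (max_ideal (subr R)) (subr R)"
    unfolding max_ideal_def by (rule theI') (use loc in \<open>unfold is_local_def, blast\<close>)
  interpret M: maximalideal "max_ideal (subr R)" "subr R" by (rule max)
  have M_R: "max_ideal (subr R) \<subseteq> R" using M.a_subset by (simp add: subr_simps)
  define \<xi> where "\<xi> i = \<alpha> i * fps_X ^ a i" for i
  have x_fps: "x i = fps_to_fls (\<xi> i)" if "i \<in> {1..n}" for i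
    unfolding x_eq[OF that] \<xi>_def by (simp add: fls_times_fps_to_fls fps_to_fls_power)
  \<comment> \<open>Otherwise x_i is a unit of k[[t]] whose inverse, being integral over R, lies in
    R; then the maximal ideal contains 1.\<close>
  have a_pos: "0 < a i" if i: "i \<in> {1..n}" for i
  proof (rule ccontr)
    assume "\<not> 0 < a i"
    then have xi: "x i = fps_to_fls (\<alpha> i)" using x_eq[OF i] by simp
    obtain \<beta> where "1 = \<alpha> i * \<beta>" using \<alpha>_unit[OF i] by (auto simp: dvd_def)
    then have inv: "x i * fps_to_fls \<beta> = 1" unfolding xi by (metis fls_times_fps_to_fls fps_one_to_fls)
    have xM: "x i \<in> max_ideal (subr R)" using x_mem i by blast
    have "integral_over R (fps_to_fls \<beta>)" using int by (auto simp: integral_closure_def)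
    then have "fps_to_fls \<beta> \<in> R" using integral_inverse[OF ring const_R _ _ inv] xM M_R by blast
    then have "\<one>\<^bsub>subr R\<^esub> \<in> max_ideal (subr R)"
      using M.I_r_closed[OF xM, of "fps_to_fls \<beta>"] inv by (simp add: subr_simps)
    then show False using M.one_imp_carrier M.I_notcarr by simp
  qed
  interpret ev: evaluation n \<xi>
  proof unfold_locales
    show "fps_nth (\<xi> i) 0 = 0" if "i \<in> {1..n}" for i
      using a_pos[OF that] by (simp add: \<xi>_def)
  qed
  have me: "mps_eval n x g = fps_to_fls (ev n \<xi> g)" for g by (rule mps_eval_eq_ev) (rule x_fps)
  have R_eq: "R = fps_to_fls ` ev.R" unfolding pres_surj[symmetric] ev.R_def image_image me ..
  have R_iff: "fps_to_fls g \<in> R \<longleftrightarrow> g \<in> ev.R" for g unfolding R_eq by auto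
  have \<xi>1: "\<xi> 1 = fps_X ^ a 1" by (simp only: \<xi>_def \<alpha>_1 mult_1_left)
  have one: "1 \<in> {1..n}" using n1 by simp
  have "\<exists>c. \<forall>g. fps_X ^ c * g \<in> ev.R"
  proof (rule ev.conductor_exists[OF n1 a_pos[OF one] \<xi>1])
    fix j
    obtain b where b: "b \<in> R" "b \<noteq> 0" "b * fps_to_fls (fps_X ^ j) \<in> R" using frac by blast
    then obtain b0 where b0: "b = fps_to_fls b0" using R_fps by auto
    then show "\<exists>b\<in>ev.R. b \<noteq> 0 \<and> b * fps_X ^ j \<in> ev.R"
      using b by (intro bexI[of _ b0]) (auto simp: R_iff simp flip: fls_times_fps_to_fls)
  qed
  then obtain c where c: "\<And>g. fps_X ^ c * g \<in> ev.R" by blast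
  have ker: "Idl\<^bsub>mps n\<^esub> (f ` {1..m}) = {g \<in> carrier (mps n). ev n \<xi> g = 0}"
    unfolding pres_ker[symmetric] by (auto simp: a_kernel_def kernel_def subr_simps me)
  interpret B: branch_presentation n \<xi> "a 1" c m f
  proof unfold_locales
    show "1 \<le> n" "0 < a 1" "\<xi> 1 = fps_X ^ a 1" by (rule n1, rule a_pos[OF one], rule \<xi>1)
    show "fps_X ^ c * g \<in> ev.R" for g by (rule c)
    show "f j \<in> carrier (mps n)" if "j \<in> {1..m}" for j by (rule f_mem[OF that])
    have "f ` {1..m} \<subseteq> Idl\<^bsub>mps n\<^esub> (f ` {1..m})" by (auto simp: genideal_def)
    then show "ev n \<xi> (f j) = 0" if "j \<in> {1..m}" for j using that unfolding ker by blast
    show "order_ge 2 g" if "g \<in> carrier (mps n)" "ev n \<xi> g = 0" for g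
      using pres_min maximal_ideal_square_order_ge that unfolding ker by blast
    show "g \<in> Idl\<^bsub>mps n\<^esub> (f ` {1..m})" if "g \<in> carrier (mps n)" "ev n \<xi> g = 0" for g
      using that unfolding ker by blast
  qed
  interpret T: torsion_free_branch n \<xi> "a 1" c m f
    by unfold_locales (rule B.torsion_freeI[OF x_fps tors[unfolded R_eq]])
  let ?I = "PIdl\<^bsub>subr R\<^esub> (x 1)"
  have x1R: "x 1 \<in> R" using x_mem M_R one by blast
  have I_ideal: "ideal ?I (subr R)" using x1R by (intro A.cgenideal_ideal) (simp add: subr_simps)
  interpret I: ideal ?I "subr R" by (rule I_ideal)
  have I_iff: "fps_to_fls g \<in> ?I \<longleftrightarrow> g \<in> (*) (\<xi> 1) ` ev.R" for g
  proof
    assume "fps_to_fls g \<in> ?I"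
    then obtain u where u: "u \<in> ev.R" "fps_to_fls g = fps_to_fls u * fps_to_fls (\<xi> 1)"
      unfolding cgenideal_def subr_simps R_eq x_fps[OF one] by blast
    then have "g = \<xi> 1 * u" unfolding fls_times_fps_to_fls[symmetric] by (simp add: mult.commute)
    with u(1) show "g \<in> (*) (\<xi> 1) ` ev.R" by blast
  next
    assume "g \<in> (*) (\<xi> 1) ` ev.R"
    then obtain u where u: "u \<in> ev.R" "g = \<xi> 1 * u" by blast
    then have "fps_to_fls g = fps_to_fls u * fps_to_fls (\<xi> 1)" by (simp add: fls_times_fps_to_fls)
    with u(1) show "fps_to_fls g \<in> ?I"
      unfolding cgenideal_def subr_simps R_eq x_fps[OF one] by blast
  qed
  have neg: "\<ominus>\<^bsub>subr R\<^esub> w = - w" if "w \<in> R" for w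
    by (rule A.minus_equality) (use that cl(3) in \<open>simp_all add: subr_simps\<close>)
  define Soc where "Soc = {z \<in> R. \<forall>y\<in>max_ideal (subr R). y * z \<in> ?I}"
  obtain z where z: "\<And>y. fps_to_fls y \<in> Soc \<Longrightarrow> \<exists>l. fps_to_fls (y - (\<Sum>i<r. fps_const (l i) * z i)) \<in> ?I"
    using quot_dim_span[OF ring const_R R_fps I_ideal _ cm_type[unfolded has_cm_type_def]]
    unfolding Soc_def by blast
  have cond_R: "conductor_plus R (x 1) \<subseteq> R"
  proof
    fix y assume "y \<in> conductor_plus R (x 1)"
    then obtain q w where "y = q + w * x 1" "q \<in> conductor R" "w \<in> R"
      by (auto simp: conductor_plus_def set_add_def' cgenideal_def subr_simps)
    \<comment> \<open>1 belongs to the integral closure, so the conductor lies in R.\<close>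
    moreover have "q * fps_to_fls 1 \<in> R" if "q \<in> conductor R" for q
      using that int unfolding conductor_def by blast
    ultimately show "y \<in> R" using x1R by (auto intro: cl)
  qed
  obtain w where w: "\<And>y. fps_to_fls y \<in> conductor_plus R (x 1) \<Longrightarrow> \<exists>l. fps_to_fls (y - (\<Sum>i<s. fps_const (l i) * w i)) \<in> ?I"
    using quot_dim_span[OF ring const_R R_fps I_ideal cond_R red_type[unfolded has_reduced_type_def]] by blast
  \<comment> \<open>In \<open>type_bound\<close>, C is taken to be the ideal generated by the
    conductor and x_1, pulled back to k[[t]].\<close>
  have "(n - 1) * (n - 2) \<le> 2 * (r + n * s)"
  proof (rule T.type_bound)
    fix y assume y: "y \<in> ev.R" and soc: "\<And>i. i \<in> {1..n} \<Longrightarrow> \<xi> i * y \<in> (*) (\<xi> 1) ` ev.R"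
    let ?y = "fps_to_fls y"
    \<comment> \<open>The multipliers of y into x_1 R form an ideal, so the socle condition passes
      from the generators x_i to the whole maximal ideal.\<close>
    let ?K = "{w \<in> R. w * ?y \<in> ?I}"
    have yR: "?y \<in> R" using y R_iff by simp
    have "ideal ?K (subr R)"
    proof (rule idealI)
      show "ring (subr R)" by (rule A.ring_axioms)
      show "subgroup ?K (add_monoid (subr R))"
      proof (rule A.add.subgroupI)
        show "?K \<noteq> {}"
          using additive_subgroup.zero_closed[OF I.is_additive_subgroup] A.zero_closed
          by (auto simp: subr_simps intro!: exI[of _ 0])
      next
        fix w assume w: "w \<in> ?K"
        then have "- (w * ?y) \<in> ?I"
          using I.a_inv_closed[of "w * ?y"] neg[of "w * ?y"] cl(2) yR by simp
        then show "\<ominus>\<^bsub>subr R\<^esub> w \<in> ?K" using w by (simp add: neg cl)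
      next
        fix w w' assume "w \<in> ?K" "w' \<in> ?K"
        then show "w \<oplus>\<^bsub>subr R\<^esub> w' \<in> ?K"
          using I.a_closed[of "w * ?y" "w' * ?y"] by (simp add: subr_simps cl distrib_right)
      qed (auto simp: subr_simps)
    next
      fix w u assume "w \<in> ?K" "u \<in> carrier (subr R)"
      then show "u \<otimes>\<^bsub>subr R\<^esub> w \<in> ?K" "w \<otimes>\<^bsub>subr R\<^esub> u \<in> ?K"
        using I.I_l_closed[of "w * ?y" u] by (simp_all add: subr_simps cl mult_ac)
    qed
    moreover have "x ` {1..n} \<subseteq> ?K"
    proof
      fix b assume "b \<in> x ` {1..n}"
      then obtain i where i: "i \<in> {1..n}" "b = x i" by blast
      have "x i * ?y = fps_to_fls (\<xi> i * y)" by (simp add: x_fps[OF i(1)] fls_times_fps_to_fls)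
      then have "x i * ?y \<in> ?I" using soc[OF i(1)] I_iff by simp
      then show "b \<in> ?K" using i x_mem M_R by blast
    qed
    ultimately have "max_ideal (subr R) \<subseteq> ?K" unfolding x_gen[symmetric] by (rule A.genideal_minimal)
    then have "?y \<in> Soc" using yR by (auto simp: Soc_def)
    from z[OF this] show "\<exists>l. y - (\<Sum>i<r. fps_const (l i) * z i) \<in> (*) (\<xi> 1) ` ev.R" unfolding I_iff .
  next
    fix y assume "y \<in> {g. fps_to_fls g \<in> conductor_plus R (x 1)}"
    then show "\<exists>l. y - (\<Sum>i<s. fps_const (l i) * w i) \<in> (*) (\<xi> 1) ` ev.R"
      using w[of y] unfolding I_iff by blast
  next
    fix g :: "(nat \<Rightarrow>\<^sub>0 nat) \<Rightarrow> 'a" assume "g \<in> carrier (mps n)" "order_ge 5 g"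
    from ev.order_ge_ideal_power[OF _ n1 this, of "max_ideal (subr R)"] x_mem
    have "fps_to_fls (ev n \<xi> g) \<in> ideal_power (subr R) (max_ideal (subr R)) 5"
      unfolding R_eq[symmetric] using x_fps by fastforce
    then show "ev n \<xi> g \<in> {g. fps_to_fls g \<in> conductor_plus R (x 1)}" using m5 by blast
  next
    fix y u assume "y \<in> {g. fps_to_fls g \<in> conductor_plus R (x 1)}" "u \<in> ev.R"
    then obtain q v where qv: "fps_to_fls y = q + v * x 1" "q \<in> conductor R" "v \<in> R" and u: "fps_to_fls u \<in> R"
      using R_iff by (auto simp: conductor_plus_def set_add_def' cgenideal_def subr_simps)
    have "fps_to_fls (\<xi> 1 * u + y) = q + (fps_to_fls u + v) * x 1"
      unfolding fps_to_fls_plus fls_times_fps_to_fls qv(1) x_fps[OF one] by (simp add: algebra_simps)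
    moreover have "fps_to_fls u + v \<in> R" using u qv(3) by (rule cl)
    ultimately show "\<xi> 1 * u + y \<in> {g. fps_to_fls g \<in> conductor_plus R (x 1)}"
      using qv(2) by (auto simp: conductor_plus_def set_add_def' cgenideal_def subr_simps)
  qed
  then have "real ((n - 1) * (n - 2)) \<le> real (2 * (r + n * s))" by (rule of_nat_mono)
  \<comment> \<open>The bound becomes n^2 - 3n + 2 \<le> 2r + 2ns, while the hypothesis on the type
    gives 2r + 2ns \<le> n^2 - 3n.\<close>
  moreover have "real ((n - 1) * (n - 2)) = real n ^ 2 - 3 * real n + 2"
  \<comment> \<open>For n = 1 the natural subtraction n - 2 is truncated, but both sides are
    0.\<close>
  proof (cases "n = 1")
    case False
    then obtain k where "n = k + 2" using n1 by (metis One_nat_def Suc_1 add.commute le_add_diff_inverse le_neq_implies_less Suc_leI)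
    then show ?thesis by (simp add: power2_eq_square algebra_simps)
  qed simp
  ultimately show False using type_le by (simp add: algebra_simps)
qed

end
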